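(* Let $\mathcal G$ be a separable complex Hilbert space and let $N:\mathbb C\setminus\mathbb R\to\mathcal L(\mathcal G)$ be a Nevanlinna function such that $N(z)^{-1}\in\mathcal L(\mathcal G)$ for some, and hence for all $z\in\mathbb C\setminus\mathbb R$. Assume that $N$ admits an analytic continuation by reflection with respect to an open interval $I\subset\mathbb R$ such that $\sigma(N(\zeta))\subset(\varepsilon,\infty)$ for some $\varepsilon>0$ and all $\zeta\in I$. Consider the integral representation $$\log(N(z))=C+\int_{\mathbb R}\Big(\frac1{\lambda-z}-\frac{\lambda}{1+\lambda^2}\Big)\Xi(\lambda)\,d\lambda,\quad z\in(\mathbb C\setminus\mathbb R)\cup I,$$ with $\Xi(\lambda)=\Xi(\lambda)^*$ and $0\le\Xi(\lambda)\le I_{\mathcal G}$ for a.e. $\lambda\in\mathbb R$, and assume, in addition, that for some $k\in\mathbb N_0$ and some $\zeta\in I$, $$\frac{d^{2k+1}}{d\zeta^{2k+1}}\log(N(\zeta))\in\mathfrak S_1(\mathcal G).$$ Then $$0\le\Xi(\lambda)\in\mathfrak S_1(\mathcal G)\quad\text{for a.e. }\lambda\in\mathbb R,$$ and $$\mathrm{tr}_{\mathcal G}(\Xi(\lambda))=\sum_{j\in J}\lim_{\varepsilon\downarrow0}\frac1\pi\big(\mathrm{Im}(\log(N(\lambda+i\varepsilon)))\varphi_j,\varphi_j\big)_{\mathcal G}$$ holds for any orthonormal basis $(\varphi_j)_{j\in J}$ in $\mathcal G$ ($J\subseteq\mathbb N$ an appropriate index set) and for a.e. $\lambda\in\mathbb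 R$. Furthermore, if the trace class assumption holds for some $\zeta\in I$ and $k=0$, that is, $\frac{d}{d\zeta}\log(N(\zeta))\in\mathfrak S_1(\mathcal G)$, then $\mathrm{Im}(\log(N(z)))\in\mathfrak S_1(\mathcal G)$ for all $z\in\mathbb C\setminus\mathbb R$, the limit $$\mathrm{Im}\big(\log(N(\lambda+i0))\big):=\lim_{\varepsilon\downarrow0}\mathrm{Im}\big(\log(N(\lambda+i\varepsilon))\big)\in\mathfrak S_1(\mathcal G)$$ exists for a.e. $\lambda\in\mathbb R$ in the norm of $\mathfrak S_1(\mathcal G)$, and $$\mathrm{tr}_{\mathcal G}(\Xi(\lambda))=\frac1\pi\mathrm{tr}_{\mathcal G}\big(\mathrm{Im}(\log(N(\lambda+i0)))\big)\quad\text{for a.e. }\lambda\in\mathbb R.$$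
   Context: $\mathcal L(\mathcal G)$ is the space of bounded operators on $\mathcal G$, $\mathfrak S_1(\mathcal G)$ the trace class; $\mathrm{Re}(K)=(K+K^* )/2$, $\mathrm{Im}(K)=(K-K^* )/(2i)$; $\mathbb C_\pm=\{z\mid\pm\mathrm{Im}(z)>0\}$. A function $N:\mathbb C_+\to\mathcal L(\mathcal G)$ is a Nevanlinna function if it is holomorphic and $\mathrm{Im}(N(z))\ge0$ for all $z\in\mathbb C_+$; it is extended to $\mathbb C_-$ by $N(z):=N(\overline z)^*$. It admits an analytic continuation by reflection with respect to an open subset $I\subset\mathbb R$ if $N$ can be continued analytically from $\mathbb C_+$ onto an open set $\mathcal O\subset\mathbb C$ containing $I$ such that the values of the continuation in $\mathcal O\cap\mathbb C_-$ coincide with the values $N(z)=N(\overline z)^*$ there; $N(\zeta)$, $\zeta\in I$, denotes the values of this continuation. If $N(z)^{-1}\in\mathcal L(\mathcal G)$ for $z\in\mathbb C\setminus\mathbb R$, then for $z\in\mathbb C_+$ $$\log(N(z)):=-i\int_0^\infty\big[(N(z)+i\lambda I_{\mathcal G})^{-1}-(1+i\lambda)^{-1}I_{\mathcal G}\big]\,d\lambda\in\mathcal L(\mathcal G),$$ and $\log(N(z)):=(\log(N(\overline z)))^*$ for $z\in\mathbb C_-$; this is again an $\mathcal L(\mathcal G)$-valued Nevanlinna function. Under the stated assumption on $I$, $\log(N)$ admits an analytic continuation by reflection with respect to $I$ (this continuation is meant by $\log(N(\zeta))$, $\zeta\in I$), and there exist the self-adjoint operator $C=\mathrm{Re}(\log(N(i)))\in\mathcal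 L(\mathcal G)$ and a weakly Lebesgue measurable function $\Xi:\mathbb R\to\mathcal L(\mathcal G)$ with the listed properties such that the integral representation (integral in the weak sense) holds; moreover $\Xi(\lambda)=0$ for a.e. $\lambda\in I$. *)

theory Defs
  imports "HOL-Analysis.Analysis"
begin

section \<open>Complex Hilbert spaces\<close>

class scaleC = scaleR +
  fixes scaleC :: "complex \<Rightarrow> 'a \<Rightarrow> 'a" (infixr \<open>*\<^sub>C\<close> 75)

class complex_normed_vector = real_normed_vector + scaleC +
  assumes scaleR_scaleC: "r *\<^sub>R x = complex_of_real r *\<^sub>C x"
    and scaleC_add_right: "a *\<^sub>C (x + y) = a *\<^sub>C x + a *\<^sub>C y"
    and scaleC_add_left: "(a + b) *\<^sub>C x = a *\<^sub>C x + b *\<^sub>C x"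
    and scaleC_scaleC: "a *\<^sub>C b *\<^sub>C x = (a * b) *\<^sub>C x"
    and norm_scaleC: "norm (a *\<^sub>C x) = cmod a * norm x"

text \<open>The inner product \<open>cinner\<close> is linear in its first argument. By \<open>inner_eq_Re_cinner\<close> the
  norm, and hence the topology and completeness, is the one induced by \<open>cinner\<close>.\<close>

class chilbert_space = real_inner + complete_space + complex_normed_vector +
  fixes cinner :: "'a \<Rightarrow> 'a \<Rightarrow> complex"
  assumes cinner_commute: "cinner x y = cnj (cinner y x)"
    and cinner_add_left: "cinner (x + y) z = cinner x z + cinner y z"
    and cinner_scaleC_left: "cinner (a *\<^sub>C x) y = a * cinner x y"
    and inner_eq_Re_cinner: "inner x y = Re (cinner x y)"

lemma vector_space_scaleC: "vector_space (scaleC :: complex \<Rightarrow> 'a::complex_normed_vector \<Rightarrow> 'a)"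
proof
  show "1 *\<^sub>C x = x" for x :: 'a
    using scaleR_scaleC[of 1 x] by simp
qed (simp_all add: scaleC_add_right scaleC_add_left scaleC_scaleC)

lemma bounded_linear_scaleC: "bounded_linear (\<lambda>x::'a::complex_normed_vector. c *\<^sub>C x)"
proof (rule bounded_linear_intro)
  show "c *\<^sub>C (r *\<^sub>R x) = r *\<^sub>R (c *\<^sub>C x)" for r and x :: 'a
    by (simp add: scaleR_scaleC scaleC_scaleC mult.commute)
  show "norm (c *\<^sub>C x) \<le> norm x * cmod c" for x :: 'a
    by (simp add: norm_scaleC mult.commute)
qed (rule scaleC_add_right)

instantiation blinfun :: (real_normed_vector, complex_normed_vector) complex_normed_vector
begin

lift_definition scaleC_blinfun :: "complex \<Rightarrow> 'a \<Rightarrow>\<^sub>L 'b \<Rightarrow> 'a \<Rightarrow>\<^sub>L 'b"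
  is "\<lambda>c f x. c *\<^sub>C f x"
  by (rule bounded_linear_compose[OF bounded_linear_scaleC])

instance
proof
  fix a b :: complex and r :: real and f g :: "'a \<Rightarrow>\<^sub>L 'b"
  show "r *\<^sub>R f = complex_of_real r *\<^sub>C f"
    by transfer (simp add: scaleR_scaleC)
  show "a *\<^sub>C (f + g) = a *\<^sub>C f + a *\<^sub>C g"
    by transfer (simp add: scaleC_add_right)
  show "(a + b) *\<^sub>C f = a *\<^sub>C f + b *\<^sub>C f"
    by transfer (simp add: scaleC_add_left)
  show "a *\<^sub>C b *\<^sub>C f = (a * b) *\<^sub>C f"
    by transfer (simp add: scaleC_scaleC)
  show "norm (a *\<^sub>C f) = cmod a * norm f"
  proof transfer
    fix a :: complex and f :: "'a \<Rightarrow> 'b"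
    assume f: "bounded_linear f"
    have "onorm (\<lambda>x. a *\<^sub>C f x) = onorm (\<lambda>x. cmod a *\<^sub>R f x)"
      by (simp add: onorm_def norm_scaleC)
    also have "\<dots> = cmod a * onorm f"
      using onorm_scaleR[OF f] by simp
    finally show "onorm (\<lambda>x. a *\<^sub>C f x) = cmod a * onorm f" .
  qed
qed

end

lemmas blinfun_apply_scaleC [simp] = scaleC_blinfun.rep_eq


section \<open>Bounded operators\<close>

text \<open>Elements of \<open>'a \<Rightarrow>\<^sub>L 'a\<close> are only real-linear; the complex-linear ones among them, with the same
  operator norm, form the space \<open>L(G)\<close>.\<close>

definition bounded_ops :: "('a::complex_normed_vector \<Rightarrow>\<^sub>L 'a) set" where
  "bounded_ops = {A :: 'a \<Rightarrow>\<^sub>L 'a. \<forall>c x. A (c *\<^sub>C x) = c *\<^sub>C A x}"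

definition op_adj :: "('a::chilbert_space \<Rightarrow>\<^sub>L 'a) \<Rightarrow> 'a \<Rightarrow>\<^sub>L 'a" where
  "op_adj A = (THE B :: 'a \<Rightarrow>\<^sub>L 'a. \<forall>x y. cinner (A x) y = cinner x (B y))"

definition op_Re :: "('a::chilbert_space \<Rightarrow>\<^sub>L 'a) \<Rightarrow> 'a \<Rightarrow>\<^sub>L 'a" where
  "op_Re A = (1 / 2) *\<^sub>C (A + op_adj A)"

definition op_Im :: "('a::chilbert_space \<Rightarrow>\<^sub>L 'a) \<Rightarrow> 'a \<Rightarrow>\<^sub>L 'a" where
  "op_Im A = (1 / (2 * \<i>)) *\<^sub>C (A - op_adj A)"

definition op_nonneg :: "('a::chilbert_space \<Rightarrow>\<^sub>L 'a) \<Rightarrow> bool" where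
  "op_nonneg A \<longleftrightarrow> (\<forall>x. cinner (A x) x \<in> \<real>\<^sub>\<ge>\<^sub>0)"

definition op_le :: "('a::chilbert_space \<Rightarrow>\<^sub>L 'a) \<Rightarrow> ('a \<Rightarrow>\<^sub>L 'a) \<Rightarrow> bool" where
  "op_le A B \<longleftrightarrow> op_nonneg (B - A)"

definition op_invertible :: "('a::complex_normed_vector \<Rightarrow>\<^sub>L 'a) \<Rightarrow> bool" where
  "op_invertible A \<longleftrightarrow> (\<exists>B. A o\<^sub>L B = id_blinfun \<and> B o\<^sub>L A = id_blinfun)"

definition op_inverse :: "('a::complex_normed_vector \<Rightarrow>\<^sub>L 'a) \<Rightarrow> 'a \<Rightarrow>\<^sub>L 'a" where
  "op_inverse A = (THE B. A o\<^sub>L B = id_blinfun \<and> B o\<^sub>L A = id_blinfun)"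

definition op_spectrum :: "('a::complex_normed_vector \<Rightarrow>\<^sub>L 'a) \<Rightarrow> complex set" where
  "op_spectrum A = {c. \<not> op_invertible (A - c *\<^sub>C id_blinfun)}"


section \<open>Trace class\<close>

definition is_onb :: "'a::chilbert_space set \<Rightarrow> bool" where
  "is_onb B \<longleftrightarrow> (\<forall>x\<in>B. \<forall>y\<in>B. cinner x y = (if x = y then 1 else 0)) \<and>
     closure (module.span scaleC B) = UNIV"

definition some_onb :: "'a::chilbert_space set" where
  "some_onb = (SOME B. is_onb B)"

text \<open>The modulus \<open>(A\<^sup>* A)\<^bsup>1/2\<^esup>\<close>.\<close>

definition op_abs :: "('a::chilbert_space \<Rightarrow>\<^sub>L 'a) \<Rightarrow> 'a \<Rightarrow>\<^sub>L 'a" where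
  "op_abs A = (THE P. P \<in> bounded_ops \<and> op_nonneg P \<and> P o\<^sub>L P = op_adj A o\<^sub>L A)"

definition trace_class :: "('a::chilbert_space \<Rightarrow>\<^sub>L 'a) \<Rightarrow> bool" where
  "trace_class A \<longleftrightarrow> A \<in> bounded_ops \<and>
     (\<exists>B. is_onb B \<and> (\<lambda>e. cinner (op_abs A e) e) summable_on B)"

text \<open>Meaningful for trace class operators only; the value does not depend on the chosen basis.\<close>

definition op_trace :: "('a::chilbert_space \<Rightarrow>\<^sub>L 'a) \<Rightarrow> complex" where
  "op_trace A = (\<Sum>\<^sub>\<infinity>e\<in>some_onb. cinner (A e) e)"

definition trace_norm :: "('a::chilbert_space \<Rightarrow>\<^sub>L 'a) \<Rightarrow> real" where
  "trace_norm A = Re (op_trace (op_abs A))"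


section \<open>Nevanlinna functions\<close>

definition vholomorphic_on :: "(complex \<Rightarrow> 'b::complex_normed_vector) \<Rightarrow> complex set \<Rightarrow> bool"
    (infix \<open>vholomorphic'_on\<close> 50) where
  "f vholomorphic_on S \<longleftrightarrow> (\<forall>z\<in>S. \<exists>D. (f has_derivative (\<lambda>h. h *\<^sub>C D)) (at z within S))"

text \<open>Functions on the complex plane without the real line are modelled as total functions whose
  values on the real line are irrelevant.\<close>

definition nevanlinna :: "(complex \<Rightarrow> 'a::chilbert_space \<Rightarrow>\<^sub>L 'a) \<Rightarrow> bool" where
  "nevanlinna N \<longleftrightarrow>
     (\<forall>z. Im z > 0 \<longrightarrow> N z \<in> bounded_ops) \<and>
     N vholomorphic_on {z. Im z > 0} \<and>
     (\<forall>z. Im z > 0 \<longrightarrow> op_nonneg (op_Im (N z))) \<and>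
     (\<forall>z. Im z < 0 \<longrightarrow> N z = op_adj (N (cnj z)))"

text \<open>\<open>M\<close> is an analytic continuation of \<open>N\<close> by reflection with respect to \<open>I\<close>: it is analytic on
  the upper half-plane together with an open neighbourhood of \<open>I\<close>, and it agrees with \<open>N\<close> off the
  real line, in particular in the part of that neighbourhood in the lower half-plane.\<close>

definition reflection_continuation ::
    "(complex \<Rightarrow> 'a::chilbert_space \<Rightarrow>\<^sub>L 'a) \<Rightarrow> real set \<Rightarrow> (complex \<Rightarrow> 'a \<Rightarrow>\<^sub>L 'a) \<Rightarrow> bool" where
  "reflection_continuation N I M \<longleftrightarrow>
     (\<forall>z. Im z \<noteq> 0 \<longrightarrow> M z = N z) \<and>
     (\<exists>U. open U \<and> complex_of_real ` I \<subseteq> U \<and>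
        (\<forall>z\<in>{z. Im z > 0} \<union> U. M z \<in> bounded_ops) \<and>
        M vholomorphic_on ({z. Im z > 0} \<union> U))"

definition admits_reflection_continuation ::
    "(complex \<Rightarrow> 'a::chilbert_space \<Rightarrow>\<^sub>L 'a) \<Rightarrow> real set \<Rightarrow> bool" where
  "admits_reflection_continuation N I \<longleftrightarrow> (\<exists>M. reflection_continuation N I M)"

text \<open>The common value at \<open>z\<close> of all continuations by reflection. It is determined for
  \<open>z\<close> in \<open>I\<close> by continuity, and it is \<open>N z\<close> off the real line.\<close>

definition refl_ext ::
    "(complex \<Rightarrow> 'a::chilbert_space \<Rightarrow>\<^sub>L 'a) \<Rightarrow> real set \<Rightarrow> complex \<Rightarrow> 'a \<Rightarrow>\<^sub>L 'a" where
  "refl_ext N I z = (THE A. \<exists>M. reflection_continuation N I M \<and> M z = A)"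

text \<open>The integral converges in operator norm.\<close>

definition op_log :: "('a::chilbert_space \<Rightarrow>\<^sub>L 'a) \<Rightarrow> 'a \<Rightarrow>\<^sub>L 'a" where
  "op_log A = (- \<i>) *\<^sub>C integral {0..} (\<lambda>t::real.
     op_inverse (A + (\<i> * complex_of_real t) *\<^sub>C id_blinfun)
       - inverse (1 + \<i> * complex_of_real t) *\<^sub>C id_blinfun)"

definition nev_log :: "(complex \<Rightarrow> 'a::chilbert_space \<Rightarrow>\<^sub>L 'a) \<Rightarrow> complex \<Rightarrow> 'a \<Rightarrow>\<^sub>L 'a" where
  "nev_log N z = (if Im z > 0 then op_log (N z) else op_adj (op_log (N (cnj z))))"

definition nth_vector_derivative :: "nat \<Rightarrow> (real \<Rightarrow> 'b::real_normed_vector) \<Rightarrow> real \<Rightarrow> 'b" where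
  "nth_vector_derivative n f = ((\<lambda>g t. vector_derivative g (at t)) ^^ n) f"


section \<open>Weak measurability and weak integrals\<close>

definition weakly_measurable :: "(real \<Rightarrow> 'a::chilbert_space \<Rightarrow>\<^sub>L 'a) \<Rightarrow> bool" where
  "weakly_measurable F \<longleftrightarrow> (\<forall>x y. (\<lambda>t. cinner (F t x) y) \<in> borel_measurable lebesgue)"

definition has_weak_integral ::
    "(real \<Rightarrow> 'a::chilbert_space \<Rightarrow>\<^sub>L 'a) \<Rightarrow> ('a \<Rightarrow>\<^sub>L 'a) \<Rightarrow> bool" where
  "has_weak_integral F A \<longleftrightarrow>
     (\<forall>x y. has_bochner_integral lebesgue (\<lambda>t. cinner (F t x) y) (cinner (A x) y))"

end

theory Submission
  imports Defs "HOL-Complex_Analysis.Complex_Analysis"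
begin

text \<open>
  The idea is to read the traces off the odd derivatives of \<open>log N\<close> on \<open>I\<close>. On the interval \<open>I\<close> the continuation of
  \<open>N\<close> is a positive operator, \<open>log N\<close> is symmetric there, and its imaginary part, which is \<open>\<pi> \<Xi>\<close> at almost
  every boundary point, vanishes on \<open>I\<close>. So near a point \<open>\<zeta>\<close> of \<open>I\<close> the representation may be
  differentiated under the integral sign, and the derivative of order \<open>2 k + 1\<close> is
  \<open>(2 k + 1)! \<integral> (t - \<zeta>)\<^bsup>-2k-2\<^esup> \<Xi>(t) dt\<close>. The exponent is even. The derivative is hence a positive operator, and
  by monotone convergence its trace is the integral of the traces of \<open>\<Xi>(t)\<close> against the same positive
  weight (\<open>weighted_trace_finite\<close>). If it is finite, \<open>\<Xi>(t)\<close> is trace class for almost every \<open>t\<close>, and the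
  diagonal entries of \<open>\<Xi>(t)\<close> in any basis sum to the trace. Each of them is the boundary value of a Poisson
  integral, the diagonal entry of \<open>Im (log N(t + i \<epsilon>)) / \<pi>\<close>, which gives the formula for the trace.

  For \<open>k = 0\<close> the weight \<open>(t - \<zeta>)\<^sup>-\<^sup>2\<close> dominates \<open>1 / (1 + t\<^sup>2)\<close>, so that the trace of \<open>\<Xi>\<close> itself has
  finite Poisson integrals, which are the traces of \<open>Im (log N(z))\<close>.
  At almost every \<open>t\<close> the entries and the traces of the positive operators \<open>Im (log N(t + i \<epsilon>))\<close> converge
  to those of \<open>\<pi> \<Xi>(t)\<close>. For positive operators this already is convergence in trace norm
  (\<open>trace_norm_convergence\<close>), just as in Scheffe's lemma for densities: the difference is compared with
  its compression to a finite part of the basis, and the rest is controlled by the traces.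

  The almost everywhere convergence of Poisson integrals (\<open>poisson_limit_AE\<close>) rests on the symmetric
  differentiation of indefinite integrals, which follows from Henstock's lemma and Vitali's covering
  theorem, and on writing the Poisson kernel as a mixture of uniform densities.

  That the continuation of \<open>log N\<close> across \<open>I\<close> exists at all (\<open>nev_log_reflection_continuation\<close>) has two
  ingredients. Invertibility of \<open>N\<close> at one point spreads to the half-plane by the Schwarz-Pick lemma
  (\<open>nevanlinna_invertible\<close>). Near \<open>I\<close> the continued \<open>N\<close> has positive real part, the integral for the logarithm
  converges there as well and depends analytically on the operator, and
  \<open>log A\<^sup>* = (log A)\<^sup>*\<close> holds for such operators, because both sides have the same derivative along the
  segment from the identity to \<open>A\<close> (\<open>op_adj_op_log\<close>).
\<close>

text \<open>Completeness of the operator space over \<open>'a\<close> is an instance for codomains of class \<open>banach\<close>.\<close>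

instance chilbert_space \<subseteq> banach ..

section \<open>Inner products, Riesz representation and adjoints\<close>

lemma scaleC_one [simp]: "1 *\<^sub>C x = (x::'a::complex_normed_vector)"
  using scaleR_scaleC[of 1 x] by simp

lemma scaleC_zero_left [simp]: "0 *\<^sub>C x = (0::'a::complex_normed_vector)"
  using scaleR_scaleC[of 0 x] by simp

lemma scaleC_of_real [simp]: "complex_of_real r *\<^sub>C x = r *\<^sub>R (x::'a::complex_normed_vector)"
  by (simp add: scaleR_scaleC)

lemma bounded_bilinear_scaleC:
  "bounded_bilinear (scaleC :: complex \<Rightarrow> 'a::complex_normed_vector \<Rightarrow> 'a)"
proof
  fix a b :: complex and x y :: 'a and r :: real
  show "(r *\<^sub>R a) *\<^sub>C x = r *\<^sub>R a *\<^sub>C x"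
    by (simp add: scaleR_scaleC scaleC_scaleC scaleR_conv_of_real del: scaleC_of_real)
  show "a *\<^sub>C r *\<^sub>R x = r *\<^sub>R a *\<^sub>C x"
    by (simp add: scaleR_scaleC scaleC_scaleC mult.commute del: scaleC_of_real)
  show "\<exists>K. \<forall>(a::complex) (b::'a). norm (a *\<^sub>C b) \<le> norm a * norm b * K"
    by (intro exI[of _ 1]) (simp add: norm_scaleC)
qed (simp_all add: scaleC_add_left scaleC_add_right)

interpretation scaleC: bounded_bilinear
  "scaleC :: complex \<Rightarrow> 'a::complex_normed_vector \<Rightarrow> 'a"
  by (rule bounded_bilinear_scaleC)

declare scaleC.zero_right [simp]

lemma cinner_add_right: "cinner x (y + z) = cinner x y + cinner x (z::'a::chilbert_space)"
  by (metis cinner_commute cinner_add_left complex_cnj_add)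

lemma cinner_scaleC_right: "cinner x (a *\<^sub>C y) = cnj a * cinner x (y::'a::chilbert_space)"
  by (metis cinner_commute cinner_scaleC_left complex_cnj_mult)

lemma cinner_self: "cinner x x = complex_of_real ((norm (x::'a::chilbert_space))\<^sup>2)"
proof -
  have "Im (cinner x x) = 0"
    using cinner_commute[of x x] by (metis complex_cnj_cancel_iff Reals_cnj_iff complex_is_Real_iff)
  moreover have "Re (cinner x x) = (norm x)\<^sup>2"
    by (simp add: inner_eq_Re_cinner[symmetric] power2_norm_eq_inner)
  ultimately show ?thesis by (simp add: complex_eq_iff)
qed

lemma cinner_scaleR_left: "cinner (r *\<^sub>R x) y = r *\<^sub>R cinner x (y::'a::chilbert_space)"
  by (simp add: scaleR_scaleC cinner_scaleC_left scaleR_conv_of_real del: scaleC_of_real)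

lemma cinner_scaleR_right: "cinner x (r *\<^sub>R y) = r *\<^sub>R cinner x (y::'a::chilbert_space)"
  by (simp add: scaleR_scaleC cinner_scaleC_right scaleR_conv_of_real del: scaleC_of_real)

lemma norm_cinner_le: "cmod (cinner x y) \<le> norm x * norm (y::'a::chilbert_space)"
proof -
  define c where "c = cnj (sgn (cinner x y))"
  have "complex_of_real (cmod (cinner x y)) = cinner (c *\<^sub>C x) y"
    by (auto simp: cinner_scaleC_left c_def sgn_div_norm scaleR_conv_of_real mult.commute
        field_simps power2_eq_square complex_norm_square[symmetric])
  then have "cmod (cinner x y) = inner (c *\<^sub>C x) y"
    by (metis inner_eq_Re_cinner Re_complex_of_real)
  also have "\<dots> \<le> norm (c *\<^sub>C x) * norm y" by (rule norm_cauchy_schwarz)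
  also have "\<dots> \<le> norm x * norm y"
    by (auto simp: norm_scaleC c_def norm_sgn intro!: mult_right_mono)
  finally show ?thesis .
qed

lemma bounded_bilinear_cinner: "bounded_bilinear (cinner :: 'a::chilbert_space \<Rightarrow> 'a \<Rightarrow> complex)"
  by standard (auto simp: cinner_add_left cinner_add_right cinner_scaleR_left cinner_scaleR_right
      intro!: exI[of _ 1] norm_cinner_le)

interpretation cinner: bounded_bilinear "cinner :: 'a::chilbert_space \<Rightarrow> 'a \<Rightarrow> complex"
  by (rule bounded_bilinear_cinner)

lemmas cinner_zero [simp] = cinner.zero_left cinner.zero_right

lemmas cinner_simps = cinner_add_left cinner_add_right cinner_scaleC_left cinner_scaleC_right
  cinner_scaleR_left cinner_scaleR_right cinner.diff_left cinner.diff_right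
  cinner.minus_left cinner.minus_right

lemma cinner_eqI: "(\<And>y. cinner x y = cinner z y) \<Longrightarrow> x = (z::'a::chilbert_space)"
  using cinner_self[of "x - z"] by (simp add: cinner.diff_left)

lemma cinner_eqI_right: "(\<And>y. cinner y x = cinner y z) \<Longrightarrow> x = (z::'a::chilbert_space)"
  by (metis cinner_commute cinner_eqI)

lemma norm_blinfun_le_cinner:
  fixes A :: "'a::chilbert_space \<Rightarrow>\<^sub>L 'a"
  assumes "\<And>x y. cmod (cinner (A x) y) \<le> M * norm x * norm y" "M \<ge> 0"
  shows "norm A \<le> M"
proof (rule norm_blinfun_bound[OF assms(2)])
  fix x
  have "(norm (A x))\<^sup>2 = cmod (cinner (A x) (A x))" by (simp add: cinner_self norm_power)
  also have "\<dots> \<le> (M * norm x) * norm (A x)" using assms(1)[of x "A x"] by simp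
  finally show "norm (A x) \<le> M * norm x"
    using assms(2) by (cases "A x = 0") (auto simp: power2_eq_square)
qed

lemma cmod_cinner_blinfun_le:
  "cmod (cinner ((A::'a::chilbert_space \<Rightarrow>\<^sub>L 'a) x) y) \<le> norm A * norm x * norm y"
  by (meson norm_cinner_le norm_blinfun mult_right_mono norm_ge_zero order_trans)

text \<open>The representing vector minimises \<open>\<parallel>x\<parallel>\<^sup>2 - 2 f x\<close>; minimising sequences are Cauchy by the
  parallelogram law.\<close>

lemma riesz_representation:
  fixes f :: "'a::{real_inner,complete_space} \<Rightarrow> real"
  assumes f: "bounded_linear f"
  shows "\<exists>z. \<forall>x. f x = inner z x"
proof -
  interpret f: bounded_linear f by (rule f)
  obtain K where K: "\<And>x. norm (f x) \<le> norm x * K" using f.bounded by blast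
  define J where "J x = (norm x)\<^sup>2 - 2 * f x" for x
  have lb: "- K\<^sup>2 \<le> J x" for x
  proof -
    have "f x \<le> norm x * K" using K[of x] by simp
    moreover have "0 \<le> (norm x - K)\<^sup>2" by simp
    ultimately show ?thesis unfolding J_def power2_diff by (simp add: mult.assoc)
  qed
  define m where "m = (INF x. J x)"
  have bdd: "bdd_below (range J)" using lb by (intro bdd_belowI) auto
  have mJ: "m \<le> J x" for x unfolding m_def by (rule cINF_lower[OF bdd]) simp
  have "\<exists>x. J x < m + 1 / real (Suc n)" for n
  proof -
    have "\<exists>y\<in>range J. y < m + 1 / real (Suc n)"
      unfolding m_def by (subst cInf_less_iff[symmetric]) (auto simp: bdd)
    then show ?thesis by auto
  qed
  then obtain X where X: "\<And>n. J (X n) < m + 1 / real (Suc n)" by metis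
  have par: "(norm (x - y))\<^sup>2 \<le> 2 * (J x - m) + 2 * (J y - m)" for x y
  proof -
    have "4 * J ((1/2) *\<^sub>R (x + y)) = (norm (x + y))\<^sup>2 - 4 * (f x + f y)"
      by (simp add: J_def f.scaleR f.add power_divide algebra_simps del: scaleR_add_right)
    moreover have "(norm (x + y))\<^sup>2 + (norm (x - y))\<^sup>2 = 2 * (norm x)\<^sup>2 + 2 * (norm y)\<^sup>2"
      by (simp add: power2_norm_eq_inner algebra_simps inner_commute)
    ultimately show ?thesis using mJ[of "(1/2) *\<^sub>R (x + y)"] by (simp add: J_def)
  qed
  have "Cauchy X"
  proof (rule metric_CauchyI)
    fix e :: real assume e: "e > 0"
    then obtain M where M: "inverse (real (Suc M)) < e\<^sup>2 / 4"
      using reals_Archimedean[of "e\<^sup>2 / 4"] by auto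
    show "\<exists>M. \<forall>m\<ge>M. \<forall>n\<ge>M. dist (X m) (X n) < e"
    proof (intro exI[of _ M] allI impI)
      fix i j assume ij: "M \<le> i" "M \<le> j"
      have s: "J (X i) - m < e\<^sup>2 / 4" if "M \<le> i" for i
      proof -
        have "1 / real (Suc i) \<le> inverse (real (Suc M))" using that by (simp add: field_simps)
        then show ?thesis using X[of i] M by linarith
      qed
      have "(norm (X i - X j))\<^sup>2 < e\<^sup>2" 
        using par[of "X i" "X j"] s[OF ij(1)] s[OF ij(2)] by (simp add: field_simps)
      then show "dist (X i) (X j) < e" using e by (simp add: dist_norm power_less_imp_less_base)
    qed
  qed
  then obtain z where z: "X \<longlonglongrightarrow> z" by (meson complete_space_class.Cauchy_convergent convergent_def)
  have "(\<lambda>n. J (X n)) \<longlonglongrightarrow> J z" unfolding J_def by (intro tendsto_intros f.tendsto z)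
  moreover have "(\<lambda>n. m + 1 / real (Suc n)) \<longlonglongrightarrow> m + 0"
    by (intro tendsto_intros LIMSEQ_Suc lim_1_over_n)
  ultimately have "J z \<le> m" using X by (intro LIMSEQ_le[of "\<lambda>n. J (X n)"]) (auto intro: less_imp_le)
  then have min: "J z \<le> J (z + t *\<^sub>R y)" for t y using mJ order_trans by blast
  have "f y = inner z y" for y
  proof -
    define b where "b = inner z y - f y"
    define n where "n = (norm y)\<^sup>2"
    \<comment> \<open>the step in direction \<open>y\<close> that makes the linear term negative and dominant\<close>
    define t where "t = - b / (n + 1)"
    have n: "n \<ge> 0" by (simp add: n_def)
    have "0 \<le> 2 * t * b + t\<^sup>2 * n"
      using min[of t y] unfolding J_def b_def n_def power2_norm_eq_inner
      by (simp add: f.add f.scaleR inner_commute algebra_simps power2_eq_square)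
    also have "\<dots> = - (b\<^sup>2 * (n + 2) / (n + 1)\<^sup>2)"
      using n unfolding t_def by (simp add: divide_simps power2_eq_square) algebra
    finally have "b\<^sup>2 * (n + 2) / (n + 1)\<^sup>2 \<le> 0" by simp
    then have "b\<^sup>2 * (n + 2) \<le> 0" using n by (simp add: divide_le_0_iff)
    then have "b = 0" using n by (simp add: mult_le_0_iff)
    then show ?thesis by (simp add: b_def)
  qed
  then show ?thesis by blast
qed

lemma bounded_opsI:
  fixes A :: "'a::complex_normed_vector \<Rightarrow>\<^sub>L 'a"
  shows "(\<And>c x. A (c *\<^sub>C x) = c *\<^sub>C A x) \<Longrightarrow> A \<in> bounded_ops"
  by (simp add: bounded_ops_def)

lemma bounded_opsD:
  fixes A :: "'a::complex_normed_vector \<Rightarrow>\<^sub>L 'a"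
  shows "A \<in> bounded_ops \<Longrightarrow> A (c *\<^sub>C x) = c *\<^sub>C A x"
  by (simp add: bounded_ops_def)

lemma bounded_ops_add: "A \<in> bounded_ops \<Longrightarrow> B \<in> bounded_ops \<Longrightarrow> A + B \<in> bounded_ops"
  by (simp add: bounded_ops_def blinfun.add_left scaleC.add_right)
lemma bounded_ops_diff: "A \<in> bounded_ops \<Longrightarrow> B \<in> bounded_ops \<Longrightarrow> A - B \<in> bounded_ops"
  by (simp add: bounded_ops_def blinfun.diff_left scaleC.diff_right)
lemma bounded_ops_scaleC: "A \<in> bounded_ops \<Longrightarrow> c *\<^sub>C A \<in> bounded_ops"
  by (simp add: bounded_ops_def scaleC_scaleC mult.commute)
lemma bounded_ops_scaleR: "A \<in> bounded_ops \<Longrightarrow> c *\<^sub>R A \<in> bounded_ops"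
  by (simp add: scaleR_scaleC bounded_ops_scaleC del: scaleC_of_real)
lemma bounded_ops_compose: "A \<in> bounded_ops \<Longrightarrow> B \<in> bounded_ops \<Longrightarrow> A o\<^sub>L B \<in> bounded_ops"
  by (simp add: bounded_ops_def)
lemma bounded_ops_id: "id_blinfun \<in> bounded_ops"
  by (simp add: bounded_ops_def)
lemma bounded_ops_zero: "0 \<in> bounded_ops"
  by (simp add: bounded_ops_def)
lemma bounded_ops_uminus: "A \<in> bounded_ops \<Longrightarrow> - A \<in> bounded_ops"
  by (simp add: bounded_ops_def blinfun.minus_left scaleC.minus_right)

lemmas bounded_ops_intros = bounded_ops_add bounded_ops_diff bounded_ops_scaleC bounded_ops_scaleR
  bounded_ops_compose bounded_ops_id bounded_ops_zero bounded_ops_uminus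

lemma closed_bounded_ops: "closed (bounded_ops :: ('a::complex_normed_vector \<Rightarrow>\<^sub>L 'a) set)"
proof -
  have "bounded_ops = (\<Inter>c. \<Inter>x. {A :: 'a \<Rightarrow>\<^sub>L 'a. A (c *\<^sub>C x) = c *\<^sub>C A x})"
    by (auto simp: bounded_ops_def)
  also have "closed \<dots>"
    by (intro closed_INT ballI closed_Collect_eq continuous_intros
        bounded_linear.continuous_on[OF bounded_linear_scaleC])
  finally show ?thesis .
qed

text \<open>Only the real part of the form has to be represented: the imaginary part is the real part at
  \<open>\<i> y\<close>.\<close>
lemma sesquilinear_representation:
  fixes s :: "'a::chilbert_space \<Rightarrow> 'a \<Rightarrow> complex"
  assumes al: "\<And>x y z. s (x + y) z = s x z + s y z" and cl: "\<And>c x y. s (c *\<^sub>C x) y = c * s x y"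
    and ar: "\<And>x y z. s x (y + z) = s x y + s x z" and cr: "\<And>c x y. s x (c *\<^sub>C y) = cnj c * s x y"
    and M: "\<And>x y. cmod (s x y) \<le> M * norm x * norm y"
  obtains A where "A \<in> bounded_ops" "\<And>x y. cinner (A x) y = s x y"
proof -
  have "\<exists>z. \<forall>y. cinner z y = s x y" for x
  proof -
    have "bounded_linear (\<lambda>y. Re (s x y))"
    proof (rule bounded_linear_intro)
      show "Re (s x (r *\<^sub>R y)) = r *\<^sub>R Re (s x y)" for r y
        using cr[of x "complex_of_real r" y] by simp
      show "norm (Re (s x y)) \<le> norm y * (M * norm x)" for y
        using M[of x y] abs_Re_le_cmod[of "s x y"] by (simp add: mult.commute)
    qed (simp add: ar)
    then obtain z where z: "\<And>y. Re (s x y) = inner z y" using riesz_representation by blast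
    have "cinner z y = s x y" for y
    proof (rule complex_eqI)
      show "Re (cinner z y) = Re (s x y)" by (simp add: z inner_eq_Re_cinner)
      have "Re (cinner z (\<i> *\<^sub>C y)) = Re (s x (\<i> *\<^sub>C y))" by (simp add: z inner_eq_Re_cinner)
      then show "Im (cinner z y) = Im (s x y)" by (simp add: cinner_scaleC_right cr)
    qed
    then show ?thesis by blast
  qed
  then obtain F where F: "\<And>x y. cinner (F x) y = s x y" by metis
  have add: "F (x + y) = F x + F y" for x y
    by (rule cinner_eqI) (simp add: F al cinner_simps)
  have scC: "F (c *\<^sub>C x) = c *\<^sub>C F x" for c x
    by (rule cinner_eqI) (simp add: F cl cinner_simps)
  have "norm (F x) \<le> norm x * \<bar>M\<bar>" for x
  proof -
    have "(norm (F x))\<^sup>2 = cmod (s x (F x))" by (simp add: F[symmetric] cinner_self norm_power)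
    also have "\<dots> \<le> (M * norm x) * norm (F x)" using M[of x "F x"] by simp
    also have "\<dots> \<le> (norm x * \<bar>M\<bar>) * norm (F x)"
      by (intro mult_right_mono) (auto simp: mult.commute mult_right_mono)
    finally show ?thesis by (cases "F x = 0") (auto simp: power2_eq_square)
  qed
  then have "bounded_linear F"
    using scC[of "complex_of_real _"] by (intro bounded_linear_intro[of _ "\<bar>M\<bar>"]) (auto simp: add)
  then have A: "blinfun_apply (Blinfun F) = F" by (rule bounded_linear_Blinfun_apply)
  show thesis by (rule that[of "Blinfun F"]) (auto simp: A F scC bounded_ops_def)
qed

lemma op_adj_unique:
  fixes A B :: "'a::chilbert_space \<Rightarrow>\<^sub>L 'a"
  assumes "\<And>x y. cinner (A x) y = cinner x (B y)"
  shows "op_adj A = B"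
  unfolding op_adj_def
proof (rule the_equality)
  fix D :: "'a \<Rightarrow>\<^sub>L 'a" assume D: "\<forall>x y. cinner (A x) y = cinner x (D y)"
  show "D = B" by (intro blinfun_eqI cinner_eqI_right) (metis D assms)
qed (use assms in blast)

lemma op_adj_exists:
  fixes A :: "'a::chilbert_space \<Rightarrow>\<^sub>L 'a"
  assumes "A \<in> bounded_ops"
  obtains B where "B \<in> bounded_ops" "\<And>x y. cinner (A x) y = cinner x (B y)"
proof -
  obtain B where B: "B \<in> bounded_ops" "\<And>x y. cinner (B x) y = cinner x (A y)"
  proof (rule sesquilinear_representation[of "\<lambda>x y. cinner x (A y)" "norm A"])
    show "cmod (cinner x (A y)) \<le> norm A * norm x * norm y" for x y
      using cmod_cinner_blinfun_le[of A y x] cinner_commute[of x "A y"]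
      by (simp add: mult.assoc mult.left_commute mult.commute[of "norm y"])
  qed (auto simp: cinner_simps blinfun.add_right bounded_opsD[OF assms])
  then show thesis using that[of B] by (metis cinner_commute)
qed

lemma op_adj_in_bounded_ops: "A \<in> bounded_ops \<Longrightarrow> op_adj A \<in> bounded_ops"
  using op_adj_exists[of A] op_adj_unique by metis

lemma cinner_op_adj: "A \<in> bounded_ops \<Longrightarrow> cinner (A x) y = cinner x (op_adj A y)"
  using op_adj_exists[of A] op_adj_unique by metis

lemma cinner_op_adj': "A \<in> bounded_ops \<Longrightarrow> cinner x (A y) = cinner (op_adj A x) y"
  by (metis cinner_op_adj cinner_commute)

lemma op_adj_op_adj: "A \<in> bounded_ops \<Longrightarrow> op_adj (op_adj A) = A"
  by (rule op_adj_unique) (simp add: cinner_op_adj')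

lemma op_adj_add: "A \<in> bounded_ops \<Longrightarrow> B \<in> bounded_ops \<Longrightarrow> op_adj (A + B) = op_adj A + op_adj B"
  by (rule op_adj_unique) (simp add: cinner_op_adj cinner_simps blinfun.add_left)

lemma op_adj_diff: "A \<in> bounded_ops \<Longrightarrow> B \<in> bounded_ops \<Longrightarrow> op_adj (A - B) = op_adj A - op_adj B"
  by (rule op_adj_unique) (simp add: cinner_op_adj cinner_simps blinfun.diff_left)

lemma op_adj_scaleC: "A \<in> bounded_ops \<Longrightarrow> op_adj (c *\<^sub>C A) = cnj c *\<^sub>C op_adj A"
  by (rule op_adj_unique) (simp add: cinner_op_adj cinner_simps)

lemma op_adj_compose:
  "A \<in> bounded_ops \<Longrightarrow> B \<in> bounded_ops \<Longrightarrow> op_adj (A o\<^sub>L B) = op_adj B o\<^sub>L op_adj A"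
  by (rule op_adj_unique) (simp add: cinner_op_adj)

lemma op_adj_id: "op_adj id_blinfun = id_blinfun"
  by (rule op_adj_unique) simp

lemma norm_op_adj: 
  assumes "A \<in> bounded_ops" shows "norm (op_adj A) = norm A"
proof -
  have le: "norm (op_adj A) \<le> norm A" if "A \<in> bounded_ops" for A :: "'a \<Rightarrow>\<^sub>L 'a"
  proof (rule norm_blinfun_le_cinner)
    fix x y
    have "cmod (cinner (op_adj A x) y) = cmod (cinner (A y) x)"
      by (metis cinner_commute cinner_op_adj complex_mod_cnj that)
    then show "cmod (cinner (op_adj A x) y) \<le> norm A * norm x * norm y"
      using cmod_cinner_blinfun_le[of A y x] by (simp add: mult_ac)
  qed simp
  show ?thesis using le[OF assms] le[OF op_adj_in_bounded_ops[OF assms]] op_adj_op_adj[OF assms] by simp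
qed

lemma tendsto_op_adj:
  assumes f: "(f \<longlongrightarrow> A) F" and b: "\<forall>\<^sub>F x in F. f x \<in> bounded_ops" "A \<in> bounded_ops"
  shows "((\<lambda>x. op_adj (f x)) \<longlongrightarrow> op_adj A) F"
proof -
  have "((\<lambda>x. norm (f x - A)) \<longlongrightarrow> 0) F" using f by (simp add: tendsto_norm_zero LIM_zero)
  moreover have "\<forall>\<^sub>F x in F. norm (f x - A) = norm (op_adj (f x) - op_adj A)"
    using b(1) by eventually_elim (use b in \<open>simp add: norm_op_adj bounded_ops_intros flip: op_adj_diff\<close>)
  ultimately have "((\<lambda>x. norm (op_adj (f x) - op_adj A)) \<longlongrightarrow> 0) F" by (rule Lim_transform_eventually)
  then show ?thesis by (simp add: tendsto_norm_zero_iff LIM_zero_iff)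
qed

section \<open>Inverses\<close>

lemma blinfun_compose_assoc3: "(A o\<^sub>L B) o\<^sub>L D = A o\<^sub>L (B o\<^sub>L D)"
  by (rule blinfun_eqI) simp

lemma op_inverse_unique:
  assumes "A o\<^sub>L B = id_blinfun" "B o\<^sub>L A = id_blinfun"
  shows "op_inverse A = B"
  unfolding op_inverse_def
proof (rule the_equality)
  fix D assume D: "A o\<^sub>L D = id_blinfun \<and> D o\<^sub>L A = id_blinfun"
  have "D = (B o\<^sub>L A) o\<^sub>L D" using assms by (simp add: blinfun_eqI)
  also have "\<dots> = B" using D by (simp add: blinfun_compose_assoc3 blinfun_eqI)
  finally show "D = B" .
qed (use assms in auto)

lemma op_inverse:
  assumes "op_invertible A"
  shows "A o\<^sub>L op_inverse A = id_blinfun" "op_inverse A o\<^sub>L A = id_blinfun"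
  using assms op_inverse_unique unfolding op_invertible_def by metis+

lemma op_inverse_apply [simp]:
  assumes "op_invertible A"
  shows "A (op_inverse A x) = x" "op_inverse A (A x) = x"
  using op_inverse[OF assms] by (metis blinfun_apply_blinfun_compose blinfun_apply_id_blinfun id_apply)+

lemma op_inverse_bounded_ops: "A \<in> bounded_ops \<Longrightarrow> op_invertible A \<Longrightarrow> op_inverse A \<in> bounded_ops"
  by (rule bounded_opsI) (metis bounded_opsD op_inverse_apply)

lemma norm_op_inverse_le:
  assumes "op_invertible A" "\<And>x. c * norm x \<le> norm (A x)" "c > 0"
  shows "norm (op_inverse A) \<le> 1 / c"
  using assms(2)[of "op_inverse A _"] assms
  by (intro norm_blinfun_bound) (auto simp: field_simps)

lemma op_invertible_compose:
  assumes "op_invertible A" "op_invertible B" shows "op_invertible (A o\<^sub>L B)"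
  unfolding op_invertible_def
  by (rule exI[of _ "op_inverse B o\<^sub>L op_inverse A"]) (auto intro!: blinfun_eqI simp: assms)

lemma op_invertible_scaleR:
  assumes "op_invertible A" "r \<noteq> 0" shows "op_invertible (r *\<^sub>R A)"
  unfolding op_invertible_def
  by (rule exI[of _ "(1/r) *\<^sub>R op_inverse A"])
    (auto intro!: blinfun_eqI simp: assms blinfun.scaleR_left blinfun.scaleR_right)

lemma op_invertible_scaleC:
  assumes "op_invertible A" "c \<noteq> 0" "A \<in> bounded_ops" shows "op_invertible (c *\<^sub>C A)"
  unfolding op_invertible_def
  by (rule exI[of _ "(1/c) *\<^sub>C op_inverse A"])
    (auto intro!: blinfun_eqI simp: assms scaleC_scaleC bounded_opsD op_inverse_bounded_ops)

lemma op_invertible_op_adj: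
  assumes "op_invertible A" "A \<in> bounded_ops"
  shows "op_invertible (op_adj A)" "op_inverse (op_adj A) = op_adj (op_inverse A)"
proof -
  note B = op_inverse_bounded_ops[OF assms(2,1)]
  have *: "op_adj A o\<^sub>L op_adj (op_inverse A) = id_blinfun" "op_adj (op_inverse A) o\<^sub>L op_adj A = id_blinfun"
    by (simp_all add: assms B op_inverse op_adj_id flip: op_adj_compose)
  then show "op_invertible (op_adj A)" unfolding op_invertible_def by blast
  show "op_inverse (op_adj A) = op_adj (op_inverse A)" using * by (rule op_inverse_unique)
qed

text \<open>The equation \<open>x + K x = y\<close> is solved by Banach's fixed point theorem.\<close>
lemma op_invertible_id_plus:
  fixes K :: "'a::{complex_normed_vector,complete_space} \<Rightarrow>\<^sub>L 'a"
  assumes K: "norm K < 1"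
  shows "op_invertible (id_blinfun + K)"
proof -
  have low: "(1 - norm K) * norm x \<le> norm ((id_blinfun + K) x)" for x
  proof -
    have "norm x \<le> norm ((id_blinfun + K) x) + norm (K x)"
      using norm_triangle_ineq4[of "(id_blinfun + K) x" "K x"] by (simp add: blinfun.add_left)
    then show ?thesis using norm_blinfun[of K x] by (simp add: algebra_simps)
  qed
  have "\<exists>x. (id_blinfun + K) x = y" for y
  proof -
    have "\<exists>!x. y - K x = x"
      using K norm_blinfun[of K]
      by (intro banach_fix_type[of "norm K"])
        (simp_all add: dist_norm blinfun.diff_right[symmetric] norm_minus_commute[of _ "_ :: 'a"],
         metis norm_minus_commute)
    then obtain x where "y - K x = x" by blast
    then show ?thesis by (intro exI[of _ x]) (simp add: blinfun.add_left algebra_simps)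
  qed
  then obtain g where g: "\<And>y. (id_blinfun + K) (g y) = y" by metis
  have inj: "x = z" if "(id_blinfun + K) x = (id_blinfun + K) z" for x z
  proof -
    have "(1 - norm K) * norm (x - z) \<le> 0" using low[of "x - z"] that by (simp add: blinfun.diff_right)
    then show ?thesis using K by (simp add: mult_le_0_iff)
  qed
  have "bounded_linear g"
  proof (rule bounded_linear_intro)
    show "g (x + y) = g x + g y" for x y by (rule inj) (simp only: g blinfun.add_right)
    show "g (r *\<^sub>R x) = r *\<^sub>R g x" for r x by (rule inj) (simp only: g blinfun.scaleR_right)
    show "norm (g x) \<le> norm x * (1 / (1 - norm K))" for x
      using low[of "g x"] K by (simp add: g field_simps)
  qed
  then have B: "blinfun_apply (Blinfun g) = g" by (rule bounded_linear_Blinfun_apply)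
  show ?thesis unfolding op_invertible_def
    by (rule exI[of _ "Blinfun g"], intro conjI blinfun_eqI, simp add: B g, rule inj, simp add: B g)
qed

lemma op_invertible_perturb:
  fixes A :: "'a::{complex_normed_vector,complete_space} \<Rightarrow>\<^sub>L 'a"
  assumes A: "op_invertible A" and H: "\<And>x. norm (op_inverse A x) \<le> c * norm x" "norm H * c < 1"
    and c: "c \<ge> 0"
  shows "op_invertible (A + H)"
proof -
  have "norm (op_inverse A o\<^sub>L H) \<le> norm (op_inverse A) * norm H" by (rule norm_blinfun_compose)
  also have "norm (op_inverse A) \<le> c" using H(1) c by (rule norm_blinfun_bound[rotated])
  finally have "norm (op_inverse A o\<^sub>L H) < 1" using H(2) by (simp add: mult.commute mult_right_mono)
  then have "op_invertible (A o\<^sub>L (id_blinfun + (op_inverse A o\<^sub>L H)))"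
    by (intro op_invertible_compose A op_invertible_id_plus)
  also have "A o\<^sub>L (id_blinfun + (op_inverse A o\<^sub>L H)) = A + H"
    by (rule blinfun_eqI) (simp add: blinfun.add_left blinfun.add_right A)
  finally show ?thesis .
qed

text \<open>A coercive operator \<open>A\<close> is, up to a positive factor, a strict contraction away from the
  identity.\<close>

lemma coercive_invertible:
  fixes A :: "'a::chilbert_space \<Rightarrow>\<^sub>L 'a"
  assumes \<delta>: "\<delta> > 0" and A: "\<And>x. \<delta> * (norm x)\<^sup>2 \<le> Re (cinner (A x) x)"
  shows "op_invertible A"
proof -
  define M where "M = norm A + \<delta>"
  \<comment> \<open>\<open>\<tau>\<close> minimises the bound \<open>1 - 2 \<tau> \<delta> + \<tau>\<^sup>2 M\<^sup>2\<close> for the square of the norm of \<open>1 - \<tau> A\<close>\<close>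
  define \<tau> where "\<tau> = \<delta> / M\<^sup>2"
  have M: "M > 0" "\<delta> \<le> M" using \<delta> by (auto simp: M_def intro: add_nonneg_pos)
  have \<tau>: "\<tau> > 0" using M \<delta> by (simp add: \<tau>_def)
  define q where "q = 1 - \<delta>\<^sup>2 / M\<^sup>2"
  have q: "0 \<le> q" "q < 1" using M \<delta> by (auto simp: q_def field_simps power_mono)
  have "norm (\<tau> *\<^sub>R A - id_blinfun) \<le> sqrt q"
  proof (rule norm_blinfun_bound)
    fix x
    have "(norm (A x))\<^sup>2 \<le> (M * norm x)\<^sup>2"
      using norm_blinfun[of A x] \<delta>
      by (intro power_mono) (auto simp: M_def algebra_simps intro: order_trans add_increasing2)
    then have "\<tau>\<^sup>2 * (norm (A x))\<^sup>2 \<le> (\<delta> / M\<^sup>2)\<^sup>2 * (M * norm x)\<^sup>2"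
      by (simp add: \<tau>_def mult_left_mono)
    also have "\<dots> = \<delta>\<^sup>2 / M\<^sup>2 * (norm x)\<^sup>2"
      using M by (simp add: power_mult_distrib power_divide power2_eq_square field_simps)
    finally have 1: "\<tau>\<^sup>2 * (norm (A x))\<^sup>2 \<le> \<delta>\<^sup>2 / M\<^sup>2 * (norm x)\<^sup>2" .
    have "\<tau> * (\<delta> * (norm x)\<^sup>2) \<le> \<tau> * inner (A x) x"
      using A[of x] \<tau> by (simp add: inner_eq_Re_cinner)
    then have 2: "\<delta>\<^sup>2 / M\<^sup>2 * (norm x)\<^sup>2 \<le> \<tau> * inner (A x) x" by (simp add: \<tau>_def power2_eq_square)
    have "(norm ((\<tau> *\<^sub>R A - id_blinfun) x))\<^sup>2 = (norm x)\<^sup>2 - 2 * (\<tau> * inner (A x) x) + \<tau>\<^sup>2 * (norm (A x))\<^sup>2"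
      unfolding power2_norm_eq_inner
      by (simp add: blinfun.diff_left blinfun.scaleR_left algebra_simps inner_commute power2_eq_square)
    also have "\<dots> \<le> q * (norm x)\<^sup>2" using 1 2 by (simp add: q_def algebra_simps)
    also have "\<dots> = (sqrt q * norm x)\<^sup>2" using q by (simp add: power_mult_distrib)
    finally show "norm ((\<tau> *\<^sub>R A - id_blinfun) x) \<le> sqrt q * norm x"
      by (rule power2_le_imp_le) (use q in auto)
  qed (use q in auto)
  also have "sqrt q < 1" using q by simp
  finally have "op_invertible (id_blinfun + (\<tau> *\<^sub>R A - id_blinfun))" by (rule op_invertible_id_plus)
  then have "op_invertible ((1/\<tau>) *\<^sub>R (\<tau> *\<^sub>R A))" using \<tau> by (intro op_invertible_scaleR[of "\<tau> *\<^sub>R A"]) auto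
  then show ?thesis using \<tau> by simp
qed

lemma coercive_lower_bound:
  fixes A :: "'a::chilbert_space \<Rightarrow>\<^sub>L 'a"
  assumes "\<delta> * (norm x)\<^sup>2 \<le> cmod (cinner (A x) x)"
  shows "\<delta> * norm x \<le> norm (A x)"
proof (cases "x = 0")
  case False
  have "\<delta> * (norm x)\<^sup>2 \<le> norm (A x) * norm x" using assms norm_cinner_le order_trans by blast
  then show ?thesis using False by (simp add: power2_eq_square)
qed simp

section \<open>Positive operators and their square roots\<close>

lemma complex_nonneg_iff: "z \<in> \<real>\<^sub>\<ge>\<^sub>0 \<longleftrightarrow> Im z = 0 \<and> Re z \<ge> 0"
  by (auto simp: complex_nonneg_Reals_iff)

text \<open>Reality of the form at \<open>x + y\<close> settles the imaginary parts, and with \<open>\<i> x\<close> in place of \<open>x\<close> the real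
  ones.\<close>

lemma op_nonneg_symmetric:
  fixes P :: "'a::chilbert_space \<Rightarrow>\<^sub>L 'a"
  assumes P: "P \<in> bounded_ops" and im: "\<And>x. Im (cinner (P x) x) = 0"
  shows "cinner (P x) y = cinner x (P y)"
proof -
  have *: "Im (cinner (P x) y) + Im (cinner (P y) x) = 0" for x y
    using im[of "x + y"] im[of x] im[of y] by (simp add: blinfun.add_right cinner_simps)
  have 1: "Im (cinner (P x) y) = Im (cinner x (P y))" for x y
    using *[of x y] cinner_commute[of "P y" x] by simp
  have "Re (cinner (P x) y) = Im (cinner (P (\<i> *\<^sub>C x)) y)"
    by (simp add: bounded_opsD[OF P] cinner_simps)
  also have "\<dots> = Re (cinner x (P y))" by (simp add: 1 cinner_simps)
  finally show ?thesis using 1 by (simp add: complex_eq_iff)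
qed

lemma op_adj_symmetric:
  fixes P :: "'a::chilbert_space \<Rightarrow>\<^sub>L 'a"
  assumes "\<And>x y. cinner (P x) y = cinner x (P y)"
  shows "op_adj P = P"
  using assms by (rule op_adj_unique)

lemma op_nonneg_op_adj: "P \<in> bounded_ops \<Longrightarrow> op_nonneg P \<Longrightarrow> op_adj P = P"
  by (intro op_adj_symmetric op_nonneg_symmetric) (auto simp: op_nonneg_def complex_nonneg_iff)

lemma op_nonnegD: "op_nonneg P \<Longrightarrow> Re (cinner (P x) x) \<ge> 0" "op_nonneg P \<Longrightarrow> Im (cinner (P x) x) = 0"
  by (auto simp: op_nonneg_def complex_nonneg_iff)

lemma op_nonneg_cinner: "op_nonneg P \<Longrightarrow> cinner (P x) x = complex_of_real (Re (cinner (P x) x))"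
  by (simp add: complex_eq_iff op_nonnegD)

lemma op_nonnegI:
  fixes P :: "'a::chilbert_space \<Rightarrow>\<^sub>L 'a"
  assumes "\<And>x y. cinner (P x) y = cinner x (P y)" "\<And>x. Re (cinner (P x) x) \<ge> 0"
  shows "op_nonneg P"
proof -
  have "Im (cinner (P x) x) = 0" for x
    using assms(1)[of x x] cinner_commute[of "P x" x] by (simp add: complex_eq_iff)
  then show ?thesis using assms(2) by (simp add: op_nonneg_def complex_nonneg_iff)
qed

lemma op_nonneg_add: "op_nonneg P \<Longrightarrow> op_nonneg Q \<Longrightarrow> op_nonneg (P + Q)"
  by (auto simp: op_nonneg_def complex_nonneg_iff blinfun.add_left cinner_simps)

lemma op_nonneg_scaleR: "op_nonneg P \<Longrightarrow> r \<ge> 0 \<Longrightarrow> op_nonneg (r *\<^sub>R P)"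
  by (auto simp: op_nonneg_def complex_nonneg_iff blinfun.scaleR_left cinner_simps)

lemma op_nonneg_conjugate:
  fixes P T :: "'a::chilbert_space \<Rightarrow>\<^sub>L 'a"
  assumes "op_nonneg P" "\<And>x y. cinner (T x) y = cinner x (T y)"
  shows "op_nonneg (T o\<^sub>L P o\<^sub>L T)"
  using assms by (auto simp: op_nonneg_def)

lemma op_nonneg_square:
  fixes T :: "'a::chilbert_space \<Rightarrow>\<^sub>L 'a"
  assumes "\<And>x y. cinner (T x) y = cinner x (T y)"
  shows "op_nonneg (T o\<^sub>L T)"
  by (rule op_nonnegI) (simp_all add: assms cinner_self)

text \<open>Positivity of the form at \<open>t x - \<langle>P x, y\<rangle> y\<close> for all real \<open>t\<close>. The form may be degenerate, whence
  the separate treatment of \<open>\<langle>P x, x\<rangle> = 0\<close>.\<close>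
lemma positive_cauchy_schwarz:
  fixes P :: "'a::chilbert_space \<Rightarrow>\<^sub>L 'a"
  assumes P: "P \<in> bounded_ops" "op_nonneg P"
  shows "(cmod (cinner (P x) y))\<^sup>2 \<le> Re (cinner (P x) x) * Re (cinner (P y) y)"
proof -
  define a where "a = Re (cinner (P x) x)"
  define b where "b = Re (cinner (P y) y)"
  define c where "c = cinner (P x) y"
  have sym: "cinner (P y) x = cnj c"
    using op_nonneg_symmetric[of P y x] P cinner_commute[of y "P x"]
    by (simp add: op_nonnegD c_def)
  have main: "0 \<le> t\<^sup>2 * a - 2 * t * (cmod c)\<^sup>2 + (cmod c)\<^sup>2 * b" for t :: real
  proof -
    define z where "z = complex_of_real t *\<^sub>C x - c *\<^sub>C y"
    have "cinner (P z) z = complex_of_real t * complex_of_real t * cinner (P x) x - 2 * complex_of_real t * (c * cnj c) + c * cnj c * cinner (P y) y"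
      using sym unfolding z_def
      by (simp add: cinner_simps blinfun.diff_right bounded_opsD[OF P(1)] blinfun.scaleR_right c_def[symmetric]
          scaleR_conv_of_real algebra_simps)
    then have "Re (cinner (P z) z) = t\<^sup>2 * a - 2 * t * (cmod c)\<^sup>2 + (cmod c)\<^sup>2 * b"
      unfolding complex_norm_square[symmetric] using op_nonneg_cinner[OF P(2), of x] op_nonneg_cinner[OF P(2), of y]
      by (simp add: a_def[symmetric] b_def[symmetric] power2_eq_square complex_eq_iff)
    then show ?thesis using op_nonnegD(1)[OF P(2), of z] by simp
  qed
  have a: "a \<ge> 0" and b: "b \<ge> 0" using P by (auto simp: a_def b_def op_nonnegD)
  show ?thesis
  proof (cases "c = 0")
    case False
    then have c: "(cmod c)\<^sup>2 > 0" by simp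
    show ?thesis
    proof (cases "a = 0")
      case True
      have "0 \<le> - (2 * (b + 1) * (cmod c)\<^sup>2) + (cmod c)\<^sup>2 * b" using main[of "b + 1"] True by simp
      then have "(cmod c)\<^sup>2 * (b + 2) \<le> 0" by (simp add: algebra_simps)
      then show ?thesis using b c by (simp add: mult_le_0_iff)
    next
      case False
      then have a: "a > 0" using a by simp
      define d where "d = (cmod c)\<^sup>2"
      have "0 \<le> (d / a)\<^sup>2 * a - 2 * (d / a) * d + d * b" using main[of "d / a"] by (simp add: d_def)
      also have "\<dots> = d * (b - d / a)" using a by (simp add: field_simps power2_eq_square)
      finally have "0 \<le> b - d / a" using c by (simp add: d_def zero_le_mult_iff)
      then show ?thesis using a by (simp add: a_def b_def c_def d_def field_simps)
    qed
  qed (use a b in \<open>simp add: a_def b_def c_def\<close>)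
qed

lemma positive_kernel:
  fixes P :: "'a::chilbert_space \<Rightarrow>\<^sub>L 'a"
  assumes "P \<in> bounded_ops" "op_nonneg P" "Re (cinner (P x) x) = 0"
  shows "P x = 0"
  using positive_cauchy_schwarz[OF assms(1,2), of x "P x"] assms(3) by (simp add: cinner_self)

lemma norm_positive_le:
  fixes P :: "'a::chilbert_space \<Rightarrow>\<^sub>L 'a"
  assumes P: "P \<in> bounded_ops" "op_nonneg P" and M: "\<And>x. Re (cinner (P x) x) \<le> M * (norm x)\<^sup>2" "M \<ge> 0"
  shows "norm P \<le> M"
proof (rule norm_blinfun_le_cinner[OF _ M(2)])
  fix x y
  have "(cmod (cinner (P x) y))\<^sup>2 \<le> (M * (norm x)\<^sup>2) * (M * (norm y)\<^sup>2)"
    using M P by (intro order_trans[OF positive_cauchy_schwarz[OF P]] mult_mono) (auto simp: op_nonnegD)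
  also have "\<dots> = (M * norm x * norm y)\<^sup>2" by (simp add: power2_eq_square)
  finally show "cmod (cinner (P x) y) \<le> M * norm x * norm y"
    by (rule power2_le_imp_le) (use M in simp)
qed

text \<open>The scalar case of the iteration below, which will dominate the operator one. It increases to its
  fixed point \<open>1\<close>.\<close>

primrec sqrt_majorant :: "nat \<Rightarrow> real" where
  "sqrt_majorant 0 = 0"
| "sqrt_majorant (Suc n) = (1 + (sqrt_majorant n)\<^sup>2) / 2"

lemma sqrt_majorant_bounds: "0 \<le> sqrt_majorant n \<and> sqrt_majorant n \<le> 1"
proof (induction n)
  case (Suc n)
  then have "(sqrt_majorant n)\<^sup>2 \<le> 1" by (simp add: power_le_one)
  then show ?case by simp
qed simp

lemma sqrt_majorant_mono: "sqrt_majorant n \<le> sqrt_majorant (Suc n)"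
proof -
  have "0 \<le> (1 - sqrt_majorant n)\<^sup>2" by simp
  then show ?thesis by (simp add: power2_diff)
qed

text \<open>The fixed point iteration \<open>Y \<mapsto> (X + Y\<^sup>2) / 2\<close> for \<open>1 - (1 - X)\<^bsup>1/2\<^esup>\<close>.\<close>

primrec sqrt_iter :: "('a::complex_normed_vector \<Rightarrow>\<^sub>L 'a) \<Rightarrow> nat \<Rightarrow> ('a \<Rightarrow>\<^sub>L 'a)" where
  "sqrt_iter X 0 = 0"
| "sqrt_iter X (Suc n) = (1/2) *\<^sub>R (X + (sqrt_iter X n o\<^sub>L sqrt_iter X n))"

lemma square_difference: "(Y o\<^sub>L Y) - (Z o\<^sub>L Z) = (Y o\<^sub>L (Y - Z)) + ((Y - Z) o\<^sub>L Z)"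
  by (rule blinfun_eqI) (simp add: blinfun.diff_left blinfun.add_left blinfun.diff_right)

text \<open>By the splitting of \<open>Y\<^sup>2 - Z\<^sup>2\<close> the increments of the operator iteration are dominated by those of
  the scalar one; \<open>Y\<close> and \<open>Z\<close> need not commute for this.\<close>
lemma norm_sqrt_iter:
  assumes X: "norm X \<le> 1"
  shows "norm (sqrt_iter X n) \<le> sqrt_majorant n"
    and "norm (sqrt_iter X (Suc n) - sqrt_iter X n) \<le> sqrt_majorant (Suc n) - sqrt_majorant n"
proof -
  show 1: "norm (sqrt_iter X n) \<le> sqrt_majorant n" for n
  proof (induction n)
    case (Suc n)
    have "norm (sqrt_iter X n o\<^sub>L sqrt_iter X n) \<le> (sqrt_majorant n)\<^sup>2"
      unfolding power2_eq_square
      by (rule order_trans[OF norm_blinfun_compose]) (intro mult_mono Suc; simp add: sqrt_majorant_bounds)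
    then have "norm (X + (sqrt_iter X n o\<^sub>L sqrt_iter X n)) \<le> 1 + (sqrt_majorant n)\<^sup>2"
      using X norm_triangle_ineq[of X "sqrt_iter X n o\<^sub>L sqrt_iter X n"] by linarith
    then show ?case by simp
  qed simp
  show "norm (sqrt_iter X (Suc n) - sqrt_iter X n) \<le> sqrt_majorant (Suc n) - sqrt_majorant n"
  proof (induction n)
    case 0 then show ?case using X by simp
  next
    case (Suc n)
    define Y Z where "Y = sqrt_iter X (Suc n)" and "Z = sqrt_iter X n"
    define y z where "y = sqrt_majorant (Suc n)" and "z = sqrt_majorant n"
    have IH: "norm (Y - Z) \<le> y - z" using Suc by (simp only: Y_def Z_def y_def z_def)
    have YZ: "norm Y \<le> y" "norm Z \<le> z" using 1 by (simp_all only: Y_def Z_def y_def z_def)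
    have "sqrt_iter X (Suc (Suc n)) - sqrt_iter X (Suc n)
        = (1/2) *\<^sub>R (X + (Y o\<^sub>L Y)) - (1/2) *\<^sub>R (X + (Z o\<^sub>L Z))"
      unfolding Y_def Z_def by (simp only: sqrt_iter.simps)
    also have "\<dots> = (1/2) *\<^sub>R ((Y o\<^sub>L (Y - Z)) + ((Y - Z) o\<^sub>L Z))"
      unfolding square_difference[symmetric] scaleR_diff_right[symmetric] by simp
    also have "norm \<dots> \<le> (1/2) * (norm (Y o\<^sub>L (Y - Z)) + norm ((Y - Z) o\<^sub>L Z))"
      by (simp add: norm_triangle_ineq)
    also have "\<dots> \<le> (1/2) * (y * (y - z) + (y - z) * z)"
      using YZ IH order_trans[OF norm_ge_zero YZ(1)] order_trans[OF norm_ge_zero IH]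
      by (intro mult_left_mono add_mono order_trans[OF norm_blinfun_compose] mult_mono) auto
    also have "\<dots> = (1 + y\<^sup>2) / 2 - (1 + z\<^sup>2) / 2" by (simp add: power2_eq_square field_simps)
    also have "\<dots> = sqrt_majorant (Suc (Suc n)) - sqrt_majorant (Suc n)"
      unfolding y_def z_def by (simp only: sqrt_majorant.simps)
    finally show ?case .
  qed
qed

lemma sqrt_iter_convergent:
  fixes X :: "'a::chilbert_space \<Rightarrow>\<^sub>L 'a"
  assumes X: "norm X \<le> 1"
  obtains Y where "sqrt_iter X \<longlonglongrightarrow> Y"
proof -
  have "summable (\<lambda>n. sqrt_majorant (Suc n) - sqrt_majorant n)"
  proof (rule bounded_imp_summable[of _ 1])
    show "(\<Sum>k\<le>n. sqrt_majorant (Suc k) - sqrt_majorant k) \<le> 1" for n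
      using sqrt_majorant_bounds[of "Suc n"] sum_lessThan_telescope[of sqrt_majorant "Suc n"]
      by (simp only: lessThan_Suc_atMost) simp
  qed (use sqrt_majorant_mono in auto)
  then have "summable (\<lambda>n. sqrt_iter X (Suc n) - sqrt_iter X n)"
    by (rule summable_comparison_test_ev[rotated]) (use norm_sqrt_iter(2)[OF X] in \<open>auto simp del: sqrt_iter.simps sqrt_majorant.simps\<close>)
  then have "convergent (sqrt_iter X)"
    by (simp add: summable_iff_convergent sum_lessThan_telescope del: sqrt_iter.simps(2))
  then show thesis using that by (auto simp: convergent_def)
qed

definition commutes :: "('a::complex_normed_vector \<Rightarrow>\<^sub>L 'a) \<Rightarrow> ('a \<Rightarrow>\<^sub>L 'a) \<Rightarrow> bool" where
  "commutes A B \<longleftrightarrow> A o\<^sub>L B = B o\<^sub>L A"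

lemma commutesD:
  fixes A B :: "'a::complex_normed_vector \<Rightarrow>\<^sub>L 'a"
  shows "commutes A B \<Longrightarrow> A (B x) = B (A x)"
  unfolding commutes_def by (metis blinfun_apply_blinfun_compose)

lemma commutesI:
  fixes A B :: "'a::complex_normed_vector \<Rightarrow>\<^sub>L 'a"
  shows "(\<And>x. A (B x) = B (A x)) \<Longrightarrow> commutes A B"
  unfolding commutes_def by (auto intro: blinfun_eqI)

lemma closed_commutes: "closed {A :: 'a::complex_normed_vector \<Rightarrow>\<^sub>L 'a. commutes A B}"
  unfolding commutes_def
  by (intro closed_Collect_eq continuous_intros bounded_bilinear.continuous_on[OF bounded_bilinear_blinfun_compose])

text \<open>After scaling, \<open>X = 1 - P / c\<close> is a contraction, and the limit \<open>Y\<close> of the iteration satisfies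
  \<open>(1 - Y)\<^sup>2 = 1 - X\<close>. Being a norm limit of polynomials in \<open>P\<close>, the root commutes with whatever commutes
  with \<open>P\<close>.\<close>
lemma positive_sqrt_exists:
  fixes P :: "'a::chilbert_space \<Rightarrow>\<^sub>L 'a"
  assumes P: "P \<in> bounded_ops" "op_nonneg P"
  obtains R where "R \<in> bounded_ops" "op_nonneg R" "R o\<^sub>L R = P"
    "\<And>B. commutes P B \<Longrightarrow> commutes R B"
proof -
  define c where "c = norm P + 1"
  have c: "c > 0" by (auto simp: c_def intro: add_nonneg_pos)
  define X where "X = id_blinfun - (1/c) *\<^sub>R P"
  have Xop: "X \<in> bounded_ops" unfolding X_def using P by (intro bounded_ops_intros)
  have symP: "cinner (P x) y = cinner x (P y)" for x y
    using P by (intro op_nonneg_symmetric) (auto simp: op_nonnegD)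
  have symX: "cinner (X x) y = cinner x (X y)" for x y
    by (simp add: X_def blinfun.diff_left blinfun.scaleR_left cinner_simps symP)
  have ReX: "Re (cinner (X x) x) = (norm x)\<^sup>2 - Re (cinner (P x) x) / c" for x
    by (simp add: X_def blinfun.diff_left blinfun.scaleR_left cinner_simps cinner_self flip: of_real_power)
  have "Re (cinner (P x) x) / c \<le> (norm x)\<^sup>2" for x
  proof -
    have "Re (cinner (P x) x) \<le> norm P * norm x * norm x"
      using cmod_cinner_blinfun_le[of P x x] complex_Re_le_cmod order_trans by blast
    also have "\<dots> \<le> c * (norm x)\<^sup>2" by (simp add: c_def power2_eq_square algebra_simps)
    finally show ?thesis using c by (simp add: field_simps)
  qed
  then have Xpos: "op_nonneg X" using ReX by (intro op_nonnegI symX) simp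
  have nX: "norm X \<le> 1"
    by (rule norm_positive_le[OF Xop Xpos]) (use ReX op_nonnegD[OF P(2)] c in auto)
  obtain Y where Y: "sqrt_iter X \<longlonglongrightarrow> Y" using sqrt_iter_convergent[OF nX] .
  have it: "sqrt_iter X n \<in> bounded_ops \<and> (\<forall>x y. cinner (sqrt_iter X n x) y = cinner x (sqrt_iter X n y))
      \<and> (\<forall>B. commutes P B \<longrightarrow> commutes (sqrt_iter X n) B)" for n
  proof (induction n)
    case 0 then show ?case by (auto simp: bounded_ops_zero commutes_def blinfun_eqI)
  next
    case (Suc n)
    have "commutes X B" if "commutes P B" for B
      using that unfolding X_def
      by (intro commutesI) (simp add: blinfun.diff_left blinfun.diff_right blinfun.scaleR_left blinfun.scaleR_right commutesD)
    then show ?case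
      using Suc Xop symX
      by (auto intro!: bounded_ops_intros commutesI
          simp: blinfun.scaleR_left blinfun.scaleR_right blinfun.add_left blinfun.add_right cinner_simps commutesD)
  qed
  have Yop: "Y \<in> bounded_ops"
    using closed_bounded_ops Y it by (meson closed_sequentially)
  have symY: "cinner (Y x) y = cinner x (Y y)" for x y
  proof (rule LIMSEQ_unique)
    show "(\<lambda>n. cinner (sqrt_iter X n x) y) \<longlonglongrightarrow> cinner (Y x) y"
      by (intro cinner.tendsto blinfun.tendsto Y tendsto_const)
    show "(\<lambda>n. cinner (sqrt_iter X n x) y) \<longlonglongrightarrow> cinner x (Y y)"
      using it by (simp, intro cinner.tendsto blinfun.tendsto Y tendsto_const)
  qed
  have comY: "commutes Y B" if "commutes P B" for B
    using closed_sequentially[OF closed_commutes[of B], of "sqrt_iter X" Y] it that Y by auto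
  have nY: "norm Y \<le> 1"
    using LIMSEQ_le_const2[OF tendsto_norm[OF Y]] norm_sqrt_iter(1)[OF nX] sqrt_majorant_bounds
    by (meson order_trans)
  have fp: "Y = (1/2) *\<^sub>R (X + (Y o\<^sub>L Y))"
  proof (rule LIMSEQ_unique)
    show "(\<lambda>n. sqrt_iter X (Suc n)) \<longlonglongrightarrow> Y" by (rule LIMSEQ_Suc[OF Y])
    show "(\<lambda>n. sqrt_iter X (Suc n)) \<longlonglongrightarrow> (1/2) *\<^sub>R (X + (Y o\<^sub>L Y))"
      unfolding sqrt_iter.simps
      by (intro tendsto_intros bounded_bilinear.tendsto[OF bounded_bilinear_blinfun_compose] Y)
  qed
  define R where "R = sqrt c *\<^sub>R (id_blinfun - Y)"
  have RR: "R o\<^sub>L R = P"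
  proof (rule blinfun_eqI)
    fix x
    have "2 *\<^sub>R Y x = X x + Y (Y x)"
      using arg_cong[OF fp, of "\<lambda>Z. 2 *\<^sub>R Z x"] by (simp add: blinfun.scaleR_left blinfun.add_left)
    then have "Y (Y x) = 2 *\<^sub>R Y x - x + (1/c) *\<^sub>R P x"
      by (simp add: X_def blinfun.diff_left blinfun.scaleR_left algebra_simps)
    moreover have "(R o\<^sub>L R) x = c *\<^sub>R (x - 2 *\<^sub>R Y x + Y (Y x))"
      using c by (simp add: R_def blinfun.scaleR_left blinfun.scaleR_right blinfun.diff_left blinfun.diff_right
          algebra_simps scaleR_2)
    ultimately show "(R o\<^sub>L R) x = P x" using c by simp
  qed
  have Rpos: "op_nonneg R"
  proof (rule op_nonnegI)
    show "cinner (R x) y = cinner x (R y)" for x y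
      by (simp add: R_def blinfun.diff_left blinfun.scaleR_left cinner_simps symY)
    have "Re (cinner (Y x) x) \<le> (norm x)\<^sup>2" for x
    proof -
      have "Re (cinner (Y x) x) \<le> norm Y * norm x * norm x"
        using cmod_cinner_blinfun_le[of Y x x] complex_Re_le_cmod order_trans by blast
      also have "\<dots> \<le> 1 * (norm x * norm x)" using nY by (simp add: mult.assoc mult_right_mono mult_left_le_one_le)
      finally show ?thesis by (simp add: power2_eq_square)
    qed
    then show "Re (cinner (R x) x) \<ge> 0" for x
      using c by (simp add: R_def blinfun.diff_left blinfun.scaleR_left cinner_simps cinner_self flip: of_real_power)
  qed
  show thesis
  proof (rule that[of R])
    show "R \<in> bounded_ops" unfolding R_def using Yop by (intro bounded_ops_intros)
    show "commutes R B" if "commutes P B" for B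
      using comY[OF that] unfolding R_def
      by (intro commutesI) (simp add: blinfun.diff_left blinfun.diff_right blinfun.scaleR_left blinfun.scaleR_right commutesD)
  qed (use Rpos RR in auto)
qed

text \<open>A positive \<open>T\<close> with \<open>T\<^sup>2 = P\<^sup>2\<close> commutes with \<open>P\<^sup>2\<close>, hence with the root \<open>R\<close> constructed above. So
  \<open>(R + T) (R - T) = 0\<close>, and positivity makes both \<open>R\<close> and \<open>T\<close> vanish on the range of \<open>R - T\<close>.\<close>
lemma positive_sqrt_unique:
  fixes P Q :: "'a::chilbert_space \<Rightarrow>\<^sub>L 'a"
  assumes P: "P \<in> bounded_ops" "op_nonneg P" and Q: "Q \<in> bounded_ops" "op_nonneg Q"
    and eq: "P o\<^sub>L P = Q o\<^sub>L Q"
  shows "P = Q"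
proof -
  have symP: "cinner (T x) y = cinner x (T y)" if "T \<in> bounded_ops" "op_nonneg T" for T :: "'a \<Rightarrow>\<^sub>L 'a" and x y
    using that by (intro op_nonneg_symmetric) (auto simp: op_nonnegD)
  obtain R where R: "R \<in> bounded_ops" "op_nonneg R" "R o\<^sub>L R = P o\<^sub>L P"
    "\<And>B. commutes (P o\<^sub>L P) B \<Longrightarrow> commutes R B"
    by (rule positive_sqrt_exists[of "P o\<^sub>L P"]) (use P symP in \<open>auto intro: bounded_ops_intros op_nonneg_square\<close>)
  have key: "T = R" if T: "T \<in> bounded_ops" "op_nonneg T" and TT: "T o\<^sub>L T = P o\<^sub>L P" for T
  proof (rule blinfun_eqI)
    fix x
    have com: "commutes R T" by (rule R(4)) (simp add: TT[symmetric] commutes_def blinfun_compose_assoc3)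
    define D where "D = R - T"
    have Dop: "D \<in> bounded_ops" unfolding D_def by (intro bounded_ops_intros T R)
    have symD: "cinner (D x) y = cinner x (D y)" for x y
      using symP[OF T] symP[OF R(1,2)] by (simp add: D_def blinfun.diff_left cinner_simps)
    have "R (R u) = T (T u)" for u
      using R(3) TT by (metis blinfun_apply_blinfun_compose)
    then have prod: "R (D u) + T (D u) = 0" for u
      using commutesD[OF com, of u] by (simp add: D_def blinfun.diff_left blinfun.diff_right)
    have "cinner (R (D u)) (D u) + cinner (T (D u)) (D u) = 0" for u
      using prod[of u] by (metis cinner_add_left cinner.zero_left)
    then have "Re (cinner (R (D u)) (D u)) + Re (cinner (T (D u)) (D u)) = 0" for u
      by (metis plus_complex.sel(1) zero_complex.sel(1))
    then have "Re (cinner (R (D u)) (D u)) = 0 \<and> Re (cinner (T (D u)) (D u)) = 0" for u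
      using op_nonnegD(1)[OF R(2), of "D u"] op_nonnegD(1)[OF T(2), of "D u"] by (smt (verit))
    then have "R (D u) = 0" "T (D u) = 0" for u
      using positive_kernel R T by blast+
    then have "D (D u) = 0" for u by (simp add: D_def blinfun.diff_left)
    then have "cinner (D x) (D x) = 0" using symD[of x "D x"] by simp
    then show "T x = R x" by (simp add: cinner_self D_def blinfun.diff_left)
  qed
  show ?thesis using key[OF P refl] key[OF Q eq[symmetric]] by simp
qed

lemma op_abs_eqI:
  fixes P A :: "'a::chilbert_space \<Rightarrow>\<^sub>L 'a"
  assumes "P \<in> bounded_ops" "op_nonneg P" "P o\<^sub>L P = op_adj A o\<^sub>L A"
  shows "op_abs A = P"
  unfolding op_abs_def 
proof (rule the_equality)
  fix Q :: "'a \<Rightarrow>\<^sub>L 'a" assume "Q \<in> bounded_ops \<and> op_nonneg Q \<and> Q o\<^sub>L Q = op_adj A o\<^sub>L A"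
  then show "Q = P" using positive_sqrt_unique[of Q P] assms by (elim conjE) metis
qed (use assms in blast)

lemma op_abs_positive: "P \<in> bounded_ops \<Longrightarrow> op_nonneg P \<Longrightarrow> op_abs P = P"
  by (rule op_abs_eqI) (simp_all add: op_nonneg_op_adj)

lemma op_abs_uminus: 
  assumes "P \<in> bounded_ops" "op_nonneg P" shows "op_abs (- P) = P"
proof (rule op_abs_eqI)
  have "op_adj (- P) = - P"
    using op_adj_scaleC[OF assms(1), of "-1"] op_nonneg_op_adj[OF assms]
    by (simp add: scaleC.minus_left)
  then show "P o\<^sub>L P = op_adj (- P) o\<^sub>L (- P)"
    by (auto intro!: blinfun_eqI simp: blinfun.minus_left blinfun.minus_right)
qed (use assms in auto)

lemma op_abs_symmetric:
  fixes D :: "'a::chilbert_space \<Rightarrow>\<^sub>L 'a"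
  assumes D: "D \<in> bounded_ops" "\<And>x y. cinner (D x) y = cinner x (D y)"
  shows "op_abs D \<in> bounded_ops" "op_nonneg (op_abs D)" "op_abs D o\<^sub>L op_abs D = D o\<^sub>L D"
    "commutes (op_abs D) D"
proof -
  obtain R where R: "R \<in> bounded_ops" "op_nonneg R" "R o\<^sub>L R = D o\<^sub>L D"
    "\<And>B. commutes (D o\<^sub>L D) B \<Longrightarrow> commutes R B"
    by (rule positive_sqrt_exists[of "D o\<^sub>L D"]) (use D in \<open>auto intro: bounded_ops_intros op_nonneg_square\<close>)
  have "op_abs D = R" by (rule op_abs_eqI) (use R(1-3) op_adj_symmetric[OF D(2)] in auto)
  moreover have "commutes R D" by (rule R(4)) (simp add: commutes_def blinfun_compose_assoc3)
  ultimately show "op_abs D \<in> bounded_ops" "op_nonneg (op_abs D)" "op_abs D o\<^sub>L op_abs D = D o\<^sub>L D"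
    "commutes (op_abs D) D"
    using R(1-3) by simp_all
qed

section \<open>Orthonormal bases and traces of positive operators\<close>

lemma is_onbD:
  assumes "is_onb B" "e \<in> B"
  shows "norm e = 1" "f \<in> B \<Longrightarrow> cinner e f = (if e = f then 1 else 0)"
proof -
  show *: "cinner e f = (if e = f then 1 else 0)" if "f \<in> B" for f
    using assms that by (simp add: is_onb_def)
  have "complex_of_real ((norm e)\<^sup>2) = complex_of_real 1"
    using *[OF assms(2)] cinner_self[of e] by simp
  then have "(norm e)\<^sup>2 = 1" by (simp only: of_real_eq_iff)
  then show "norm e = 1" using power2_eq_1_iff[of "norm e"] norm_ge_zero[of e] by linarith
qed

text \<open>Distinct basis vectors have distance \<open>\<surd>2\<close>, so a countable dense set separates them.\<close>

lemma countable_onb: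
  fixes B :: "'a::chilbert_space set"
  assumes sep: "separable_space (euclidean :: 'a topology)" and B: "is_onb B"
  shows "countable B"
proof -
  obtain D :: "'a set" where D: "countable D" "closure D = UNIV"
    using sep unfolding separable_space_def by auto
  have "\<exists>d\<in>D. dist d e < 1/2" for e
  proof -
    have "e \<in> closure D" using D by simp
    then show ?thesis by (meson closure_approachable half_gt_zero zero_less_one)
  qed
  then obtain d where d: "\<And>e. d e \<in> D" "\<And>e. dist (d e) e < 1/2" by metis
  have "inj_on d B"
  proof (rule inj_onI, rule ccontr)
    fix e f assume ef: "e \<in> B" "f \<in> B" "d e = d f" "e \<noteq> f"
    have "dist e f < 1" using d(2)[of e] d(2)[of f] ef dist_triangle[of e f "d e"] by (simp add: dist_commute)
    then have "(norm (e - f))\<^sup>2 < 1" by (simp add: dist_norm power_less_one_iff)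
    moreover have "(norm (e - f))\<^sup>2 = (norm e)\<^sup>2 + (norm f)\<^sup>2 - 2 * Re (cinner e f)"
      by (simp add: power2_norm_eq_inner inner_diff inner_commute flip: inner_eq_Re_cinner)
    ultimately show False using is_onbD[OF B] ef by simp
  qed
  moreover have "countable (d ` B)" using D d by (meson countable_subset image_subsetI)
  ultimately show ?thesis by (rule countable_image_inj_on[rotated])
qed

definition onb_proj :: "'a::chilbert_space set \<Rightarrow> 'a \<Rightarrow>\<^sub>L 'a" where
  "onb_proj F = Blinfun (\<lambda>x. \<Sum>e\<in>F. cinner x e *\<^sub>C e)"

lemma onb_proj_apply: "onb_proj F x = (\<Sum>e\<in>F. cinner x e *\<^sub>C e)"
proof -
  have "bounded_linear (\<lambda>x. \<Sum>e\<in>F. cinner x e *\<^sub>C e)"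
    by (intro bounded_linear_sum bounded_linear_compose[OF scaleC.bounded_linear_left] cinner.bounded_linear_left)
  then show ?thesis unfolding onb_proj_def by (simp add: bounded_linear_Blinfun_apply)
qed

lemma onb_proj_bounded_ops: "onb_proj F \<in> bounded_ops"
  by (rule bounded_opsI) (simp add: onb_proj_apply cinner_simps scaleC.sum_right scaleC_scaleC)

lemma onb_proj_symmetric: "cinner (onb_proj F x) y = cinner x (onb_proj F y)"
  by (simp add: onb_proj_apply cinner.sum_left cinner.sum_right cinner_simps)
    (metis (mono_tags, lifting) cinner_commute mult.commute)

lemma onb_proj_basis:
  assumes B: "is_onb B" and F: "finite F" "F \<subseteq> B" and e: "e \<in> B"
  shows "onb_proj F e = (if e \<in> F then e else 0)"
proof -
  have "onb_proj F e = (\<Sum>f\<in>F. if e = f then e else 0)"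
    unfolding onb_proj_apply using is_onbD(2)[OF B e] F by (intro sum.cong) auto
  then show ?thesis using F by (simp add: sum.delta)
qed

lemma onb_proj_idem:
  assumes "is_onb B" "finite F" "F \<subseteq> B"
  shows "onb_proj F (onb_proj F x) = onb_proj F x"
proof -
  have "onb_proj F (cinner x e *\<^sub>C e) = cinner x e *\<^sub>C e" if "e \<in> F" for e
    using that assms onb_proj_basis[OF assms, of e] by (auto simp: bounded_opsD[OF onb_proj_bounded_ops])
  then have "onb_proj F (\<Sum>e\<in>F. cinner x e *\<^sub>C e) = (\<Sum>e\<in>F. cinner x e *\<^sub>C e)"
    by (simp add: blinfun.sum_right)
  then show ?thesis by (simp only: onb_proj_apply[of F x])
qed

lemma norm_onb_proj:
  assumes "is_onb B" "finite F" "F \<subseteq> B"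
  shows "(norm (onb_proj F x))\<^sup>2 = (\<Sum>e\<in>F. (cmod (cinner x e))\<^sup>2)"
    and "(norm (onb_proj F x))\<^sup>2 + (norm (x - onb_proj F x))\<^sup>2 = (norm x)\<^sup>2"
    and "Re (cinner (onb_proj F x) x) = (norm (onb_proj F x))\<^sup>2"
proof -
  let ?P = "onb_proj F"
  have *: "cinner (?P x) (?P x) = cinner (?P x) x"
    using onb_proj_symmetric[of F "?P x" x] onb_proj_idem[OF assms] by simp
  have "cinner (?P x) x = (\<Sum>e\<in>F. complex_of_real ((cmod (cinner x e))\<^sup>2))"
    unfolding onb_proj_apply cinner.sum_left
    by (intro sum.cong refl) (metis cinner_commute cinner_scaleC_left complex_norm_square)
  then have "complex_of_real ((norm (?P x))\<^sup>2) = complex_of_real (\<Sum>e\<in>F. (cmod (cinner x e))\<^sup>2)"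
    using * by (simp add: cinner_self)
  then show "(norm (onb_proj F x))\<^sup>2 = (\<Sum>e\<in>F. (cmod (cinner x e))\<^sup>2)" by (simp only: of_real_eq_iff)
  show 3: "Re (cinner (?P x) x) = (norm (?P x))\<^sup>2" unfolding *[symmetric] by (simp add: cinner_self)
  show "(norm (?P x))\<^sup>2 + (norm (x - ?P x))\<^sup>2 = (norm x)\<^sup>2"
    using 3 by (simp add: power2_norm_eq_inner inner_diff inner_commute flip: inner_eq_Re_cinner)
qed

lemma has_sum_metric:
  "(f has_sum (x :: 'b::{topological_comm_monoid_add,metric_space})) A \<longleftrightarrow> (\<forall>\<epsilon>>0. \<exists>F0. finite F0 \<and> F0 \<subseteq> A \<and>
     (\<forall>F. finite F \<and> F0 \<subseteq> F \<and> F \<subseteq> A \<longrightarrow> dist (sum f F) x < \<epsilon>))"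
  unfolding has_sum_def tendsto_iff eventually_finite_subsets_at_top by blast

text \<open>Partial sums are squared norms of projections, and a projection onto a larger span approximates at
  least as well as any vector of the smaller one.\<close>
lemma parseval:
  assumes B: "is_onb B"
  shows "((\<lambda>e. (cmod (cinner x e))\<^sup>2) has_sum (norm x)\<^sup>2) B"
proof -
  interpret cvs: vector_space "scaleC :: complex \<Rightarrow> 'a \<Rightarrow> 'a" by (rule vector_space_scaleC)
  have "\<exists>F0. finite F0 \<and> F0 \<subseteq> B \<and> (\<forall>F. finite F \<and> F0 \<subseteq> F \<and> F \<subseteq> B \<longrightarrow>
      dist (\<Sum>e\<in>F. (cmod (cinner x e))\<^sup>2) ((norm x)\<^sup>2) < \<epsilon>)" if \<epsilon>: "\<epsilon> > 0" for \<epsilon> :: real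
  proof -
    have "x \<in> closure (cvs.span B)" using B by (simp add: is_onb_def)
    then obtain y where y: "y \<in> cvs.span B" "dist y x < sqrt \<epsilon>"
      using closure_approachable[of x] \<epsilon> by (meson real_sqrt_gt_zero)
    then obtain F0 r where F0: "finite F0" "F0 \<subseteq> B" "y = (\<Sum>a\<in>F0. r a *\<^sub>C a)"
      by (auto simp: cvs.span_explicit)
    show ?thesis
    proof (intro exI[of _ F0] conjI allI impI F0)
      fix F assume F: "finite F \<and> F0 \<subseteq> F \<and> F \<subseteq> B"
      let ?P = "onb_proj F"
      have "?P (r a *\<^sub>C a) = r a *\<^sub>C a" if "a \<in> F0" for a
        using onb_proj_basis[OF B, of F a] subsetD[of F0 B a] subsetD[of F0 F a] that F F0(2)
        by (simp add: bounded_opsD[OF onb_proj_bounded_ops])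
      then have Py: "?P y = y" by (simp add: F0(3) blinfun.sum_right)
      have *: "(x - y) - ?P (x - y) = x - ?P x" by (simp add: blinfun.diff_right Py)
      have "(norm (?P (x - y)))\<^sup>2 + (norm (x - ?P x))\<^sup>2 = (norm (x - y))\<^sup>2"
        using norm_onb_proj(2)[OF B, of F "x - y"] F unfolding * by blast
      then have "(norm (x - ?P x))\<^sup>2 \<le> (norm (x - y))\<^sup>2"
        using zero_le_power2[of "norm (?P (x - y))"] by linarith
      also have "\<dots> < (sqrt \<epsilon>)\<^sup>2"
        using y(2) by (intro power_strict_mono) (auto simp: dist_norm norm_minus_commute)
      finally have "(norm (x - ?P x))\<^sup>2 < \<epsilon>" using \<epsilon> by simp
      moreover have "dist (\<Sum>e\<in>F. (cmod (cinner x e))\<^sup>2) ((norm x)\<^sup>2) = (norm (x - ?P x))\<^sup>2"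
        unfolding norm_onb_proj(2)[OF B, of F x, symmetric, OF conjunct1[OF F] conjunct2[OF conjunct2[OF F]]]
        using norm_onb_proj(1)[OF B, of F x] F by (simp add: dist_real_def)
      ultimately show "dist (\<Sum>e\<in>F. (cmod (cinner x e))\<^sup>2) ((norm x)\<^sup>2) < \<epsilon>" by simp
    qed
  qed
  then show ?thesis by (simp add: has_sum_metric)
qed

lemma nn_integral_count_space_has_sum:
  assumes "(f has_sum s) A" "\<And>x. x \<in> A \<Longrightarrow> f x \<ge> (0::real)"
  shows "(\<integral>\<^sup>+x. ennreal (f x) \<partial>count_space A) = ennreal s"
proof -
  have "f summable_on A" using assms by (auto simp: summable_on_def)
  then have "(\<lambda>x. norm (f x)) summable_on A"
    by (subst summable_on_cong[of _ _ f]) (use assms in auto)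
  then have a: "Infinite_Set_Sum.abs_summable_on f A" by (rule iffD1[OF abs_summable_equivalent])
  have "(\<integral>\<^sup>+x. ennreal (f x) \<partial>count_space A) = ennreal (infsetsum f A)"
    by (rule nn_integral_conv_infsetsum[OF a assms(2)])
  also have "infsetsum f A = s"
    using infsetsum_infsum[OF a] infsumI[OF assms(1)] by simp
  finally show ?thesis .
qed

lemma has_sum_nn_integral_count_space:
  assumes "(\<integral>\<^sup>+x. ennreal (f x) \<partial>count_space A) < \<infinity>" "\<And>x. x \<in> A \<Longrightarrow> f x \<ge> (0::real)"
  shows "(f has_sum enn2real (\<integral>\<^sup>+x. ennreal (f x) \<partial>count_space A)) A"
proof -
  have "(\<integral>\<^sup>+x. ennreal (norm (f x)) \<partial>count_space A) = (\<integral>\<^sup>+x. ennreal (f x) \<partial>count_space A)"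
    by (rule nn_integral_cong) (use assms in simp)
  then have a: "Infinite_Set_Sum.abs_summable_on f A"
    using assms unfolding Infinite_Set_Sum.abs_summable_on_def by (intro integrableI_bounded) auto
  then have "f summable_on A" 
    by (rule abs_summable_summable[OF iffD2[OF abs_summable_equivalent]])
  then have "(f has_sum infsum f A) A" by (rule has_sum_infsum)
  moreover have "infsum f A \<ge> 0" by (rule infsum_nonneg[OF assms(2)])
  ultimately show ?thesis
    by (simp add: nn_integral_conv_infsetsum[OF a assms(2)] infsetsum_infsum[OF a])
qed

text \<open>Extended values, given by an integral with respect to counting measure, make the Tonelli theorem
  available for traces that are not known to be finite.\<close>

definition etrace :: "'a::chilbert_space set \<Rightarrow> ('a \<Rightarrow>\<^sub>L 'a) \<Rightarrow> ennreal" where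
  "etrace B P = (\<integral>\<^sup>+e. ennreal (Re (cinner (P e) e)) \<partial>count_space B)"

lemma nn_integral_parseval:
  assumes "is_onb B"
  shows "(\<integral>\<^sup>+e. ennreal ((cmod (cinner x e))\<^sup>2) \<partial>count_space B) = ennreal ((norm x)\<^sup>2)"
  by (rule nn_integral_count_space_has_sum[OF parseval[OF assms]]) simp

text \<open>Both sides are the double sum of \<open>\<bar>\<langle>S e, f\<rangle>\<bar>\<^sup>2\<close>, by Parseval's identity in either variable.\<close>

lemma hilbert_schmidt_adjoint:
  fixes S T :: "'a::chilbert_space \<Rightarrow>\<^sub>L 'a"
  assumes B: "is_onb B" "countable B" and B': "is_onb B'" "countable B'"
    and adj: "\<And>x y. cinner (S x) y = cinner x (T y)"
  shows "(\<integral>\<^sup>+e. ennreal ((norm (S e))\<^sup>2) \<partial>count_space B) = (\<integral>\<^sup>+f. ennreal ((norm (T f))\<^sup>2) \<partial>count_space B')"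
proof -
  have "(\<integral>\<^sup>+e. ennreal ((norm (S e))\<^sup>2) \<partial>count_space B)
      = (\<integral>\<^sup>+e. (\<integral>\<^sup>+f. ennreal ((cmod (cinner (S e) f))\<^sup>2) \<partial>count_space B') \<partial>count_space B)"
    by (simp add: nn_integral_parseval[OF B'(1)])
  also have "\<dots> = (\<integral>\<^sup>+f. (\<integral>\<^sup>+e. ennreal ((cmod (cinner (S e) f))\<^sup>2) \<partial>count_space B) \<partial>count_space B')"
    by (rule nn_integral_count_space_nn_integral) (use B' in auto)
  also have "\<dots> = (\<integral>\<^sup>+f. (\<integral>\<^sup>+e. ennreal ((cmod (cinner (T f) e))\<^sup>2) \<partial>count_space B) \<partial>count_space B')"
    by (intro nn_integral_cong) (metis adj cinner_commute complex_mod_cnj)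
  also have "\<dots> = (\<integral>\<^sup>+f. ennreal ((norm (T f))\<^sup>2) \<partial>count_space B')"
    by (simp add: nn_integral_parseval[OF B(1)])
  finally show ?thesis .
qed

lemma etrace_sqrt:
  fixes P R :: "'a::chilbert_space \<Rightarrow>\<^sub>L 'a"
  assumes "R o\<^sub>L R = P" "\<And>x y. cinner (R x) y = cinner x (R y)"
  shows "Re (cinner (P x) x) = (norm (R x))\<^sup>2"
    "etrace B P = (\<integral>\<^sup>+e. ennreal ((norm (R e))\<^sup>2) \<partial>count_space B)"
proof -
  show *: "Re (cinner (P x) x) = (norm (R x))\<^sup>2" for x
    using assms(2)[of "R x" x] by (simp add: assms(1)[symmetric] cinner_self flip: of_real_power)
  show "etrace B P = (\<integral>\<^sup>+e. ennreal ((norm (R e))\<^sup>2) \<partial>count_space B)" by (simp add: etrace_def *)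
qed

lemma op_nonneg_symmetric':
  "P \<in> bounded_ops \<Longrightarrow> op_nonneg P \<Longrightarrow> cinner (P x) y = cinner x (P y)"
  by (intro op_nonneg_symmetric) (auto simp: op_nonnegD)

text \<open>The trace of \<open>P\<close> is the squared Hilbert-Schmidt norm of its symmetric square root.\<close>
lemma etrace_basis_independent:
  assumes B: "is_onb B" "countable B" and B': "is_onb B'" "countable B'"
    and P: "P \<in> bounded_ops" "op_nonneg P"
  shows "etrace B P = etrace B' P"
proof -
  obtain R where R: "R \<in> bounded_ops" "op_nonneg R" "R o\<^sub>L R = P"
    using positive_sqrt_exists[OF P] by metis
  note sym = op_nonneg_symmetric'[OF R(1,2)]
  show ?thesis unfolding etrace_sqrt(2)[OF R(3) sym]
    by (rule hilbert_schmidt_adjoint[OF B B' sym])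
qed

lemma positive_has_sum_etrace:
  assumes "etrace B P < \<infinity>" "op_nonneg P"
  shows "((\<lambda>e. Re (cinner (P e) e)) has_sum enn2real (etrace B P)) B"
    "((\<lambda>e. cinner (P e) e) has_sum complex_of_real (enn2real (etrace B P))) B"
proof -
  show 1: "((\<lambda>e. Re (cinner (P e) e)) has_sum enn2real (etrace B P)) B"
    using assms unfolding etrace_def by (intro has_sum_nn_integral_count_space) (auto simp: op_nonnegD)
  have "((\<lambda>e. complex_of_real (Re (cinner (P e) e))) has_sum complex_of_real (enn2real (etrace B P))) B"
    by (rule has_sum_bounded_linear[OF bounded_linear_of_real 1, unfolded o_def])
  then show "((\<lambda>e. cinner (P e) e) has_sum complex_of_real (enn2real (etrace B P))) B"
    using op_nonneg_cinner[OF assms(2)] by simp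
qed

lemma trace_class_positiveD:
  assumes P: "P \<in> bounded_ops" "op_nonneg P" and T: "trace_class P"
    and sep: "separable_space (euclidean :: 'a::chilbert_space topology)"
    and B: "is_onb (B :: 'a set)"
  shows "etrace B P < \<infinity>"
proof -
  obtain B' where B': "is_onb B'" "(\<lambda>e. cinner (P e) e) summable_on B'"
    using T unfolding trace_class_def op_abs_positive[OF P] by auto
  then obtain s where "((\<lambda>e. cinner (P e) e) has_sum s) B'" by (auto simp: summable_on_def)
  then have "((\<lambda>e. Re (cinner (P e) e)) has_sum Re s) B'"
    using has_sum_bounded_linear[OF bounded_linear_Re] unfolding o_def by blast
  then have "etrace B' P = ennreal (Re s)"
    unfolding etrace_def by (rule nn_integral_count_space_has_sum) (simp add: op_nonnegD P)
  then show ?thesis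
    using etrace_basis_independent[OF B countable_onb[OF sep B] B'(1) countable_onb[OF sep B'(1)] P] by simp
qed

lemma trace_class_positiveI:
  assumes P: "P \<in> bounded_ops" "op_nonneg P" and B: "is_onb B" "etrace B P < \<infinity>"
  shows "trace_class P"
  unfolding trace_class_def op_abs_positive[OF P]
  using P B positive_has_sum_etrace(2)[OF B(2) P(2)] by (auto simp: summable_on_def)

lemma trace_class_uminusI:
  assumes P: "P \<in> bounded_ops" "op_nonneg P" and "trace_class P"
  shows "trace_class (- P)"
  using assms bounded_ops_uminus[OF P(1)] unfolding trace_class_def op_abs_uminus[OF P] op_abs_positive[OF P] by simp

lemma is_onb_some_onb:
  "is_onb (B :: 'a::chilbert_space set) \<Longrightarrow> is_onb (some_onb :: 'a set)"
  unfolding some_onb_def by (rule someI[of is_onb])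

lemma op_trace_positive:
  assumes "etrace some_onb P < \<infinity>" "op_nonneg P"
  shows "op_trace P = complex_of_real (enn2real (etrace some_onb P))"
  unfolding op_trace_def by (rule infsumI[OF positive_has_sum_etrace(2)[OF assms]])


section \<open>Convergence in trace norm\<close>

text \<open>If \<open>T\<close> is symmetric and commutes with \<open>D\<close>, the identity
  \<open>4 D T = (1 + T) D (1 + T) - (1 - T) D (1 - T)\<close> turns the form bound \<open>\<plusminus>D \<le> E\<close> into
  \<open>D T \<le> (E + T E T) / 2\<close>. For the spectral sign \<open>T\<close> of \<open>D\<close> the product \<open>D T\<close> is the modulus of \<open>D\<close>. To
  avoid a spectral calculus the sign is replaced by the contraction \<open>D (\<bar>D\<bar> + c)\<^sup>-\<^sup>1\<close>, at the expense of
  an error \<open>c\<close>.\<close>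

lemma abs_form_bound:
  fixes D E :: "'a::chilbert_space \<Rightarrow>\<^sub>L 'a"
  assumes D: "D \<in> bounded_ops" "\<And>x y. cinner (D x) y = cinner x (D y)"
    and DE: "\<And>x. \<bar>Re (cinner (D x) x)\<bar> \<le> Re (cinner (E x) x)" and c: "c > 0"
  obtains T where "T \<in> bounded_ops" "\<And>x y. cinner (T x) y = cinner x (T y)" "\<And>x. norm (T x) \<le> norm x"
    "\<And>x. Re (cinner (op_abs D x) x) \<le> (Re (cinner (E x) x) + Re (cinner (E (T x)) (T x))) / 2 + c * (norm x)\<^sup>2"
proof -
  define R where "R = op_abs D"
  note R = op_abs_symmetric[OF D, folded R_def]
  have symR: "cinner (R x) y = cinner x (R y)" for x y by (rule op_nonneg_symmetric'[OF R(1,2)])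
  define G where "G = R + c *\<^sub>R id_blinfun"
  have Gx: "G x = R x + c *\<^sub>R x" for x by (simp add: G_def blinfun.add_left blinfun.scaleR_left)
  have Gop: "G \<in> bounded_ops" unfolding G_def by (intro bounded_ops_intros R)
  have inv: "op_invertible G"
    by (rule coercive_invertible[OF c])
      (simp add: Gx cinner_simps cinner_self op_nonnegD R flip: of_real_power)
  define W where "W = op_inverse G"
  have GW: "G (W x) = x" "W (G x) = x" for x using inv by (simp_all add: W_def)
  have com: "R (D x) = D (R x)" for x using R(4) by (rule commutesD)
  have WD: "W (D x) = D (W x)" for x
  proof -
    have "G (D (W x)) = D (G (W x))" by (simp add: Gx com blinfun.add_right blinfun.scaleR_right)
    then show ?thesis by (metis GW)
  qed
  have WR: "W (R x) = R (W x)" for x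
  proof -
    have "G (R (W x)) = R (G (W x))" by (simp add: Gx blinfun.add_right blinfun.scaleR_right)
    then show ?thesis by (metis GW)
  qed
  have symG: "cinner (G x) y = cinner x (G y)" for x y by (simp add: Gx cinner_simps symR)
  have symW: "cinner (W x) y = cinner x (W y)" for x y by (metis GW(1) symG)
  define T where "T = D o\<^sub>L W"
  have DD: "D (D x) = R (R x)" for x using R(3) by (metis blinfun_apply_blinfun_compose)
  have nDR: "norm (D x) = norm (R x)" for x
  proof -
    have "complex_of_real ((norm (D x))\<^sup>2) = complex_of_real ((norm (R x))\<^sup>2)"
      unfolding cinner_self[symmetric] using D(2)[of x "D x"] symR[of x "R x"] DD by simp
    then show ?thesis by (simp only: of_real_eq_iff) simp
  qed
  have nT: "norm (T x) \<le> norm x" for x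
  proof -
    have "norm (T x) = norm (R (W x))" by (simp add: T_def nDR)
    also have "\<dots> \<le> norm (G (W x))"
    proof (rule power2_le_imp_le)
      have "(norm (G u))\<^sup>2 = (norm (R u))\<^sup>2 + 2 * c * Re (cinner (R u) u) + c\<^sup>2 * (norm u)\<^sup>2" for u
        unfolding Gx power2_norm_eq_inner
        by (simp add: inner_add inner_commute flip: inner_eq_Re_cinner) (simp add: power2_eq_square)
      then show "(norm (R (W x)))\<^sup>2 \<le> (norm (G (W x)))\<^sup>2" using c op_nonnegD(1)[OF R(2)] by simp
    qed simp
    finally show ?thesis by (simp add: GW)
  qed
  have symT: "cinner (T x) y = cinner x (T y)" for x y by (simp add: T_def D(2) symW WD)
  have DT: "4 * Re (cinner (D (T x)) x) \<le> 2 * Re (cinner (E x) x) + 2 * Re (cinner (E (T x)) (T x))" for x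
  proof -
    have comDT: "D (T x) = T (D x)" for x by (simp add: T_def WD)
    have "cinner (D x) (T x) = cinner (D (T x)) x" "cinner (D (T x)) (T x) = cinner (D (T x)) (T x)"
      using symT[of "D x" x] by (simp_all add: comDT)
    then have "4 * Re (cinner (D (T x)) x)
        = Re (cinner (D (x + T x)) (x + T x)) - Re (cinner (D (x - T x)) (x - T x))"
      by (simp add: blinfun.add_right blinfun.diff_right cinner_simps)
    also have "\<dots> \<le> Re (cinner (E (x + T x)) (x + T x)) + Re (cinner (E (x - T x)) (x - T x))"
      using DE[of "x + T x"] DE[of "x - T x"] by linarith
    also have "\<dots> = 2 * Re (cinner (E x) x) + 2 * Re (cinner (E (T x)) (T x))"
      by (simp add: blinfun.add_right blinfun.diff_right cinner_simps)
    finally show ?thesis .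
  qed
  have Rle: "Re (cinner (R x) x) \<le> Re (cinner (D (T x)) x) + c * (norm x)\<^sup>2" for x
  proof -
    have "R x = G (W (R x))" by (simp add: GW)
    also have "\<dots> = D (T x) + c *\<^sub>R R (W x)" by (simp add: WR Gx T_def DD)
    finally have "Re (cinner (R x) x) = Re (cinner (D (T x)) x) + c * Re (cinner (R (W x)) x)"
      by (metis cinner_add_left cinner_scaleR_left plus_complex.sel(1) scaleR_complex.sel(1))
    moreover have "Re (cinner (R (W x)) x) \<le> (norm x)\<^sup>2"
    proof -
      have "Re (cinner (R (W x)) x) \<le> norm (R (W x)) * norm x"
        using complex_Re_le_cmod norm_cinner_le order_trans by blast
      also have "\<dots> \<le> norm x * norm x" using nT[of x] by (intro mult_right_mono) (auto simp: T_def nDR)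
      finally show ?thesis by (simp add: power2_eq_square)
    qed
    ultimately show ?thesis using c by simp
  qed
  show thesis
  proof (rule that[of T])
    show "T \<in> bounded_ops" unfolding T_def W_def by (intro bounded_ops_intros D op_inverse_bounded_ops inv Gop)
    show "Re (cinner (op_abs D x) x) \<le> (Re (cinner (E x) x) + Re (cinner (E (T x)) (T x))) / 2 + c * (norm x)\<^sup>2" for x
      using Rle[of x] DT[of x] unfolding R_def by (simp add: field_simps)
  qed (use symT nT in auto)
qed

text \<open>Sum the preceding form bound over the basis, using that a symmetric contraction \<open>T\<close> does not
  increase the trace: \<open>tr (T E T)\<close> and \<open>tr E\<close> are the squared Hilbert-Schmidt norms of \<open>T Q\<close> and \<open>Q\<close>,
  where \<open>Q\<^sup>2 = E\<close>. The error \<open>c\<close> may be chosen anew for each finite part of the basis.\<close>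
lemma etrace_abs_le:
  fixes D E :: "'a::chilbert_space \<Rightarrow>\<^sub>L 'a"
  assumes B: "is_onb B" "countable B"
    and D: "D \<in> bounded_ops" "\<And>x y. cinner (D x) y = cinner x (D y)"
    and E: "E \<in> bounded_ops" "op_nonneg E"
    and DE: "\<And>x. \<bar>Re (cinner (D x) x)\<bar> \<le> Re (cinner (E x) x)"
    and tE: "etrace B E \<le> ennreal s" and s: "s \<ge> 0"
  shows "etrace B (op_abs D) \<le> ennreal s"
proof -
  note R = op_abs_symmetric[OF D]
  obtain Q where Q: "Q \<in> bounded_ops" "op_nonneg Q" "Q o\<^sub>L Q = E"
    using positive_sqrt_exists[OF E] by metis
  note symQ = op_nonneg_symmetric'[OF Q(1,2)]
  note EQ = etrace_sqrt[OF Q(3) symQ]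
  have fin: "(\<Sum>e\<in>F. Re (cinner (op_abs D e) e)) \<le> s" if F: "finite F" "F \<subseteq> B" for F
  proof (rule field_le_epsilon)
    fix \<epsilon> :: real assume \<epsilon>: "\<epsilon> > 0"
    define c where "c = \<epsilon> / (real (card F) + 1)"
    have c: "c > 0" using \<epsilon> by (simp add: c_def)
    obtain T where T: "T \<in> bounded_ops" "\<And>x y. cinner (T x) y = cinner x (T y)" "\<And>x. norm (T x) \<le> norm x"
      "\<And>x. Re (cinner (op_abs D x) x) \<le> (Re (cinner (E x) x) + Re (cinner (E (T x)) (T x))) / 2 + c * (norm x)\<^sup>2"
      using abs_form_bound[OF D DE c] by metis
    have sub: "(\<Sum>e\<in>F. g e) \<le> s" if g: "(\<integral>\<^sup>+e. ennreal (g e) \<partial>count_space B) \<le> ennreal s" "\<And>e. g e \<ge> 0" for g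
    proof -
      have "ennreal (\<Sum>e\<in>F. g e) = (\<integral>\<^sup>+e. ennreal (g e) \<partial>count_space F)"
        using F g by (simp add: nn_integral_count_space_finite sum_ennreal)
      also have "\<dots> \<le> (\<integral>\<^sup>+e. ennreal (g e) \<partial>count_space B)"
        using F by (subst (1 2) nn_integral_count_space_indicator)
          (auto intro!: nn_integral_mono simp: indicator_def split: if_splits)
      also have "\<dots> \<le> ennreal s" by (rule g)
      finally show ?thesis using s by (simp add: ennreal_le_iff)
    qed
    have "(\<integral>\<^sup>+e. ennreal ((norm (Q (T e)))\<^sup>2) \<partial>count_space B) = (\<integral>\<^sup>+f. ennreal ((norm (T (Q f)))\<^sup>2) \<partial>count_space B)"
      using hilbert_schmidt_adjoint[OF B B, of "Q o\<^sub>L T" "T o\<^sub>L Q"] by (simp add: symQ T(2))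
    also have "\<dots> \<le> (\<integral>\<^sup>+f. ennreal ((norm (Q f))\<^sup>2) \<partial>count_space B)"
      by (intro nn_integral_mono ennreal_leI power_mono T(3) norm_ge_zero)
    also have "\<dots> \<le> ennreal s" using tE by (simp add: EQ(2))
    finally have 1: "(\<Sum>e\<in>F. (norm (Q (T e)))\<^sup>2) \<le> s" by (rule sub) simp
    have 2: "(\<Sum>e\<in>F. (norm (Q e))\<^sup>2) \<le> s" by (rule sub) (use tE in \<open>simp_all add: EQ(2)\<close>)
    have "(\<Sum>e\<in>F. Re (cinner (op_abs D e) e)) \<le> (\<Sum>e\<in>F. ((norm (Q e))\<^sup>2 + (norm (Q (T e)))\<^sup>2) / 2 + c)"
    proof (rule sum_mono)
      fix e assume "e \<in> F"
      then have "norm e = 1" using is_onbD(1)[OF B(1)] F by blast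
      then show "Re (cinner (op_abs D e) e) \<le> ((norm (Q e))\<^sup>2 + (norm (Q (T e)))\<^sup>2) / 2 + c"
        using T(4)[of e] by (simp add: EQ(1))
    qed
    also have "\<dots> = ((\<Sum>e\<in>F. (norm (Q e))\<^sup>2) + (\<Sum>e\<in>F. (norm (Q (T e)))\<^sup>2)) / 2 + real (card F) * c"
      unfolding sum.distrib sum_divide_distrib[symmetric] by simp
    also have "\<dots> \<le> s + \<epsilon>"
    proof -
      have "real (card F) * c \<le> \<epsilon>" using \<epsilon> by (simp add: c_def field_simps)
      then show ?thesis using 1 2 by (simp add: field_simps)
    qed
    finally show "(\<Sum>e\<in>F. Re (cinner (op_abs D e) e)) \<le> s + \<epsilon>" .
  qed
  have nn: "Re (cinner (op_abs D e) e) \<ge> 0" for e by (rule op_nonnegD(1)[OF R(2)])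
  have "(\<lambda>e. Re (cinner (op_abs D e) e)) summable_on B"
    by (rule nonneg_bdd_above_summable_on) (use nn fin in \<open>auto intro!: bdd_aboveI2\<close>)
  then have hs: "((\<lambda>e. Re (cinner (op_abs D e) e)) has_sum infsum (\<lambda>e. Re (cinner (op_abs D e) e)) B) B"
    by (rule has_sum_infsum)
  then have "etrace B (op_abs D) = ennreal (infsum (\<lambda>e. Re (cinner (op_abs D e) e)) B)"
    unfolding etrace_def by (rule nn_integral_count_space_has_sum) (rule nn)
  moreover have "infsum (\<lambda>e. Re (cinner (op_abs D e) e)) B \<le> s"
    by (rule has_sum_le_finite_sums[OF hs fin])
  ultimately show ?thesis by (simp add: ennreal_leI)
qed

lemma trace_norm_symmetric:
  fixes D :: "'a::chilbert_space \<Rightarrow>\<^sub>L 'a"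
  assumes D: "D \<in> bounded_ops" "\<And>x y. cinner (D x) y = cinner x (D y)"
    and fin: "etrace some_onb (op_abs D) \<le> ennreal s" and s: "s \<ge> 0"
  shows "0 \<le> trace_norm D" "trace_norm D \<le> s"
proof -
  have "trace_norm D = enn2real (etrace some_onb (op_abs D))"
    unfolding trace_norm_def using fin
    by (subst op_trace_positive) (auto simp: op_abs_symmetric[OF D] intro: le_less_trans)
  then show "0 \<le> trace_norm D" "trace_norm D \<le> s"
    using enn2real_mono[OF fin] s by simp_all
qed

text \<open>From positivity of the form at \<open>d p + q\<close> and \<open>d p - q\<close>.\<close>
lemma positive_form_split:
  fixes A :: "'a::chilbert_space \<Rightarrow>\<^sub>L 'a"
  assumes A: "A \<in> bounded_ops" "op_nonneg A" and d: "d > 0"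
  shows "\<bar>Re (cinner (A (p + q)) (p + q)) - Re (cinner (A p) p) - Re (cinner (A q) q)\<bar>
    \<le> d * Re (cinner (A p) p) + (1/d) * Re (cinner (A q) q)"
proof -
  have sym: "Re (cinner (A q) p) = Re (cinner (A p) q)"
    using op_nonneg_symmetric'[OF A, of q p] cinner_commute[of q "A p"] by simp
  have "0 \<le> d * (d * Re (cinner (A p) p) + 2 * Re (cinner (A p) q) + (1/d) * Re (cinner (A q) q))"
    using op_nonnegD(1)[OF A(2), of "d *\<^sub>R p + q"] sym d
    by (simp add: blinfun.add_right blinfun.scaleR_right cinner_simps algebra_simps)
  moreover have "0 \<le> d * (d * Re (cinner (A p) p) - 2 * Re (cinner (A p) q) + (1/d) * Re (cinner (A q) q))"
    using op_nonnegD(1)[OF A(2), of "d *\<^sub>R p - q"] sym d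
    by (simp add: blinfun.diff_right blinfun.scaleR_right cinner_simps algebra_simps)
  ultimately have "\<bar>2 * Re (cinner (A p) q)\<bar> \<le> d * Re (cinner (A p) p) + (1/d) * Re (cinner (A q) q)"
    using d by (simp add: zero_le_mult_iff abs_le_iff)
  then show ?thesis using sym by (simp add: blinfun.add_right cinner_simps)
qed

text \<open>Compare with the compression to the span of a finite part \<open>F\<close> of the basis. The block inside is
  small by entrywise convergence, and the trace of the block outside is controlled by the traces.\<close>

lemma trace_norm_difference_le:
  fixes A S :: "'a::chilbert_space \<Rightarrow>\<^sub>L 'a"
  assumes B: "is_onb B" "countable B" "B = some_onb"
    and A: "A \<in> bounded_ops" "op_nonneg A" and S: "S \<in> bounded_ops" "op_nonneg S"
    and tA: "((\<lambda>e. Re (cinner (A e) e)) has_sum \<tau>) B" and tS: "((\<lambda>e. Re (cinner (S e) e)) has_sum \<sigma>) B"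
    and F: "finite F" "F \<subseteq> B" and d: "d > 0"
  shows "0 \<le> trace_norm (A - S)"
    "trace_norm (A - S) \<le> real (card F) * (\<Sum>e\<in>F. \<Sum>f\<in>F. cmod (cinner (A e) f - cinner (S e) f))
      + d * (\<Sum>e\<in>F. Re (cinner (A e) e) + Re (cinner (S e) e))
      + (1 + 1/d) * (\<tau> + \<sigma> - (\<Sum>e\<in>F. Re (cinner (A e) e) + Re (cinner (S e) e)))" (is "_ \<le> ?s")
proof -
  define \<eta> where "\<eta> = (\<Sum>e\<in>F. \<Sum>f\<in>F. cmod (cinner (A e) f - cinner (S e) f))"
  define P where "P = onb_proj F"
  define Q where "Q = id_blinfun - P"
  define G where "G = A + S"
  define D where "D = A - S"
  \<comment> \<open>the three terms dominate the inner block of \<open>D\<close>, the share of the mixed blocks charged to the inside,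
    and the outer block with the remaining share\<close>
  define E where "E = \<eta> *\<^sub>R P + d *\<^sub>R (P o\<^sub>L G o\<^sub>L P) + (1 + 1/d) *\<^sub>R (Q o\<^sub>L G o\<^sub>L Q)"
  have \<eta>: "\<eta> \<ge> 0" unfolding \<eta>_def by (intro sum_nonneg) simp
  have Pop: "P \<in> bounded_ops" unfolding P_def by (rule onb_proj_bounded_ops)
  have symP: "cinner (P x) y = cinner x (P y)" for x y unfolding P_def by (rule onb_proj_symmetric)
  have symQ: "cinner (Q x) y = cinner x (Q y)" for x y
    by (simp add: Q_def blinfun.diff_left cinner_simps symP)
  have Ppos: "op_nonneg P"
    by (rule op_nonnegI[OF symP]) (simp add: P_def norm_onb_proj(3)[OF B(1) F])
  have Gpos: "op_nonneg G" unfolding G_def by (intro op_nonneg_add A S)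
  have Eop: "E \<in> bounded_ops"
    unfolding E_def G_def Q_def by (intro bounded_ops_intros Pop A S)
  have Epos: "op_nonneg E"
    unfolding E_def using \<eta> d
    by (intro op_nonneg_add op_nonneg_scaleR Ppos op_nonneg_conjugate Gpos symP symQ) auto
  have Dop: "D \<in> bounded_ops" unfolding D_def by (intro bounded_ops_intros A S)
  have symD: "cinner (D x) y = cinner x (D y)" for x y
    by (simp add: D_def blinfun.diff_left cinner_simps op_nonneg_symmetric'[OF A] op_nonneg_symmetric'[OF S])
  have Eform: "Re (cinner (E x) x) = \<eta> * Re (cinner (P x) x) + d * Re (cinner (G (P x)) (P x))
      + (1 + 1/d) * Re (cinner (G (Q x)) (Q x))" for x
    by (simp add: E_def blinfun.add_left blinfun.scaleR_left cinner_simps symP[of "G _"] symQ[of "G _"])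
  have DE: "\<bar>Re (cinner (D x) x)\<bar> \<le> Re (cinner (E x) x)" for x
  proof -
    have x: "x = P x + Q x" by (simp add: Q_def blinfun.diff_left)
    have a: "\<bar>Re (cinner (A x) x) - Re (cinner (A (P x)) (P x)) - Re (cinner (A (Q x)) (Q x))\<bar>
        \<le> d * Re (cinner (A (P x)) (P x)) + (1/d) * Re (cinner (A (Q x)) (Q x))"
      using positive_form_split[OF A d, of "P x" "Q x"] by (simp only: x[symmetric])
    have s: "\<bar>Re (cinner (S x) x) - Re (cinner (S (P x)) (P x)) - Re (cinner (S (Q x)) (Q x))\<bar>
        \<le> d * Re (cinner (S (P x)) (P x)) + (1/d) * Re (cinner (S (Q x)) (Q x))"
      using positive_form_split[OF S d, of "P x" "Q x"] by (simp only: x[symmetric])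
    have p: "\<bar>Re (cinner (D (P x)) (P x))\<bar> \<le> \<eta> * Re (cinner (P x) x)"
    proof -
      have cx: "cmod (cinner x e) \<le> norm (P x)" if "e \<in> F" for e
      proof (rule power2_le_imp_le)
        show "(cmod (cinner x e))\<^sup>2 \<le> (norm (P x))\<^sup>2"
          unfolding P_def norm_onb_proj(1)[OF B(1) F] by (rule member_le_sum[OF that]) (use F in auto)
      qed simp
      have "cinner (D (P x)) (P x) = (\<Sum>f\<in>F. \<Sum>e\<in>F. cinner x e * (cnj (cinner x f) * cinner (D e) f))"
        by (simp add: P_def onb_proj_apply blinfun.sum_right cinner.sum_left cinner.sum_right
            bounded_opsD[OF Dop] cinner_simps mult.left_commute sum_distrib_left)
      also have "\<dots> = (\<Sum>e\<in>F. \<Sum>f\<in>F. cinner x e * (cnj (cinner x f) * cinner (D e) f))"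
        by (rule sum.swap)
      also have "cmod \<dots> \<le> (\<Sum>e\<in>F. \<Sum>f\<in>F. (norm (P x))\<^sup>2 * cmod (cinner (D e) f))"
        unfolding power2_eq_square
        by (intro order_trans[OF norm_sum] sum_mono)
          (auto simp: norm_mult mult.assoc intro!: mult_mono cx mult_nonneg_nonneg)
      also have "\<dots> = (norm (P x))\<^sup>2 * \<eta>"
        by (simp add: \<eta>_def D_def blinfun.diff_left cinner_simps sum_distrib_left)
      finally show ?thesis
        using abs_Re_le_cmod[of "cinner (D (P x)) (P x)"]
        unfolding P_def norm_onb_proj(3)[OF B(1) F] by (simp add: mult.commute)
    qed
    have "Re (cinner (A (Q x)) (Q x)) \<ge> 0" "Re (cinner (S (Q x)) (Q x)) \<ge> 0" using A S by (auto simp: op_nonnegD)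
    then show ?thesis
      using a s p unfolding Eform by (simp add: D_def G_def blinfun.add_left blinfun.diff_left cinner_simps algebra_simps)
  qed
  define g where "g e = Re (cinner (A e) e) + Re (cinner (S e) e)" for e
  have g0: "g e \<ge> 0" for e using A S by (auto simp: op_nonnegD g_def)
  have hg: "(g has_sum (\<tau> + \<sigma>)) B" unfolding g_def by (intro has_sum_add tA tS)
  have hgF: "(g has_sum (\<tau> + \<sigma> - sum g F)) (B - F)"
    by (rule has_sum_Diff[OF hg has_sum_finite F(2)]) (rule F(1))
  have s_eq: "(\<Sum>e\<in>F. \<eta> + d * g e) + (1 + 1/d) * (\<tau> + \<sigma> - sum g F) = ?s"
    unfolding \<eta>_def[symmetric] g_def[symmetric] by (simp add: sum.distrib sum_distrib_left)
  have "((\<lambda>e. Re (cinner (E e) e)) has_sum ?s) B"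
  proof -
    have 1: "((\<lambda>e. Re (cinner (E e) e)) has_sum (\<Sum>e\<in>F. \<eta> + d * g e)) F"
    proof (subst has_sum_cong)
      fix e assume e: "e \<in> F"
      then have "P e = e" using F B onb_proj_basis[OF B(1) F, of e] by (auto simp: P_def)
      moreover have "norm e = 1" using is_onbD(1)[OF B(1)] e F by blast
      ultimately show "Re (cinner (E e) e) = \<eta> + d * g e"
        unfolding Eform by (simp add: Q_def G_def g_def blinfun.diff_left blinfun.add_left cinner_simps cinner_self)
    qed (rule has_sum_finite[OF F(1)])
    have 2: "((\<lambda>e. Re (cinner (E e) e)) has_sum ((1 + 1/d) * (\<tau> + \<sigma> - sum g F))) (B - F)"
    proof (subst has_sum_cong)
      fix e assume e: "e \<in> B - F"
      then have "P e = 0" using F B onb_proj_basis[OF B(1) F, of e] by (auto simp: P_def)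
      then show "Re (cinner (E e) e) = (1 + 1/d) * g e"
        unfolding Eform by (simp add: Q_def G_def g_def blinfun.diff_left blinfun.add_left cinner_simps)
    qed (rule has_sum_cmult_right[OF hgF])
    have "((\<lambda>e. Re (cinner (E e) e)) has_sum ((\<Sum>e\<in>F. \<eta> + d * g e) + (1 + 1/d) * (\<tau> + \<sigma> - sum g F))) (F \<union> (B - F))"
      by (rule has_sum_Un_disjoint[OF 1 2]) auto
    then show ?thesis unfolding s_eq using F by (simp add: Un_absorb1 Un_Diff_cancel)
  qed
  then have tE: "etrace B E = ennreal ?s" and s0: "?s \<ge> 0"
    unfolding etrace_def using op_nonnegD(1)[OF Epos]
    by (auto intro: nn_integral_count_space_has_sum has_sum_nonneg)
  have "etrace some_onb (op_abs D) \<le> ennreal ?s"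
    using etrace_abs_le[OF B(1,2) Dop symD Epos[THEN conjI[OF Eop], THEN conjunct1] Epos DE _ s0] tE B(3) by simp
  from trace_norm_symmetric[OF Dop symD this s0]
  show "0 \<le> trace_norm (A - S)" "trace_norm (A - S) \<le> ?s" by (simp_all add: D_def)
qed

text \<open>As in Scheffe's lemma for densities, the traces prevent mass from escaping: a finite part of the
  basis that carries nearly all of the limit trace eventually carries nearly all of the trace of
  \<open>A i\<close>, and on that part entrywise convergence suffices.\<close>

lemma trace_norm_convergence:
  fixes A :: "'i \<Rightarrow> 'a::chilbert_space \<Rightarrow>\<^sub>L 'a"
  assumes B: "is_onb (some_onb :: 'a set)" "countable (some_onb :: 'a set)"
    and A: "\<forall>\<^sub>F i in H. A i \<in> bounded_ops \<and> op_nonneg (A i) \<and> ((\<lambda>e. Re (cinner (A i e) e)) has_sum \<tau> i) some_onb"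
    and S: "S \<in> bounded_ops" "op_nonneg S" "((\<lambda>e. Re (cinner (S e) e)) has_sum \<sigma>) some_onb"
    and lim: "\<And>e f. e \<in> some_onb \<Longrightarrow> f \<in> some_onb \<Longrightarrow> ((\<lambda>i. cinner (A i e) f) \<longlongrightarrow> cinner (S e) f) H"
    and tr: "(\<tau> \<longlongrightarrow> \<sigma>) H"
  shows "((\<lambda>i. trace_norm (A i - S)) \<longlongrightarrow> 0) H"
proof (rule tendstoI)
  fix r :: real assume r: "r > 0"
  let ?B = "some_onb :: 'a set"
  have \<sigma>: "\<sigma> \<ge> 0" by (rule has_sum_nonneg[OF S(3)]) (simp add: op_nonnegD S)
  \<comment> \<open>first \<open>d\<close>, to make \<open>2 d \<sigma>\<close> small, then \<open>F\<close>, to beat the factor \<open>1 + 1 / d\<close> of the tail\<close>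
  define d where "d = r / (4 * (\<sigma> + 1))"
  have d: "d > 0" using r \<sigma> by (simp add: d_def)
  define \<rho> where "\<rho> = r / (4 * (1 + 1/d))"
  have \<rho>: "\<rho> > 0" using r d by (simp add: \<rho>_def add_pos_pos)
  obtain F where F: "finite F" "F \<subseteq> ?B" "dist (\<Sum>e\<in>F. Re (cinner (S e) e)) \<sigma> < \<rho> / 2"
    using S(3) half_gt_zero[OF \<rho>] unfolding has_sum_metric by blast
  define s where "s = (\<Sum>e\<in>F. Re (cinner (S e) e))"
  have s: "s \<le> \<sigma>" "\<sigma> - s \<le> \<rho> / 2"
  proof -
    show "s \<le> \<sigma>" unfolding s_def
      by (rule has_sum_mono_neutral[OF has_sum_finite[OF F(1)] S(3)]) (use F S in \<open>auto simp: op_nonnegD\<close>)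
    show "\<sigma> - s \<le> \<rho> / 2" using F(3) unfolding s_def[symmetric] dist_real_def by (simp add: abs_real_def split: if_splits)
  qed
  define U where "U i = real (card F) * (\<Sum>e\<in>F. \<Sum>f\<in>F. cmod (cinner (A i e) f - cinner (S e) f))
      + d * (\<Sum>e\<in>F. Re (cinner (A i e) e) + Re (cinner (S e) e))
      + (1 + 1/d) * (\<tau> i + \<sigma> - (\<Sum>e\<in>F. Re (cinner (A i e) e) + Re (cinner (S e) e)))" for i
  have two: "(\<Sum>e\<in>F. Re (cinner (S e) e) + Re (cinner (S e) e)) = 2 * s"
    unfolding s_def sum.distrib by simp
  have "(U \<longlongrightarrow> real (card F) * (\<Sum>e\<in>F. \<Sum>f\<in>F. cmod (cinner (S e) f - cinner (S e) f))
      + d * (\<Sum>e\<in>F. Re (cinner (S e) e) + Re (cinner (S e) e))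
      + (1 + 1/d) * (\<sigma> + \<sigma> - (\<Sum>e\<in>F. Re (cinner (S e) e) + Re (cinner (S e) e)))) H"
    unfolding U_def using F(2) by (intro tendsto_intros lim tr) auto
  also have "real (card F) * (\<Sum>e\<in>F. \<Sum>f\<in>F. cmod (cinner (S e) f - cinner (S e) f))
      + d * (\<Sum>e\<in>F. Re (cinner (S e) e) + Re (cinner (S e) e))
      + (1 + 1/d) * (\<sigma> + \<sigma> - (\<Sum>e\<in>F. Re (cinner (S e) e) + Re (cinner (S e) e)))
     = 2 * d * s + 2 * ((1 + 1/d) * (\<sigma> - s))"
    unfolding two by (simp add: algebra_simps add_divide_distrib diff_divide_distrib)
  finally have U: "(U \<longlongrightarrow> 2 * d * s + 2 * ((1 + 1/d) * (\<sigma> - s))) H" .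
  have "2 * d * s \<le> 2 * d * \<sigma>" using s d by simp
  also have "\<dots> < r / 2" using r \<sigma> by (simp add: d_def field_simps)
  finally have "2 * d * s < r / 2" .
  moreover have "(1 + 1/d) * (\<sigma> - s) \<le> (1 + 1/d) * (\<rho> / 2)" using s d by (intro mult_left_mono) auto
  moreover have "(1 + 1/d) * (\<rho> / 2) = r / 8"
  proof -
    have *: "u * (r / (4 * u) / 2) = r / 8" if "u > 0" for u using that by (simp add: field_simps)
    show ?thesis unfolding \<rho>_def by (rule *) (use d in \<open>simp add: add_pos_pos\<close>)
  qed
  ultimately have "2 * d * s + 2 * ((1 + 1/d) * (\<sigma> - s)) < r" using r by argo
  then have "\<forall>\<^sub>F i in H. U i < r" by (rule order_tendstoD(2)[OF U])
  with A show "\<forall>\<^sub>F i in H. dist (trace_norm (A i - S)) 0 < r"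
  proof eventually_elim
    case (elim i)
    then show ?case
      using trace_norm_difference_le[OF B refl, of "A i" S "\<tau> i" \<sigma> F d] S F d by (simp add: U_def)
  qed
qed

section \<open>Boundary values of Poisson integrals\<close>

text \<open>By the Henstock lemma the intervals on which the symmetric difference quotient of the primitive
  is far from \<open>f\<close> have small total length; Vitali's covering theorem extracts them disjointly.\<close>

lemma negligible_symmetric_derivative_fails_by:
  fixes f :: "real \<Rightarrow> real"
  assumes f: "f integrable_on cbox a b" and k: "k > 0"
  shows "negligible {t \<in> {a<..<b}. \<forall>d>0. \<exists>r. 0 < r \<and> r < d \<and> k * (2 * r) \<le> \<bar>2 * r * f t - integral {t - r..t + r} f\<bar>}"
    (is "negligible ?E")
  unfolding negligible_outer_le
proof (intro allI impI)
  fix \<epsilon> :: real assume \<epsilon>: "\<epsilon> > 0"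
  obtain \<gamma> where \<gamma>: "gauge \<gamma>"
    and hen: "\<And>p. \<lbrakk>p tagged_partial_division_of (cbox a b); \<gamma> fine p\<rbrakk> \<Longrightarrow>
             sum (\<lambda>(x,K). norm (Henstock_Kurzweil_Integration.content K *\<^sub>R f x - integral K f)) p < \<epsilon> * k"
    by (rule Henstock_lemma[OF f mult_pos_pos[OF \<epsilon> k]]) (rule that; blast)
  define K where "K = {(t, r). 0 < r \<and> cball t r \<subseteq> \<gamma> t \<and> cball t r \<subseteq> {a<..<b} \<and>
      k * (2 * r) \<le> \<bar>2 * r * f t - integral {t - r..t + r} f\<bar>}"
  have Kpos: "snd i > 0" if "i \<in> K" for i using that by (auto simp: K_def)
  have cov: "\<exists>i. i \<in> K \<and> x \<in> cball (fst i) (snd i) \<and> snd i < d" if x: "x \<in> ?E" and d: "d > 0" for x d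
  proof -
    have "open (\<gamma> x \<inter> {a<..<b})" "x \<in> \<gamma> x \<inter> {a<..<b}"
      using \<gamma> x by (auto simp: gauge_def)
    then obtain \<rho> where \<rho>: "\<rho> > 0" "cball x \<rho> \<subseteq> \<gamma> x \<inter> {a<..<b}" by (meson open_contains_cball)
    obtain r where r: "0 < r" "r < min d \<rho>" "k * (2 * r) \<le> \<bar>2 * r * f x - integral {x - r..x + r} f\<bar>"
    proof -
      have "min d \<rho> > 0" using d \<rho>(1) by simp
      then show ?thesis using x that by blast
    qed
    have "cball x r \<subseteq> cball x \<rho>" using r by (intro subset_cball) auto
    then have "(x, r) \<in> K" using r \<rho> by (auto simp: K_def)
    then show ?thesis using r by (intro exI[of _ "(x, r)"]) auto
  qed
  obtain C where C: "countable C" "C \<subseteq> K"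
     "pairwise (\<lambda>i j. disjnt (cball (fst i) (snd i)) (cball (fst j) (snd j))) C"
     "negligible (?E - (\<Union>i \<in> C. cball (fst i) (snd i)))"
    using Vitali_covering_theorem_cballs[of K snd ?E fst, OF Kpos cov] by blast
  have bound: "(\<Sum>i\<in>D. 2 * snd i) \<le> \<epsilon>" if D: "D \<subseteq> C" "finite D" for D
  proof -
    define p where "p = (\<lambda>i. (fst i, cball (fst i) (snd i))) ` D"
    have inj: "inj_on (\<lambda>i. (fst i, cball (fst i) (snd i))) D"
    proof (rule inj_onI)
      fix i j assume ij: "i \<in> D" "j \<in> D" "(fst i, cball (fst i) (snd i)) = (fst j, cball (fst j) (snd j))"
      then have "snd i > 0" "snd j > 0" using D C Kpos by blast+
      then show "i = j" using ij by (auto simp: cball_eq_atLeastAtMost prod_eq_iff)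
    qed
    have "p tagged_partial_division_of cbox a b"
      unfolding tagged_partial_division_of_def
    proof (intro conjI allI impI)
      show "finite p" using D by (simp add: p_def)
      fix x L assume "(x, L) \<in> p"
      then obtain i where i: "i \<in> D" "x = fst i" "L = cball (fst i) (snd i)" by (auto simp: p_def)
      then have iK: "i \<in> K" using D C by blast
      show "x \<in> L" using i Kpos[OF iK] by simp
      show "L \<subseteq> cbox a b" using iK i by (fastforce simp: K_def)
      show "\<exists>a b. L = cbox a b" using i by (auto simp: cball_eq_atLeastAtMost)
    next
      fix x1 K1 x2 K2 assume "(x1, K1) \<in> p \<and> (x2, K2) \<in> p \<and> (x1, K1) \<noteq> (x2, K2)"
      then obtain i j where ij: "i \<in> D" "j \<in> D" "i \<noteq> j" "K1 = cball (fst i) (snd i)" "K2 = cball (fst j) (snd j)"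
        by (auto simp: p_def)
      then have "disjnt K1 K2" using C(3) D by (auto simp: pairwise_def)
      then show "interior K1 \<inter> interior K2 = {}" using interior_subset by (fastforce simp: disjnt_def)
    qed
    moreover have "\<gamma> fine p" using D C unfolding fine_def p_def by (fastforce simp: K_def)
    ultimately have "sum (\<lambda>(x,K). norm (Henstock_Kurzweil_Integration.content K *\<^sub>R f x - integral K f)) p < \<epsilon> * k" by (rule hen)
    also have "sum (\<lambda>(x,K). norm (Henstock_Kurzweil_Integration.content K *\<^sub>R f x - integral K f)) p
        = (\<Sum>i\<in>D. norm (Henstock_Kurzweil_Integration.content (cball (fst i) (snd i)) *\<^sub>R f (fst i) - integral (cball (fst i) (snd i)) f))"
      unfolding p_def by (subst sum.reindex[OF inj]) simp
    finally have 1: "(\<Sum>i\<in>D. norm (Henstock_Kurzweil_Integration.content (cball (fst i) (snd i)) *\<^sub>R f (fst i) - integral (cball (fst i) (snd i)) f)) < \<epsilon> * k" .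
    have "k * (\<Sum>i\<in>D. 2 * snd i) = (\<Sum>i\<in>D. k * (2 * snd i))" by (simp add: sum_distrib_left)
    also have "\<dots> \<le> (\<Sum>i\<in>D. norm (Henstock_Kurzweil_Integration.content (cball (fst i) (snd i)) *\<^sub>R f (fst i) - integral (cball (fst i) (snd i)) f))"
    proof (rule sum_mono)
      fix i assume "i \<in> D"
      then have i: "i \<in> K" using D C by blast
      have "Henstock_Kurzweil_Integration.content {fst i - snd i..fst i + snd i} = 2 * snd i" using Kpos[OF i] by simp
      then show "k * (2 * snd i) \<le> norm (Henstock_Kurzweil_Integration.content (cball (fst i) (snd i)) *\<^sub>R f (fst i) - integral (cball (fst i) (snd i)) f)"
        using i by (auto simp: K_def cball_eq_atLeastAtMost)
    qed
    finally have "k * (\<Sum>i\<in>D. 2 * snd i) < k * \<epsilon>" using 1 by (simp add: mult.commute)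
    then show ?thesis using k by simp
  qed
  have mb: "measure lebesgue (\<Union>i\<in>D. cball (fst i) (snd i)) \<le> \<epsilon>" if D: "D \<subseteq> C" "finite D" for D
  proof -
    have "measure lebesgue (\<Union>i\<in>D. cball (fst i) (snd i)) \<le> (\<Sum>i\<in>D. measure lebesgue (cball (fst i) (snd i)))"
      by (rule measure_UNION_le[OF D(2)]) auto
    also have "\<dots> = (\<Sum>i\<in>D. 2 * snd i)"
    proof (rule sum.cong)
      fix i assume "i \<in> D"
      then have "snd i > 0" using D C Kpos by blast
      then show "measure lebesgue (cball (fst i) (snd i)) = 2 * snd i"
        by (simp add: cball_eq_atLeastAtMost measure_completion)
    qed simp
    finally show ?thesis using bound[OF D] by simp
  qed
  let ?T = "\<Union>i\<in>C. cball (fst i) (snd i)"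
  have T: "?T \<in> lmeasurable" "measure lebesgue ?T \<le> \<epsilon>"
    by (rule fmeasurable_UN_bound[OF C(1) _ mb] measure_UN_bound[OF C(1) _ mb]; simp)+
  let ?N = "?E - ?T"
  have N: "?N \<in> lmeasurable" "measure lebesgue ?N = 0"
    using C(4) negligible_iff_measure by blast+
  show "\<exists>T. ?E \<subseteq> T \<and> T \<in> lmeasurable \<and> measure lebesgue T \<le> \<epsilon>"
  proof (intro exI[of _ "?T \<union> ?N"] conjI)
    show "?T \<union> ?N \<in> lmeasurable" by (rule fmeasurable.Un[OF T(1) N(1)])
    have "measure lebesgue (?T \<union> ?N) \<le> measure lebesgue ?T + measure lebesgue ?N"
      by (rule measure_Un_le) (use T N in auto)
    then show "measure lebesgue (?T \<union> ?N) \<le> \<epsilon>" using T N by simp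
  qed auto
qed

text \<open>The exceptional set is a countable union, over bounded intervals and error bounds \<open>1 / (m + 1)\<close>, of
  the preceding negligible sets.\<close>
lemma symmetric_derivative_AE:
  fixes f :: "real \<Rightarrow> real"
  assumes f: "\<And>a b. f integrable_on cbox a b"
  shows "AE t in lebesgue. ((\<lambda>r. integral {t - r..t + r} f / (2 * r)) \<longlongrightarrow> f t) (at_right 0)"
proof -
  define E where "E n m = {t \<in> {- real n<..<real n}. \<forall>d>0. \<exists>r. 0 < r \<and> r < d \<and>
      (1 / real (Suc m)) * (2 * r) \<le> \<bar>2 * r * f t - integral {t - r..t + r} f\<bar>}" for n m :: nat
  have "negligible (E n m)" for n m
    unfolding E_def by (rule negligible_symmetric_derivative_fails_by[OF f]) simp
  then have "negligible (\<Union>n. \<Union>m. E n m)"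
    by (intro negligible_countable_Union) (auto intro!: negligible_countable_Union)
  then have null: "(\<Union>n. \<Union>m. E n m) \<in> null_sets lebesgue" by (simp add: negligible_iff_null_sets)
  show ?thesis
  proof (rule AE_I'[OF null], rule subsetI, rule ccontr)
    fix t assume t: "t \<in> {t \<in> space lebesgue. \<not> ((\<lambda>r. integral {t - r..t + r} f / (2 * r)) \<longlongrightarrow> f t) (at_right 0)}"
      and nt: "t \<notin> (\<Union>n. \<Union>m. E n m)"
    have "((\<lambda>r. integral {t - r..t + r} f / (2 * r)) \<longlongrightarrow> f t) (at_right 0)"
    proof (rule tendstoI)
      fix e :: real assume e: "e > 0"
      then obtain m where m: "inverse (real (Suc m)) < e" using reals_Archimedean by blast
      obtain n where n: "\<bar>t\<bar> < real n" using reals_Archimedean2 by blast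
      have "t \<notin> E n m" using nt by blast
      then obtain d where d: "d > 0" "\<And>r. 0 < r \<Longrightarrow> r < d \<Longrightarrow>
          \<bar>2 * r * f t - integral {t - r..t + r} f\<bar> < (1 / real (Suc m)) * (2 * r)"
        using n unfolding E_def by (auto simp: not_le)
      show "\<forall>\<^sub>F r in at_right 0. dist (integral {t - r..t + r} f / (2 * r)) (f t) < e"
        unfolding eventually_at_right_field
      proof (intro exI[of _ d] conjI allI impI d(1))
        fix r :: real assume r: "0 < r" "r < d"
        have "dist (integral {t - r..t + r} f / (2 * r)) (f t) = \<bar>2 * r * f t - integral {t - r..t + r} f\<bar> / (2 * r)"
          using r by (simp add: dist_real_def field_simps abs_minus_commute)
        also have "\<dots> < inverse (real (Suc m))"
          using d(2)[OF r] r by (simp add: field_simps)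
        also have "\<dots> < e" by (rule m)
        finally show "dist (integral {t - r..t + r} f / (2 * r)) (f t) < e" .
      qed
    qed
    then show False using t by simp
  qed
qed

text \<open>The Poisson kernel is a mixture of the uniform distributions on the intervals \<open>[t - r, t + r]\<close>.
  This reduces boundary values of Poisson integrals to symmetric derivatives.\<close>

lemma poisson_kernel_mixture:
  assumes "\<epsilon> > 0" "c \<ge> 0"
  shows "(\<integral>\<^sup>+r. ennreal (2 * r * \<epsilon> / (r\<^sup>2 + \<epsilon>\<^sup>2)\<^sup>2) * indicator {c..} r \<partial>lborel) = ennreal (\<epsilon> / (c\<^sup>2 + \<epsilon>\<^sup>2))"
proof -
  have "(\<integral>\<^sup>+r. ennreal (2 * r * \<epsilon> / (r\<^sup>2 + \<epsilon>\<^sup>2)\<^sup>2) * indicator {c..} r \<partial>lborel) = ennreal (0 - (- (\<epsilon> / (c\<^sup>2 + \<epsilon>\<^sup>2))))"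
  proof (rule nn_integral_FTC_atLeast)
    show "((\<lambda>r. - (\<epsilon> / (r\<^sup>2 + \<epsilon>\<^sup>2))) has_real_derivative 2 * r * \<epsilon> / (r\<^sup>2 + \<epsilon>\<^sup>2)\<^sup>2) (at r)" for r
    proof -
      have "r\<^sup>2 + \<epsilon>\<^sup>2 \<noteq> 0" using assms by (simp add: sum_power2_eq_zero_iff)
      then show ?thesis by (auto intro!: derivative_eq_intros simp: power2_eq_square)
    qed
    show "((\<lambda>r. - (\<epsilon> / (r\<^sup>2 + \<epsilon>\<^sup>2))) \<longlongrightarrow> 0) at_top" by real_asymp
  qed (use assms in auto)
  then show ?thesis by simp
qed

lemma poisson_kernel_le:
  fixes s t \<epsilon> :: real
  assumes \<epsilon>: "\<epsilon> > 0"
  shows "\<epsilon> / ((s - t)\<^sup>2 + \<epsilon>\<^sup>2) \<le> \<epsilon> * (2 + (1 + 2 * t\<^sup>2) / \<epsilon>\<^sup>2) * (1 / (1 + s\<^sup>2))"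
proof -
  define c where "c = 2 + (1 + 2 * t\<^sup>2) / \<epsilon>\<^sup>2"
  have pos: "1 + s\<^sup>2 > 0" "(s - t)\<^sup>2 + \<epsilon>\<^sup>2 > 0" using \<epsilon> by (simp_all add: add_pos_nonneg add_nonneg_pos)
  have "0 \<le> (s - 2 * t)\<^sup>2" by simp
  then have "s\<^sup>2 \<le> 2 * (s - t)\<^sup>2 + 2 * t\<^sup>2" by (simp add: power2_eq_square algebra_simps)
  then have "1 + s\<^sup>2 \<le> 2 * (s - t)\<^sup>2 + (1 + 2 * t\<^sup>2)" by simp
  also have "\<dots> \<le> c * ((s - t)\<^sup>2 + \<epsilon>\<^sup>2)"
  proof -
    have "c * ((s - t)\<^sup>2 + \<epsilon>\<^sup>2) = 2 * (s - t)\<^sup>2 + (1 + 2 * t\<^sup>2) + ((1 + 2 * t\<^sup>2) / \<epsilon>\<^sup>2 * (s - t)\<^sup>2 + 2 * \<epsilon>\<^sup>2)"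
      using \<epsilon> by (simp add: c_def distrib_left distrib_right add_divide_distrib)
    moreover have "0 \<le> (1 + 2 * t\<^sup>2) / \<epsilon>\<^sup>2 * (s - t)\<^sup>2 + 2 * \<epsilon>\<^sup>2" by simp
    ultimately show ?thesis by linarith
  qed
  finally have "1 / ((s - t)\<^sup>2 + \<epsilon>\<^sup>2) \<le> c * (1 / (1 + s\<^sup>2))"
    using pos by (simp add: field_simps)
  then have "\<epsilon> * (1 / ((s - t)\<^sup>2 + \<epsilon>\<^sup>2)) \<le> \<epsilon> * (c * (1 / (1 + s\<^sup>2)))"
    using \<epsilon> by (intro mult_left_mono) auto
  then show ?thesis by (simp add: c_def mult.assoc)
qed

text \<open>Integrating the mixture against \<open>u\<close> and exchanging the integrals expresses the Poisson integral
  through the integrals of \<open>u\<close> over centred intervals.\<close>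
lemma poisson_mixture:
  fixes u :: "real \<Rightarrow> real"
  assumes um[measurable]: "u \<in> borel_measurable borel" and u0: "\<And>s. u s \<ge> 0"
    and ui: "integrable lborel (\<lambda>s. u s / (1 + s\<^sup>2))" and \<epsilon>: "\<epsilon> > 0"
  shows "integrable lborel (\<lambda>s. \<epsilon> / ((s - t)\<^sup>2 + \<epsilon>\<^sup>2) * u s)"
    and "integrable lborel (\<lambda>s. indicator {t - r..t + r} s * u s)"
    and "has_bochner_integral lborel (\<lambda>r. indicator {0..} r * (2 * r * \<epsilon> / (r\<^sup>2 + \<epsilon>\<^sup>2)\<^sup>2) *
        (LINT s|lborel. indicator {t - r..t + r} s * u s))
        (LINT s|lborel. \<epsilon> / ((s - t)\<^sup>2 + \<epsilon>\<^sup>2) * u s)"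
proof -
  have pos1: "1 + s\<^sup>2 > 0" for s :: real by (simp add: add_pos_nonneg)
  have pos2: "(s - t)\<^sup>2 + \<epsilon>\<^sup>2 > 0" for s using \<epsilon> by (simp add: add_nonneg_pos)
  show I: "integrable lborel (\<lambda>s. \<epsilon> / ((s - t)\<^sup>2 + \<epsilon>\<^sup>2) * u s)"
  proof (rule Bochner_Integration.integrable_bound)
    define c where "c = 2 + (1 + 2 * t\<^sup>2) / \<epsilon>\<^sup>2"
    have c: "c \<ge> 0" by (simp add: c_def)
    show "integrable lborel (\<lambda>s. (\<epsilon> * c) * (u s / (1 + s\<^sup>2)))" using ui by (rule integrable_mult_right)
    have "norm (\<epsilon> / ((s - t)\<^sup>2 + \<epsilon>\<^sup>2) * u s) \<le> norm ((\<epsilon> * c) * (u s / (1 + s\<^sup>2)))" for s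
      using mult_right_mono[OF poisson_kernel_le[OF \<epsilon>, of s t] u0[of s]] \<epsilon> u0[of s] c pos1[of s] pos2[of s]
      by (simp add: c_def[symmetric])
    then show "AE s in lborel. norm (\<epsilon> / ((s - t)\<^sup>2 + \<epsilon>\<^sup>2) * u s) \<le> norm ((\<epsilon> * c) * (u s / (1 + s\<^sup>2)))" by simp
  qed measurable
  show J: "integrable lborel (\<lambda>s. indicator {t - r..t + r} s * u s)" for r
  proof (rule Bochner_Integration.integrable_bound)
    define M where "M = \<bar>t\<bar> + \<bar>r\<bar>"
    show "integrable lborel (\<lambda>s. (1 + M\<^sup>2) * (u s / (1 + s\<^sup>2)))" using ui by (rule integrable_mult_right)
    have "norm (indicator {t - r..t + r} s * u s) \<le> norm ((1 + M\<^sup>2) * (u s / (1 + s\<^sup>2)))" for s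
    proof (cases "s \<in> {t - r..t + r}")
      case True
      then have "\<bar>s\<bar> \<le> \<bar>M\<bar>" by (auto simp: M_def)
      then have "1 + s\<^sup>2 \<le> 1 + M\<^sup>2" by (simp add: abs_le_square_iff)
      then have "u s * (1 + s\<^sup>2) \<le> u s * (1 + M\<^sup>2)" using u0[of s] by (rule mult_left_mono)
      then have "u s \<le> (1 + M\<^sup>2) * (u s / (1 + s\<^sup>2))" using pos1[of s] by (simp add: field_simps)
      then show ?thesis using True u0[of s] by simp
    qed simp
    then show "AE s in lborel. norm (indicator {t - r..t + r} s * u s) \<le> norm ((1 + M\<^sup>2) * (u s / (1 + s\<^sup>2)))" by simp
  qed measurable
  let ?w = "\<lambda>r. 2 * r * \<epsilon> / (r\<^sup>2 + \<epsilon>\<^sup>2)\<^sup>2"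
  let ?U = "\<lambda>r. LINT s|lborel. indicator {t - r..t + r} s * u s"
  have U: "ennreal (?U r) = (\<integral>\<^sup>+s. ennreal (u s) * indicator {p. \<bar>snd p - t\<bar> \<le> fst p} (r, s) \<partial>lborel)" for r
  proof -
    have "ennreal (?U r) = (\<integral>\<^sup>+s. ennreal (indicator {t - r..t + r} s * u s) \<partial>lborel)"
      by (rule nn_integral_eq_integral[OF J, symmetric]) (use u0 in simp)
    also have "\<dots> = (\<integral>\<^sup>+s. ennreal (u s) * indicator {p. \<bar>snd p - t\<bar> \<le> fst p} (r, s) \<partial>lborel)"
      by (intro nn_integral_cong) (auto simp: indicator_def)
    finally show ?thesis .
  qed
  have cl: "closed {p :: real \<times> real. \<bar>snd p - t\<bar> \<le> fst p}"
    by (intro closed_Collect_le continuous_intros)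
  have "sets (lborel \<Otimes>\<^sub>M lborel) = sets (borel :: (real \<times> real) measure)"
    unfolding lborel_prod by (rule sets_lborel)
  then have m2[measurable]: "{p :: real \<times> real. \<bar>snd p - t\<bar> \<le> fst p} \<in> sets (lborel \<Otimes>\<^sub>M lborel)"
    using borel_closed[OF cl] by blast
  have Um[measurable]: "?U \<in> borel_measurable lborel"
  proof -
    have "(\<lambda>r. \<integral>\<^sup>+s. ennreal (u s) * indicator {p. \<bar>snd p - t\<bar> \<le> fst p} (r, s) \<partial>lborel) \<in> borel_measurable lborel"
      by measurable
    then have "(\<lambda>r. enn2real (ennreal (?U r))) \<in> borel_measurable lborel"
      unfolding U by measurable
    then show ?thesis by (simp add: u0)
  qed
  have U0: "?U r \<ge> 0" for r using u0 by simp
  have w0: "indicator {0..} r * ?w r \<ge> 0" for r using \<epsilon> by (simp add: indicator_def)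
  have "(\<integral>\<^sup>+r. ennreal (indicator {0..} r * ?w r * ?U r) \<partial>lborel)
      = (\<integral>\<^sup>+r. (\<integral>\<^sup>+s. ennreal (indicator {0..} r * ?w r) * (ennreal (u s) * indicator {p. \<bar>snd p - t\<bar> \<le> fst p} (r, s)) \<partial>lborel) \<partial>lborel)"
  proof (rule nn_integral_cong)
    fix r
    have "ennreal (indicator {0..} r * ?w r * ?U r) = ennreal (indicator {0..} r * ?w r) * ennreal (?U r)"
      by (rule ennreal_mult[OF w0 U0])
    also have "\<dots> = (\<integral>\<^sup>+s. ennreal (indicator {0..} r * ?w r) * (ennreal (u s) * indicator {p. \<bar>snd p - t\<bar> \<le> fst p} (r, s)) \<partial>lborel)"
      unfolding U by (rule nn_integral_cmult[symmetric]) measurable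
    finally show "ennreal (indicator {0..} r * ?w r * ?U r)
      = (\<integral>\<^sup>+s. ennreal (indicator {0..} r * ?w r) * (ennreal (u s) * indicator {p. \<bar>snd p - t\<bar> \<le> fst p} (r, s)) \<partial>lborel)" .
  qed
  also have "\<dots> = (\<integral>\<^sup>+s. (\<integral>\<^sup>+r. ennreal (indicator {0..} r * ?w r) * (ennreal (u s) * indicator {p. \<bar>snd p - t\<bar> \<le> fst p} (r, s)) \<partial>lborel) \<partial>lborel)"
    by (rule lborel_pair.Fubini'[symmetric]) measurable
  also have "\<dots> = (\<integral>\<^sup>+s. ennreal (\<epsilon> / ((s - t)\<^sup>2 + \<epsilon>\<^sup>2) * u s) \<partial>lborel)"
  proof (intro nn_integral_cong)
    fix s
    have "(\<integral>\<^sup>+r. ennreal (indicator {0..} r * ?w r) * (ennreal (u s) * indicator {p. \<bar>snd p - t\<bar> \<le> fst p} (r, s)) \<partial>lborel)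
        = (\<integral>\<^sup>+r. ennreal (u s) * (ennreal (?w r) * indicator {\<bar>s - t\<bar>..} r) \<partial>lborel)"
      by (intro nn_integral_cong) (auto simp: indicator_def mult.commute)
    also have "\<dots> = ennreal (u s) * (\<integral>\<^sup>+r. ennreal (?w r) * indicator {\<bar>s - t\<bar>..} r \<partial>lborel)"
      by (rule nn_integral_cmult) measurable
    also have "\<dots> = ennreal (u s) * ennreal (\<epsilon> / (\<bar>s - t\<bar>\<^sup>2 + \<epsilon>\<^sup>2))"
      by (subst poisson_kernel_mixture[OF \<epsilon>]) auto
    also have "\<dots> = ennreal (\<epsilon> / ((s - t)\<^sup>2 + \<epsilon>\<^sup>2) * u s)"
      using u0[of s] \<epsilon> by (simp add: mult.commute flip: ennreal_mult)
    finally show "(\<integral>\<^sup>+r. ennreal (indicator {0..} r * ?w r) * (ennreal (u s) * indicator {p. \<bar>snd p - t\<bar> \<le> fst p} (r, s)) \<partial>lborel)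
        = ennreal (\<epsilon> / ((s - t)\<^sup>2 + \<epsilon>\<^sup>2) * u s)" .
  qed
  also have "\<dots> = ennreal (LINT s|lborel. \<epsilon> / ((s - t)\<^sup>2 + \<epsilon>\<^sup>2) * u s)"
    by (rule nn_integral_eq_integral[OF I]) (use u0 \<epsilon> in simp)
  finally have eq: "(\<integral>\<^sup>+r. ennreal (indicator {0..} r * ?w r * ?U r) \<partial>lborel)
      = ennreal (LINT s|lborel. \<epsilon> / ((s - t)\<^sup>2 + \<epsilon>\<^sup>2) * u s)" .
  show "has_bochner_integral lborel (\<lambda>r. indicator {0..} r * ?w r * ?U r) (LINT s|lborel. \<epsilon> / ((s - t)\<^sup>2 + \<epsilon>\<^sup>2) * u s)"
  proof (rule has_bochner_integral_nn_integral[OF _ _ _ eq])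
    show "AE r in lborel. 0 \<le> indicator {0..} r * ?w r * ?U r"
      by (rule AE_I2) (rule mult_nonneg_nonneg[OF w0 U0])
    show "0 \<le> (LINT s|lborel. \<epsilon> / ((s - t)\<^sup>2 + \<epsilon>\<^sup>2) * u s)"
      using u0 \<epsilon> by (intro integral_nonneg_AE) auto
  qed measurable
qed

lemma poisson_kernel_integral:
  assumes \<epsilon>: "\<epsilon> > 0"
  shows "has_bochner_integral lborel (\<lambda>s. \<epsilon> / ((s - t)\<^sup>2 + \<epsilon>\<^sup>2)) pi"
proof -
  have "(\<integral>\<^sup>+s. ennreal (\<epsilon> / (s\<^sup>2 + \<epsilon>\<^sup>2)) * indicator {0..} s \<partial>lborel) = ennreal (pi / 2 - arctan (0 / \<epsilon>))"
  proof (rule nn_integral_FTC_atLeast)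
    show "((\<lambda>s. arctan (s / \<epsilon>)) has_real_derivative \<epsilon> / (s\<^sup>2 + \<epsilon>\<^sup>2)) (at s)" for s
      using \<epsilon> by (auto intro!: derivative_eq_intros simp: field_simps power2_eq_square)
    show "((\<lambda>s. arctan (s / \<epsilon>)) \<longlongrightarrow> pi / 2) at_top"
      using \<epsilon> by (intro filterlim_compose[OF tendsto_arctan_at_top]) real_asymp
  qed (use \<epsilon> in auto)
  moreover have "(\<integral>\<^sup>+s. ennreal (indicator {0..} s * (\<epsilon> / (s\<^sup>2 + \<epsilon>\<^sup>2))) \<partial>lborel)
      = (\<integral>\<^sup>+s. ennreal (\<epsilon> / (s\<^sup>2 + \<epsilon>\<^sup>2)) * indicator {0..} s \<partial>lborel)"
    by (intro nn_integral_cong) (auto simp: indicator_def)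
  ultimately have "has_bochner_integral lborel (\<lambda>s. indicator {0..} s *\<^sub>R (\<epsilon> / (s\<^sup>2 + \<epsilon>\<^sup>2))) (pi / 2)"
    using \<epsilon> by (intro has_bochner_integral_nn_integral) auto
  then have "has_bochner_integral lborel (\<lambda>s. \<epsilon> / (s\<^sup>2 + \<epsilon>\<^sup>2)) (2 *\<^sub>R (pi / 2))"
    by (rule has_bochner_integral_even_function) simp
  then have "has_bochner_integral lborel (\<lambda>s. \<epsilon> / ((s - t)\<^sup>2 + \<epsilon>\<^sup>2)) pi"
    by (subst lborel_has_bochner_integral_real_affine_iff[where c=1 and t=t]) simp_all
  then show ?thesis .
qed

text \<open>In the mixture, radii below \<open>\<delta>\<close> contribute up to the error of the symmetric difference quotient,
  since the mixing density \<open>w \<epsilon> r\<close> has total weight \<open>\<pi>\<close> against \<open>2 r\<close>. For radii above \<open>\<delta>\<close> it is at most a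
  constant times \<open>\<epsilon> w 1 r\<close>, which is integrable against the same averages.\<close>
lemma poisson_limit_at_point:
  fixes u :: "real \<Rightarrow> real"
  assumes um[measurable]: "u \<in> borel_measurable borel" and u0: "\<And>s. u s \<ge> 0"
    and ui: "integrable lborel (\<lambda>s. u s / (1 + s\<^sup>2))"
    and lim: "((\<lambda>r. (LINT s|lborel. indicator {t - r..t + r} s * u s) / (2 * r)) \<longlongrightarrow> u t) (at_right 0)"
  shows "((\<lambda>\<epsilon>. LINT s|lborel. \<epsilon> / ((s - t)\<^sup>2 + \<epsilon>\<^sup>2) * u s) \<longlongrightarrow> pi * u t) (at_right 0)"
proof (rule tendstoI)
  fix e :: real assume e: "e > 0"
  define U where "U r = (LINT s|lborel. indicator {t - r..t + r} s * u s)" for r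
  define w where "w \<epsilon> r = indicator {0..} r * (2 * r * \<epsilon> / (r\<^sup>2 + \<epsilon>\<^sup>2)\<^sup>2)" for \<epsilon> r :: real
  define K where "K \<epsilon> = (LINT s|lborel. \<epsilon> / ((s - t)\<^sup>2 + \<epsilon>\<^sup>2) * u s)" for \<epsilon>
  have KU: "has_bochner_integral lborel (\<lambda>r. w \<epsilon> r * U r) (K \<epsilon>)" if "\<epsilon> > 0" for \<epsilon>
    using poisson_mixture(3)[OF um u0 ui that, of t] unfolding U_def w_def K_def .
  have P: "has_bochner_integral lborel (\<lambda>r. w \<epsilon> r * (2 * r)) pi" if "\<epsilon> > 0" for \<epsilon>
  proof -
    have "integrable lborel (\<lambda>s. 1 / (1 + s\<^sup>2) :: real)"
      using poisson_kernel_integral[of 1 0]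
      by (simp add: has_bochner_integral_iff add.commute)
    from poisson_mixture(3)[OF _ _ this that, of t]
    have *: "has_bochner_integral lborel (\<lambda>r. w \<epsilon> r * (LINT s|lborel. indicator {t - r..t + r} s)) (LINT s|lborel. \<epsilon> / ((s - t)\<^sup>2 + \<epsilon>\<^sup>2))"
      by (simp add: w_def)
    have 1: "w \<epsilon> r * (LINT s|lborel. indicator {t - r..t + r} s) = w \<epsilon> r * (2 * r)" for r
      by (cases "r \<ge> 0") (simp_all add: w_def)
    have 2: "(LINT s|lborel. \<epsilon> / ((s - t)\<^sup>2 + \<epsilon>\<^sup>2)) = pi"
      using poisson_kernel_integral[OF that, of t] by (rule has_bochner_integral_integral_eq)
    show ?thesis using * unfolding 1 2 .
  qed
  have U0: "U r \<ge> 0" for r using u0 unfolding U_def by simp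
  define \<eta> where "\<eta> = e / (2 * pi)"
  have \<eta>: "\<eta> > 0" using e by (simp add: \<eta>_def)
  obtain \<delta> where \<delta>: "\<delta> > 0" "\<And>r. 0 < r \<Longrightarrow> r < \<delta> \<Longrightarrow> dist (U r / (2 * r)) (u t) < \<eta>"
    using tendstoD[OF lim \<eta>] unfolding eventually_at_right_field U_def by blast
  define c where "c = (1 + 1 / \<delta>\<^sup>2)\<^sup>2"
  have c: "c \<ge> 0" by (simp add: c_def)
  define S where "S = K 1 + pi * u t"
  have bound: "\<bar>K \<epsilon> - pi * u t\<bar> \<le> \<eta> * pi + \<epsilon> * c * S" if \<epsilon>: "\<epsilon> > 0" for \<epsilon>
  proof -
    have d: "has_bochner_integral lborel (\<lambda>r. w \<epsilon> r * U r - w \<epsilon> r * (2 * r) * u t) (K \<epsilon> - pi * u t)"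
      by (intro has_bochner_integral_diff has_bochner_integral_mult_left KU P \<epsilon>)
    have g: "has_bochner_integral lborel (\<lambda>r. \<eta> * (w \<epsilon> r * (2 * r)) + \<epsilon> * c * (w 1 r * U r + w 1 r * (2 * r) * u t))
        (\<eta> * pi + \<epsilon> * c * S)"
      unfolding S_def
      by (intro has_bochner_integral_add has_bochner_integral_mult_right has_bochner_integral_mult_left KU P \<epsilon>) auto
    have "norm (LINT r|lborel. w \<epsilon> r * U r - w \<epsilon> r * (2 * r) * u t)
        \<le> (LINT r|lborel. \<eta> * (w \<epsilon> r * (2 * r)) + \<epsilon> * c * (w 1 r * U r + w 1 r * (2 * r) * u t))"
    proof (rule Bochner_Integration.integral_norm_bound_integral)
      fix r :: real
      have w1: "w 1 r \<ge> 0" and w\<epsilon>: "w \<epsilon> r \<ge> 0" using \<epsilon> by (auto simp: w_def indicator_def)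
      show "norm (w \<epsilon> r * U r - w \<epsilon> r * (2 * r) * u t)
          \<le> \<eta> * (w \<epsilon> r * (2 * r)) + \<epsilon> * c * (w 1 r * U r + w 1 r * (2 * r) * u t)"
      proof (cases "r > 0")
        case False
        then have "w \<epsilon> r = 0" "w 1 r = 0" by (auto simp: w_def indicator_def)
        then show ?thesis by simp
      next
        case True
        have nn: "0 \<le> \<epsilon> * c * (w 1 r * U r + w 1 r * (2 * r) * u t)"
          using \<epsilon> c w1 U0[of r] u0[of t] True by simp
        have dd: "w \<epsilon> r * U r - w \<epsilon> r * (2 * r) * u t = w \<epsilon> r * (U r - 2 * r * u t)" by (simp add: algebra_simps)
        show ?thesis
        proof (cases "r < \<delta>")
          case r: True
          have "\<bar>U r - 2 * r * u t\<bar> = 2 * r * dist (U r / (2 * r)) (u t)"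
          proof -
            have "U r - 2 * r * u t = 2 * r * (U r / (2 * r) - u t)" using True by (simp add: right_diff_distrib)
            then show ?thesis using True by (simp add: abs_mult dist_real_def)
          qed
          also have "\<dots> \<le> 2 * r * \<eta>" using \<delta>(2)[OF True r] True by simp
          finally have "w \<epsilon> r * \<bar>U r - 2 * r * u t\<bar> \<le> w \<epsilon> r * (2 * r * \<eta>)" using w\<epsilon> by (rule mult_left_mono)
          then have "norm (w \<epsilon> r * U r - w \<epsilon> r * (2 * r) * u t) \<le> \<eta> * (w \<epsilon> r * (2 * r))"
            unfolding dd using w\<epsilon> by (simp add: abs_mult mult_ac)
          then show ?thesis using nn by linarith
        next
          case r: False
          have "w \<epsilon> r \<le> \<epsilon> * c * w 1 r"
          proof -
            have "w \<epsilon> r \<le> 2 * r * \<epsilon> / (r\<^sup>2)\<^sup>2"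
            proof -
              have "(r\<^sup>2)\<^sup>2 \<le> (r\<^sup>2 + \<epsilon>\<^sup>2)\<^sup>2" by (intro power_mono) auto
              moreover have "(r\<^sup>2)\<^sup>2 > 0" using True by simp
              ultimately have "2 * r * \<epsilon> / (r\<^sup>2 + \<epsilon>\<^sup>2)\<^sup>2 \<le> 2 * r * \<epsilon> / (r\<^sup>2)\<^sup>2"
                using True \<epsilon> by (intro divide_left_mono mult_pos_pos) auto
              then show ?thesis using True by (simp add: w_def)
            qed
            also have "\<dots> = \<epsilon> * (1 + 1 / r\<^sup>2)\<^sup>2 * w 1 r"
            proof -
              have "1 + 1 / r\<^sup>2 = (r\<^sup>2 + 1) / r\<^sup>2" using True by (simp add: field_simps)
              moreover have "(r\<^sup>2 + 1)\<^sup>2 \<noteq> 0" using True by (simp add: add_nonneg_eq_0_iff)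
              ultimately show ?thesis using True by (simp add: w_def power_divide)
            qed
            also have "\<dots> \<le> \<epsilon> * c * w 1 r"
            proof -
              have "1 / r\<^sup>2 \<le> 1 / \<delta>\<^sup>2" using r \<delta> True by (intro divide_left_mono power_mono) auto
              then have "(1 + 1 / r\<^sup>2)\<^sup>2 \<le> c" unfolding c_def by (intro power_mono) auto
              then show ?thesis using \<epsilon> w1 by (intro mult_right_mono mult_left_mono) auto
            qed
            finally show ?thesis .
          qed
          then have "w \<epsilon> r * \<bar>U r - 2 * r * u t\<bar> \<le> (\<epsilon> * c * w 1 r) * (U r + 2 * r * u t)"
            using U0[of r] u0[of t] True \<epsilon> c w1 by (intro mult_mono) (auto simp: abs_le_iff)
          moreover have "0 \<le> \<eta> * (w \<epsilon> r * (2 * r))" using \<eta> w\<epsilon> True by simp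
          moreover have "norm (w \<epsilon> r * (U r - 2 * r * u t)) = w \<epsilon> r * \<bar>U r - 2 * r * u t\<bar>"
            using w\<epsilon> by (simp add: abs_mult)
          moreover have "(\<epsilon> * c * w 1 r) * (U r + 2 * r * u t) = \<epsilon> * c * (w 1 r * U r + w 1 r * (2 * r) * u t)"
            by (simp add: algebra_simps)
          ultimately show ?thesis unfolding dd by linarith
        qed
      qed
    qed (use d g in \<open>auto simp: has_bochner_integral_iff\<close>)
    then show ?thesis using d g by (simp add: has_bochner_integral_iff)
  qed
  have S: "S \<ge> 0"
  proof -
    have "K 1 \<ge> 0" unfolding K_def using u0 by simp
    then show ?thesis using u0 by (simp add: S_def)
  qed
  have "((\<lambda>\<epsilon>. \<eta> * pi + \<epsilon> * c * S) \<longlongrightarrow> \<eta> * pi + 0 * c * S) (at_right 0)"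
    by (intro tendsto_intros)
  moreover have "\<eta> * pi + 0 * c * S < e" using e by (simp add: \<eta>_def)
  ultimately have "\<forall>\<^sub>F \<epsilon> in at_right 0. \<eta> * pi + \<epsilon> * c * S < e" by (rule order_tendstoD(2))
  moreover have "\<forall>\<^sub>F \<epsilon> in at_right (0::real). \<epsilon> > 0" by (simp add: eventually_at_right_less)
  ultimately show "\<forall>\<^sub>F \<epsilon> in at_right 0. dist (LINT s|lborel. \<epsilon> / ((s - t)\<^sup>2 + \<epsilon>\<^sup>2) * u s) (pi * u t) < e"
  proof eventually_elim
    case (elim \<epsilon>)
    then show ?case using bound[of \<epsilon>] by (simp add: K_def dist_real_def)
  qed
qed

text \<open>Fatou's theorem on boundary values: it holds wherever the indefinite integral of a Borel
  representative has the symmetric derivative that it should have.\<close>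
lemma poisson_limit_AE:
  fixes u :: "real \<Rightarrow> real"
  assumes um: "u \<in> borel_measurable lebesgue" and u0: "AE s in lebesgue. u s \<ge> 0"
    and ui: "integrable lebesgue (\<lambda>s. u s / (1 + s\<^sup>2))"
  shows "AE t in lebesgue. ((\<lambda>\<epsilon>. LINT s|lebesgue. \<epsilon> / ((s - t)\<^sup>2 + \<epsilon>\<^sup>2) * u s) \<longlongrightarrow> pi * u t) (at_right 0)"
proof -
  obtain u' where u'[measurable]: "u' \<in> borel_measurable lborel" and eq: "AE s in lborel. u s = u' s"
    using completion_ex_borel_measurable_real[OF um] by auto
  define v where "v s = max 0 (u' s)" for s
  have vm[measurable]: "v \<in> borel_measurable borel" using u' unfolding v_def by simp
  have v0: "v s \<ge> 0" for s by (simp add: v_def)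
  have uv: "AE s in lebesgue. u s = v s"
    using AE_completion[OF eq] u0 by eventually_elim (simp add: v_def)
  have "integrable lebesgue (\<lambda>s. v s / (1 + s\<^sup>2))"
    using ui by (rule Bochner_Integration.integrable_cong_AE_imp) (use uv in \<open>auto intro: measurable_completion\<close>)
  then have vi: "integrable lborel (\<lambda>s. v s / (1 + s\<^sup>2))"
    by (subst (asm) integrable_completion) measurable
  have J: "set_integrable lborel {t - r..t + r} v" for t r
    using poisson_mixture(2)[OF vm v0 vi zero_less_one] unfolding set_integrable_def by simp
  have "v integrable_on cbox a b" for a b
    using set_borel_integral_eq_integral(1)[OF J[of "(a+b)/2" "(b-a)/2"]] by (simp add: field_simps)
  from symmetric_derivative_AE[OF this]
  have "AE t in lebesgue. ((\<lambda>\<epsilon>. LINT s|lborel. \<epsilon> / ((s - t)\<^sup>2 + \<epsilon>\<^sup>2) * v s) \<longlongrightarrow> pi * v t) (at_right 0)"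
  proof eventually_elim
    case (elim t)
    have "integral {t - r..t + r} v = (LINT s|lborel. indicator {t - r..t + r} s * v s)" for r
      using set_borel_integral_eq_integral(2)[OF J[of t r]] by (simp add: set_lebesgue_integral_def)
    then show ?case using elim by (intro poisson_limit_at_point vm v0 vi) simp
  qed
  moreover have "(LINT s|lebesgue. \<epsilon> / ((s - t)\<^sup>2 + \<epsilon>\<^sup>2) * u s) = (LINT s|lborel. \<epsilon> / ((s - t)\<^sup>2 + \<epsilon>\<^sup>2) * v s)" for \<epsilon> t
  proof -
    have "(LINT s|lebesgue. \<epsilon> / ((s - t)\<^sup>2 + \<epsilon>\<^sup>2) * u s) = (LINT s|lebesgue. \<epsilon> / ((s - t)\<^sup>2 + \<epsilon>\<^sup>2) * v s)"
    proof (rule integral_cong_AE)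
      have k: "(\<lambda>s. \<epsilon> / ((s - t)\<^sup>2 + \<epsilon>\<^sup>2)) \<in> borel_measurable lebesgue"
        by (rule measurable_completion) measurable
      show "(\<lambda>s. \<epsilon> / ((s - t)\<^sup>2 + \<epsilon>\<^sup>2) * u s) \<in> borel_measurable lebesgue"
        by (intro borel_measurable_times k um)
      show "(\<lambda>s. \<epsilon> / ((s - t)\<^sup>2 + \<epsilon>\<^sup>2) * v s) \<in> borel_measurable lebesgue"
        by (rule measurable_completion) measurable
      show "AE s in lebesgue. \<epsilon> / ((s - t)\<^sup>2 + \<epsilon>\<^sup>2) * u s = \<epsilon> / ((s - t)\<^sup>2 + \<epsilon>\<^sup>2) * v s"
        using uv by eventually_elim simp
    qed
    also have "\<dots> = (LINT s|lborel. \<epsilon> / ((s - t)\<^sup>2 + \<epsilon>\<^sup>2) * v s)"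
      by (rule integral_completion) measurable
    finally show ?thesis .
  qed
  ultimately show ?thesis using uv by (auto elim: eventually_elim2)
qed

section \<open>The operator logarithm\<close>

text \<open>Meant for values in an operator space, which need not be separable: the improper integral is obtained
  from the Cauchy criterion alone.\<close>
lemma improper_integral_quadratic_decay:
  fixes f :: "real \<Rightarrow> 'b::banach"
  assumes cont: "continuous_on {0..} f" and bound: "\<And>t. t \<ge> 0 \<Longrightarrow> norm (f t) \<le> K / (1 + t)\<^sup>2"
  shows "f integrable_on {0..}" "norm (integral {0..} f) \<le> K"
    "(\<lambda>n. integral {0..real n} f) \<longlonglongrightarrow> integral {0..} f"
proof -
  define I where "I b = integral {0..b} f" for b
  have K: "K \<ge> 0" using order_trans[OF norm_ge_zero bound[of 0]] by simp
  have fi: "f integrable_on {a..b}" if "a \<ge> 0" for a b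
    by (rule integrable_continuous_interval, rule continuous_on_subset[OF cont]) (use that in auto)
  have diff: "norm (I c - I b) \<le> K / (1 + b)" if b: "0 \<le> b" "b \<le> c" for b c
  proof -
    have "I c = I b + integral {b..c} f"
      unfolding I_def by (rule Henstock_Kurzweil_Integration.integral_combine[symmetric]) (use b fi in auto)
    then have "norm (I c - I b) = norm (integral {b..c} f)" by simp
    also have "\<dots> \<le> integral {b..c} (\<lambda>t. K / (1 + t)\<^sup>2)"
    proof (rule integral_norm_bound_integral)
      show "(\<lambda>t. K / (1 + t)\<^sup>2) integrable_on {b..c}"
        using b by (intro integrable_continuous_interval continuous_intros) auto
    qed (use fi b bound in auto)
    also have "\<dots> = - (K / (1 + c)) - - (K / (1 + b))"
    proof (rule integral_unique, rule fundamental_theorem_of_calculus)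
      fix t assume "t \<in> {b..c}"
      then have "((\<lambda>t. - (K / (1 + t))) has_real_derivative K / (1 + t)\<^sup>2) (at t)"
        using b by (auto intro!: derivative_eq_intros simp: power2_eq_square)
      then show "((\<lambda>t. - (K / (1 + t))) has_vector_derivative K / (1 + t)\<^sup>2) (at t within {b..c})"
        using has_real_derivative_iff_has_vector_derivative has_vector_derivative_at_within by blast
    qed (use b in auto)
    also have "\<dots> \<le> K / (1 + b)" using K b by simp
    finally show ?thesis .
  qed
  have "Cauchy (\<lambda>n. I (real n))"
  proof (rule metric_CauchyI)
    fix e :: real assume e: "e > 0"
    obtain M :: nat where M: "K / e < real M" using reals_Archimedean2 by blast
    have *: "dist (I (real m)) (I (real n)) < e" if "M \<le> m" "m \<le> n" for m n
    proof -
      have "norm (I (real n) - I (real m)) \<le> K / (1 + real m)" by (rule diff) (use that in auto)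
      also have "\<dots> \<le> K / (1 + real M)" using that K by (intro divide_left_mono) auto
      also have "\<dots> < e" using M e by (simp add: field_simps)
      finally show ?thesis by (simp add: dist_norm norm_minus_commute)
    qed
    show "\<exists>M. \<forall>m\<ge>M. \<forall>n\<ge>M. dist (I (real m)) (I (real n)) < e"
      by (intro exI[of _ M] allI impI) (metis * dist_commute nle_le)
  qed
  then obtain y where y: "(\<lambda>n. I (real n)) \<longlonglongrightarrow> y" by (meson Cauchy_convergent convergent_def)
  have tail: "norm (I b - y) \<le> K / (1 + b)" if "b \<ge> 0" for b
  proof (rule LIMSEQ_le_const2)
    show "(\<lambda>n. norm (I b - I (real n))) \<longlonglongrightarrow> norm (I b - y)" by (intro tendsto_intros y)
    obtain M :: nat where M: "b < real M" using reals_Archimedean2 by blast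
    show "\<exists>N. \<forall>n\<ge>N. norm (I b - I (real n)) \<le> K / (1 + b)"
      using M diff[OF that] norm_minus_commute[of "I b"] by (intro exI[of _ M]) auto
  qed
  have "(f has_integral y) {0..}"
    unfolding has_integral_alt'
  proof (intro conjI allI impI)
    have Int: "{0..} \<inter> cbox a b = {max 0 a..b}" for a b :: real by auto
    show "(\<lambda>x. if x \<in> {0..} then f x else 0) integrable_on cbox a b" for a b
      unfolding integrable_restrict_Int Int using fi by simp
    fix e :: real assume e: "e > 0"
    define B where "B = K / e + 1"
    have B: "B > 0" using K e by (simp add: B_def add_nonneg_pos)
    show "\<exists>B>0. \<forall>a b. ball 0 B \<subseteq> cbox a b \<longrightarrow>
        norm (integral (cbox a b) (\<lambda>x. if x \<in> {0..} then f x else 0) - y) < e"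
    proof (intro exI[of _ B] conjI allI impI B)
      fix a b :: real assume ab: "ball 0 B \<subseteq> cbox a b"
      have "closure (ball 0 B) \<subseteq> cbox a b" by (rule closure_minimal[OF ab]) simp
      then have "cball 0 B \<subseteq> {a..b}" using B by simp
      then have ab: "a \<le> - B" "B \<le> b" using B by (auto simp: subset_iff dist_real_def)
      have "integral (cbox a b) (\<lambda>x. if x \<in> {0..} then f x else 0) = I b"
        unfolding integral_restrict_Int Int I_def using ab B by simp
      moreover have "norm (I b - y) \<le> K / (1 + b)" by (rule tail) (use ab B in simp)
      moreover have "K / (1 + b) \<le> K / (1 + B)" using ab B K by (intro divide_left_mono) auto
      moreover have "K / (1 + B) < e" using e K B by (simp add: B_def field_simps)
      ultimately show "norm (integral (cbox a b) (\<lambda>x. if x \<in> {0..} then f x else 0) - y) < e" by simp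
    qed
  qed
  then have eq: "integral {0..} f = y" and int: "f integrable_on {0..}"
    by (auto simp: integral_unique)
  show "f integrable_on {0..}" by (rule int)
  show "(\<lambda>n. integral {0..real n} f) \<longlonglongrightarrow> integral {0..} f" unfolding eq using y by (simp add: I_def)
  have "I 0 = 0" by (simp add: I_def)
  then show "norm (integral {0..} f) \<le> K" using tail[of 0] by (simp add: eq)
qed

abbreviation shifted :: "('a::complex_normed_vector \<Rightarrow>\<^sub>L 'a) \<Rightarrow> real \<Rightarrow> 'a \<Rightarrow>\<^sub>L 'a" where
  "shifted A t \<equiv> A + (\<i> * complex_of_real t) *\<^sub>C id_blinfun"

abbreviation resolvent :: "('a::complex_normed_vector \<Rightarrow>\<^sub>L 'a) \<Rightarrow> real \<Rightarrow> 'a \<Rightarrow>\<^sub>L 'a" where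
  "resolvent A t \<equiv> op_inverse (shifted A t)"

text \<open>The lower bound grows with \<open>t\<close> so that a single constant gives both the decay that makes the
  logarithm converge and stability under perturbations of \<open>A\<close>.\<close>
definition log_admissible :: "real \<Rightarrow> ('a::complex_normed_vector \<Rightarrow>\<^sub>L 'a) \<Rightarrow> bool" where
  "log_admissible c A \<longleftrightarrow> A \<in> bounded_ops \<and> c > 0 \<and>
     (\<forall>t\<ge>0. op_invertible (shifted A t) \<and> (\<forall>x. c * (1 + t) * norm x \<le> norm (shifted A t x)))"

lemma shifted_apply: "shifted A t x = A x + (\<i> * complex_of_real t) *\<^sub>C x"
  by (simp add: blinfun.add_left)

lemma shifted_bounded_ops: "A \<in> bounded_ops \<Longrightarrow> shifted A t \<in> bounded_ops"
  by (intro bounded_ops_intros)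

text \<open>A bound uniform in \<open>t\<close> suffices, because \<open>t - \<parallel>A\<parallel>\<close> takes over for large \<open>t\<close>.\<close>
lemma log_admissibleI:
  fixes A :: "'a::complex_normed_vector \<Rightarrow>\<^sub>L 'a"
  assumes A: "A \<in> bounded_ops" and c: "c > 0"
    and inv: "\<And>t. t \<ge> 0 \<Longrightarrow> op_invertible (shifted A t)"
    and low: "\<And>t x. t \<ge> 0 \<Longrightarrow> c * norm x \<le> norm (shifted A t x)"
  shows "\<exists>c'. log_admissible c' A"
proof (intro exI)
  define d where "d = 1 + c + norm A"
  have d: "d > 0" using c by (simp add: d_def add_pos_nonneg)
  show "log_admissible (c / d) A"
    unfolding log_admissible_def
  proof (intro conjI allI impI A inv)
    fix t :: real and x :: 'a assume t: "t \<ge> 0"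
    show "c / d * (1 + t) * norm x \<le> norm (shifted A t x)"
    proof (cases "t \<le> c + norm A")
      case True
      then have "c / d * (1 + t) \<le> c / d * d" using c d by (intro mult_left_mono) (auto simp: d_def)
      then have "c / d * (1 + t) \<le> c" using d by simp
      then show ?thesis using low[OF t, of x] mult_right_mono[OF _ norm_ge_zero] order_trans by blast
    next
      case False
      have "c / d * (1 + t) = c / d * (t - (c + norm A)) + c / d * d"
        unfolding distrib_left[symmetric] by (simp add: d_def)
      also have "\<dots> \<le> 1 * (t - (c + norm A)) + c"
        using c d False by (intro add_mono mult_right_mono) (auto simp: d_def)
      finally have "c / d * (1 + t) \<le> t - norm A" by simp
      then have "c / d * (1 + t) * norm x \<le> (t - norm A) * norm x" by (intro mult_right_mono) auto
      also have "\<dots> \<le> norm ((\<i> * complex_of_real t) *\<^sub>C x) - norm (A x)"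
        using t norm_blinfun[of A x] by (simp add: norm_scaleC norm_mult algebra_simps)
      also have "\<dots> \<le> norm (shifted A t x)"
        unfolding shifted_apply using norm_diff_ineq[of "(\<i> * complex_of_real t) *\<^sub>C x" "A x"] by (simp add: add.commute)
      finally show ?thesis .
    qed
  qed (use c d in auto)
qed

lemma log_admissibleD:
  assumes "log_admissible c A"
  shows "A \<in> bounded_ops" "c > 0" "\<And>t. t \<ge> 0 \<Longrightarrow> op_invertible (shifted A t)"
    "\<And>t. t \<ge> 0 \<Longrightarrow> norm (resolvent A t) \<le> 1 / (c * (1 + t))"
    "\<And>t. t \<ge> 0 \<Longrightarrow> resolvent A t \<in> bounded_ops"
proof -
  show 1: "A \<in> bounded_ops" "c > 0" "\<And>t. t \<ge> 0 \<Longrightarrow> op_invertible (shifted A t)"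
    using assms by (auto simp: log_admissible_def)
  show "norm (resolvent A t) \<le> 1 / (c * (1 + t))" if "t \<ge> 0" for t
    using assms that by (intro norm_op_inverse_le) (auto simp: log_admissible_def)
  show "resolvent A t \<in> bounded_ops" if "t \<ge> 0" for t
    by (rule op_inverse_bounded_ops[OF shifted_bounded_ops[OF 1(1)] 1(3)[OF that]])
qed

lemma op_inverse_difference:
  assumes "op_invertible A" "op_invertible B"
  shows "op_inverse A - op_inverse B = op_inverse A o\<^sub>L (B - A) o\<^sub>L op_inverse B"
  using assms by (intro blinfun_eqI) (simp add: blinfun.diff_left blinfun.diff_right)

lemma shifted_diff: "shifted A s - shifted A t = (\<i> * complex_of_real (s - t)) *\<^sub>C id_blinfun"
  by (simp add: scaleC.diff_left[symmetric] right_diff_distrib)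

lemma norm_blinfun_compose3: "norm (A o\<^sub>L B o\<^sub>L D) \<le> norm A * norm B * norm D"
  by (rule order_trans[OF norm_blinfun_compose]) (intro mult_right_mono norm_blinfun_compose norm_ge_zero)

lemma resolvent_difference:
  assumes A: "log_admissible c A" and st: "s \<ge> 0" "t \<ge> 0"
  shows "norm (resolvent A s - resolvent A t) \<le> \<bar>s - t\<bar> / c\<^sup>2"
proof -
  note D = log_admissibleD[OF A]
  have c: "norm (resolvent A s) \<le> 1 / c" if "s \<ge> 0" for s
  proof -
    have "norm (resolvent A s) \<le> 1 / (c * (1 + s))" by (rule D(4)[OF that])
    also have "\<dots> \<le> 1 / c" using D(2) that by (intro divide_left_mono) auto
    finally show ?thesis .
  qed
  have "norm (resolvent A s - resolvent A t)
      \<le> norm (resolvent A s) * norm (shifted A t - shifted A s) * norm (resolvent A t)"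
    unfolding op_inverse_difference[OF D(3)[OF st(1)] D(3)[OF st(2)]] by (rule norm_blinfun_compose3)
  also have "norm (shifted A t - shifted A s) \<le> \<bar>s - t\<bar>"
  proof -
    have "norm (shifted A t - shifted A s) = \<bar>s - t\<bar> * norm (id_blinfun :: 'a \<Rightarrow>\<^sub>L 'a)"
      unfolding shifted_diff norm_scaleC norm_mult norm_ii norm_of_real by (simp add: abs_minus_commute)
    also have "\<dots> \<le> \<bar>s - t\<bar> * 1" by (intro mult_left_mono norm_blinfun_id_le) simp
    finally show ?thesis by simp
  qed
  also have "norm (resolvent A s) * \<bar>s - t\<bar> * norm (resolvent A t) \<le> (1 / c) * \<bar>s - t\<bar> * (1 / c)"
    using D(2) by (intro mult_mono c st mult_nonneg_nonneg) auto
  finally show ?thesis by (simp add: power2_eq_square mult_left_mono mult_right_mono)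
qed

lemma continuous_on_resolvent:
  assumes A: "log_admissible c A"
  shows "continuous_on {0..} (resolvent A)"
  unfolding continuous_on_iff
proof (intro ballI allI impI)
  fix t :: real and e :: real assume t: "t \<in> {0..}" and e: "e > 0"
  have c: "c > 0" by (rule log_admissibleD(2)[OF A])
  show "\<exists>d>0. \<forall>s\<in>{0..}. dist s t < d \<longrightarrow> dist (resolvent A s) (resolvent A t) < e"
  proof (intro exI[of _ "e * c\<^sup>2"] conjI ballI impI)
    fix s :: real assume s: "s \<in> {0..}" "dist s t < e * c\<^sup>2"
    have "dist (resolvent A s) (resolvent A t) \<le> \<bar>s - t\<bar> / c\<^sup>2"
      unfolding dist_norm by (rule resolvent_difference[OF A]) (use s t in auto)
    also have "\<dots> < e" using s c by (simp add: dist_real_def field_simps)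
    finally show "dist (resolvent A s) (resolvent A t) < e" .
  qed (use e c in simp)
qed

lemma resolvent_derivative:
  assumes A: "log_admissible c A" and t: "t \<ge> 0"
  shows "(resolvent A has_vector_derivative (- \<i>) *\<^sub>C (resolvent A t o\<^sub>L resolvent A t)) (at t within {0..})"
proof -
  note D = log_admissibleD[OF A]
  have quot: "(1 / (s - t)) *\<^sub>R (resolvent A s - resolvent A t) = (- \<i>) *\<^sub>C (resolvent A s o\<^sub>L resolvent A t)"
    if "s \<ge> 0" "s \<noteq> t" for s
  proof (rule blinfun_eqI)
    fix x
    have "(resolvent A s - resolvent A t) x = (\<i> * complex_of_real (t - s)) *\<^sub>C resolvent A s (resolvent A t x)"
      unfolding op_inverse_difference[OF D(3)[OF that(1)] D(3)[OF t]] shifted_diff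
      by (simp add: bounded_opsD[OF D(5)[OF that(1)]])
    then have "((1 / (s - t)) *\<^sub>R (resolvent A s - resolvent A t)) x
        = (complex_of_real (1 / (s - t)) * (\<i> * complex_of_real (t - s))) *\<^sub>C resolvent A s (resolvent A t x)"
      by (simp only: blinfun.scaleR_left) (simp only: scaleR_scaleC scaleC_scaleC)
    also have "complex_of_real (1 / (s - t)) * (\<i> * complex_of_real (t - s)) = - \<i>"
    proof -
      have "(t - s) / (s - t) = -1" using that(2) by (simp add: divide_eq_eq)
      moreover have "complex_of_real (1 / (s - t)) * (\<i> * complex_of_real (t - s)) = \<i> * complex_of_real ((t - s) / (s - t))"
        by simp
      ultimately show ?thesis by simp
    qed
    finally show "((1 / (s - t)) *\<^sub>R (resolvent A s - resolvent A t)) x = ((- \<i>) *\<^sub>C (resolvent A s o\<^sub>L resolvent A t)) x"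
      by simp
  qed
  have "((\<lambda>s. (- \<i>) *\<^sub>C (resolvent A s o\<^sub>L resolvent A t)) \<longlongrightarrow> (- \<i>) *\<^sub>C (resolvent A t o\<^sub>L resolvent A t)) (at t within {0..})"
    using continuous_on_resolvent[OF A] t
    by (intro scaleC.tendsto bounded_bilinear.tendsto[OF bounded_bilinear_blinfun_compose] tendsto_const)
      (auto simp: continuous_on_def)
  note lim = tendstoD[OF this]
  show ?thesis
    unfolding has_vector_derivative_def has_derivative_within_alt2
  proof (intro conjI allI impI bounded_linear_scaleR_left)
    fix e :: real assume "e > 0"
    from lim[OF this] have "\<forall>\<^sub>F s in at t within {0..}. s \<in> {0..} - {t} \<and>
        dist ((- \<i>) *\<^sub>C (resolvent A s o\<^sub>L resolvent A t)) ((- \<i>) *\<^sub>C (resolvent A t o\<^sub>L resolvent A t)) < e"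
      by (auto simp: eventually_at_filter elim: eventually_mono)
    then show "\<forall>\<^sub>F s in at t within {0..}. norm (resolvent A s - resolvent A t
        - (s - t) *\<^sub>R ((- \<i>) *\<^sub>C (resolvent A t o\<^sub>L resolvent A t))) \<le> e * norm (s - t)"
    proof eventually_elim
      case (elim s)
      then have "resolvent A s - resolvent A t = (s - t) *\<^sub>R ((- \<i>) *\<^sub>C (resolvent A s o\<^sub>L resolvent A t))"
        using quot[of s, symmetric] by simp
      then have "norm (resolvent A s - resolvent A t - (s - t) *\<^sub>R ((- \<i>) *\<^sub>C (resolvent A t o\<^sub>L resolvent A t)))
          = \<bar>s - t\<bar> * dist ((- \<i>) *\<^sub>C (resolvent A s o\<^sub>L resolvent A t)) ((- \<i>) *\<^sub>C (resolvent A t o\<^sub>L resolvent A t))"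
        by (simp only: scaleR_diff_right[symmetric] norm_scaleR dist_norm)
      also have "\<dots> \<le> \<bar>s - t\<bar> * e" using elim by (intro mult_left_mono) auto
      finally show ?case by (simp add: mult.commute)
    qed
  qed
qed

lemma one_plus_neq_0: "1 + \<i> * complex_of_real t \<noteq> 0"
  by (simp add: complex_eq_iff)

lemma norm_inverse_one_plus: "t \<ge> 0 \<Longrightarrow> cmod (inverse (1 + \<i> * complex_of_real t)) \<le> 2 / (1 + t)"
proof -
  assume t: "t \<ge> 0"
  have "1 + t \<le> 2 * cmod (1 + \<i> * complex_of_real t)"
    using abs_Re_le_cmod[of "1 + \<i> * complex_of_real t"] abs_Im_le_cmod[of "1 + \<i> * complex_of_real t"] t by simp
  then show ?thesis using t one_plus_neq_0[of t] unfolding norm_inverse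
    by (simp add: divide_simps add_nonneg_eq_0_iff)
qed

abbreviation log_integrand :: "('a::complex_normed_vector \<Rightarrow>\<^sub>L 'a) \<Rightarrow> real \<Rightarrow> 'a \<Rightarrow>\<^sub>L 'a" where
  "log_integrand A t \<equiv> resolvent A t - inverse (1 + \<i> * complex_of_real t) *\<^sub>C id_blinfun"

lemma log_integrand_continuous:
  assumes A: "log_admissible c A" shows "continuous_on {0..} (log_integrand A)"
  using one_plus_neq_0
  by (intro continuous_on_diff continuous_on_resolvent[OF A] scaleC.continuous_on continuous_intros) auto

lemma log_integrand_bound:
  assumes A: "log_admissible c A" and t: "t \<ge> 0"
  shows "norm (log_integrand A t) \<le> (2 * norm (id_blinfun - A) / c) / (1 + t)\<^sup>2"
proof -
  note D = log_admissibleD[OF A]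
  have "log_integrand A t = inverse (1 + \<i> * complex_of_real t) *\<^sub>C (resolvent A t o\<^sub>L (id_blinfun - A))"
  proof (rule blinfun_eqI)
    fix x
    have "x - A x = (1 + \<i> * complex_of_real t) *\<^sub>C x - shifted A t x"
      unfolding shifted_apply by (simp add: scaleC.add_left)
    then have "resolvent A t (x - A x) = (1 + \<i> * complex_of_real t) *\<^sub>C resolvent A t x - x"
      using D(3)[OF t] by (simp add: blinfun.diff_right bounded_opsD[OF D(5)[OF t]])
    then show "log_integrand A t x = (inverse (1 + \<i> * complex_of_real t) *\<^sub>C (resolvent A t o\<^sub>L (id_blinfun - A))) x"
      using one_plus_neq_0[of t] by (simp add: blinfun.diff_left scaleC.diff_right scaleC_scaleC)
  qed
  then have "norm (log_integrand A t)
      \<le> cmod (inverse (1 + \<i> * complex_of_real t)) * (norm (resolvent A t) * norm (id_blinfun - A))"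
    by (simp only: norm_scaleC) (intro mult_left_mono norm_blinfun_compose norm_ge_zero)
  also have "\<dots> \<le> (2 / (1 + t)) * (1 / (c * (1 + t)) * norm (id_blinfun - A))"
    using t D(2) by (intro mult_mono norm_inverse_one_plus D(4) mult_nonneg_nonneg) auto
  also have "\<dots> = (2 * norm (id_blinfun - A) / c) / (1 + t)\<^sup>2" by (simp add: power2_eq_square mult_ac)
  finally show ?thesis .
qed

lemma log_integrand_integrable:
  fixes A :: "'a::chilbert_space \<Rightarrow>\<^sub>L 'a"
  assumes A: "log_admissible c A" shows "log_integrand A integrable_on {0..}"
  by (rule improper_integral_quadratic_decay(1)[OF log_integrand_continuous[OF A] log_integrand_bound[OF A]])

lemma integral_bounded_ops:
  fixes f :: "real \<Rightarrow> 'a::chilbert_space \<Rightarrow>\<^sub>L 'a"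
  assumes f: "f integrable_on S" "\<And>t. t \<in> S \<Longrightarrow> f t \<in> bounded_ops"
  shows "integral S f \<in> bounded_ops"
proof (rule bounded_opsI)
  fix c :: complex and x :: 'a
  have bl: "bounded_linear (\<lambda>T :: 'a \<Rightarrow>\<^sub>L 'a. T (c *\<^sub>C x) - c *\<^sub>C T x)"
    by (intro bounded_linear_sub blinfun.bounded_linear_left bounded_linear_compose[OF bounded_linear_scaleC])
  have "integral S f (c *\<^sub>C x) - c *\<^sub>C integral S f x = integral S ((\<lambda>T :: 'a \<Rightarrow>\<^sub>L 'a. T (c *\<^sub>C x) - c *\<^sub>C T x) \<circ> f)"
    by (rule integral_linear[OF f(1) bl, symmetric])
  also have "\<dots> = integral S (\<lambda>t. 0)"
    by (rule Henstock_Kurzweil_Integration.integral_cong) (simp add: bounded_opsD[OF f(2)])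
  finally show "integral S f (c *\<^sub>C x) = c *\<^sub>C integral S f x" by simp
qed

lemma op_log_bounded_ops:
  fixes A :: "'a::chilbert_space \<Rightarrow>\<^sub>L 'a"
  assumes A: "log_admissible c A" shows "op_log A \<in> bounded_ops"
  unfolding op_log_def
  by (intro bounded_ops_scaleC integral_bounded_ops log_integrand_integrable[OF A] bounded_ops_diff bounded_ops_id)
    (use log_admissibleD(5)[OF A] in auto)

text \<open>The derivative of the logarithm at \<open>A\<close> in the direction \<open>H\<close>, which is the differentiated integrand
  of the logarithm.\<close>
definition op_log_deriv :: "('a::chilbert_space \<Rightarrow>\<^sub>L 'a) \<Rightarrow> ('a \<Rightarrow>\<^sub>L 'a) \<Rightarrow> 'a \<Rightarrow>\<^sub>L 'a" where
  "op_log_deriv A H = \<i> *\<^sub>C integral {0..} (\<lambda>t. resolvent A t o\<^sub>L H o\<^sub>L resolvent A t)"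

lemma sandwich_continuous:
  fixes A :: "'a::chilbert_space \<Rightarrow>\<^sub>L 'a"
  assumes A: "log_admissible c A"
  shows "continuous_on {0..} (\<lambda>t. resolvent A t o\<^sub>L H o\<^sub>L resolvent A t)"
  by (intro bounded_bilinear.continuous_on[OF bounded_bilinear_blinfun_compose] continuous_on_resolvent[OF A] continuous_on_const)

lemma sandwich_bound:
  fixes A :: "'a::chilbert_space \<Rightarrow>\<^sub>L 'a"
  assumes A: "log_admissible c A" and t: "t \<ge> 0"
  shows "norm (resolvent A t o\<^sub>L H o\<^sub>L resolvent A t) \<le> (norm H / c\<^sup>2) / (1 + t)\<^sup>2"
proof -
  note D = log_admissibleD[OF A]
  have "norm (resolvent A t o\<^sub>L H o\<^sub>L resolvent A t) \<le> norm (resolvent A t) * norm H * norm (resolvent A t)"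
    by (rule norm_blinfun_compose3)
  also have "\<dots> \<le> (1 / (c * (1 + t))) * norm H * (1 / (c * (1 + t)))"
    using D(2) t by (intro mult_mono D(4) mult_nonneg_nonneg) auto
  finally show ?thesis by (simp add: power2_eq_square mult_ac)
qed

lemmas sandwich_integral = improper_integral_quadratic_decay[OF sandwich_continuous sandwich_bound]

lemma bounded_linear_op_log_deriv:
  assumes A: "log_admissible c A" shows "bounded_linear (op_log_deriv A)"
proof (rule bounded_linear_intro)
  note i = sandwich_integral(1)[OF A A]
  fix H K :: "'a \<Rightarrow>\<^sub>L 'a" and r :: real
  have "(\<lambda>t. resolvent A t o\<^sub>L (H + K) o\<^sub>L resolvent A t)
      = (\<lambda>t. (resolvent A t o\<^sub>L H o\<^sub>L resolvent A t) + (resolvent A t o\<^sub>L K o\<^sub>L resolvent A t))"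
    by (rule ext, rule blinfun_eqI) (simp add: blinfun.add_left blinfun.add_right)
  then show "op_log_deriv A (H + K) = op_log_deriv A H + op_log_deriv A K"
    unfolding op_log_deriv_def
    by (simp only: Henstock_Kurzweil_Integration.integral_add[OF i i] scaleC.add_right)
  have "(\<lambda>t. resolvent A t o\<^sub>L (r *\<^sub>R H) o\<^sub>L resolvent A t) = (\<lambda>t. r *\<^sub>R (resolvent A t o\<^sub>L H o\<^sub>L resolvent A t))"
    by (rule ext, rule blinfun_eqI) (simp add: blinfun.scaleR_left blinfun.scaleR_right)
  then show "op_log_deriv A (r *\<^sub>R H) = r *\<^sub>R op_log_deriv A H"
    unfolding op_log_deriv_def by (simp add: scaleC.scaleR_right)
  show "norm (op_log_deriv A H) \<le> norm H * (1 / c\<^sup>2)"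
    unfolding op_log_deriv_def norm_scaleC using sandwich_integral(2)[OF A A, of H] by simp
qed

lemma op_log_deriv_scaleC:
  assumes A: "log_admissible c A" shows "op_log_deriv A (z *\<^sub>C H) = z *\<^sub>C op_log_deriv A H"
proof -
  have "integral {0..} (\<lambda>t. resolvent A t o\<^sub>L (z *\<^sub>C H) o\<^sub>L resolvent A t)
      = integral {0..} ((\<lambda>T. z *\<^sub>C T) \<circ> (\<lambda>t. resolvent A t o\<^sub>L H o\<^sub>L resolvent A t))"
  proof (rule Henstock_Kurzweil_Integration.integral_cong)
    fix t :: real assume "t \<in> {0..}"
    then have "resolvent A t \<in> bounded_ops" using log_admissibleD(5)[OF A] by simp
    then show "resolvent A t o\<^sub>L (z *\<^sub>C H) o\<^sub>L resolvent A t = ((\<lambda>T. z *\<^sub>C T) \<circ> (\<lambda>t. resolvent A t o\<^sub>L H o\<^sub>L resolvent A t)) t"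
      by (intro blinfun_eqI) (simp add: bounded_opsD)
  qed
  also have "\<dots> = z *\<^sub>C integral {0..} (\<lambda>t. resolvent A t o\<^sub>L H o\<^sub>L resolvent A t)"
    by (rule integral_linear[OF sandwich_integral(1)[OF A A] bounded_linear_scaleC])
  finally show ?thesis by (simp add: op_log_deriv_def scaleC_scaleC mult.commute)
qed

lemma log_admissible_perturb:
  fixes A :: "'a::chilbert_space \<Rightarrow>\<^sub>L 'a"
  assumes A: "log_admissible c A" and H: "H \<in> bounded_ops" "norm H \<le> c / 2"
  shows "log_admissible (c / 2) (A + H)"
  unfolding log_admissible_def
proof (intro conjI allI impI)
  note D = log_admissibleD[OF A]
  show "A + H \<in> bounded_ops" by (intro bounded_ops_intros D H)
  show "c / 2 > 0" using D(2) by simp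
  fix t :: real and x assume t: "t \<ge> 0"
  have sh: "shifted (A + H) t = shifted A t + H" by simp
  show "op_invertible (shifted (A + H) t)"
    unfolding sh
  proof (rule op_invertible_perturb[OF D(3)[OF t], of "1 / c"])
    fix x
    have "norm (resolvent A t x) \<le> norm (resolvent A t) * norm x" by (rule norm_blinfun)
    also have "\<dots> \<le> (1 / (c * (1 + t))) * norm x" by (intro mult_right_mono D(4) t) simp
    also have "\<dots> \<le> (1 / c) * norm x" using D(2) t by (intro mult_right_mono divide_left_mono) auto
    finally show "norm (resolvent A t x) \<le> 1 / c * norm x" .
  qed (use H D(2) in \<open>auto simp: field_simps\<close>)
  have "c * (1 + t) * norm x \<le> norm (shifted A t x)" using A t by (simp add: log_admissible_def)
  moreover have "norm (H x) \<le> c / 2 * (1 + t) * norm x"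
  proof -
    have "norm (H x) \<le> norm H * norm x" by (rule norm_blinfun)
    also have "\<dots> \<le> c / 2 * norm x" by (intro mult_right_mono H) simp
    also have "\<dots> \<le> c / 2 * (1 + t) * norm x" using t D(2) by (intro mult_right_mono) auto
    finally show ?thesis .
  qed
  moreover have "norm (shifted A t x) - norm (H x) \<le> norm (shifted (A + H) t x)"
    unfolding sh blinfun.add_left[of "shifted A t" H] by (rule norm_diff_ineq)
  moreover have "c * (1 + t) * norm x = c / 2 * (1 + t) * norm x + c / 2 * (1 + t) * norm x" by simp
  ultimately show "c / 2 * (1 + t) * norm x \<le> norm (shifted (A + H) t x)" by linarith
qed

text \<open>The second order remainder of the resolvent is a product of three resolvents and two factors \<open>H\<close>;
  two of the resolvents supply the decay in \<open>t\<close>.\<close>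

lemma op_log_expansion:
  fixes A :: "'a::chilbert_space \<Rightarrow>\<^sub>L 'a"
  assumes A: "log_admissible c A" and H: "H \<in> bounded_ops" "norm H \<le> c / 2"
  shows "norm (op_log (A + H) - op_log A - op_log_deriv A H) \<le> 2 / c ^ 3 * (norm H)\<^sup>2"
proof -
  note AH = log_admissible_perturb[OF A H]
  note D = log_admissibleD[OF A] and E = log_admissibleD[OF AH]
  let ?R = "\<lambda>t. resolvent A t" and ?S = "\<lambda>t. resolvent (A + H) t"
  have dif: "shifted A t - shifted (A + H) t = - H" for t by simp
  have rem: "log_integrand (A + H) t - log_integrand A t + (?R t o\<^sub>L H o\<^sub>L ?R t)
      = (?S t o\<^sub>L H o\<^sub>L ?R t) o\<^sub>L H o\<^sub>L ?R t" if t: "t \<ge> 0" for t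
  proof -
    have 1: "?S t x = ?R t x - ?S t (H (?R t x))" for x
      using arg_cong[OF op_inverse_difference[OF E(3)[OF t] D(3)[OF t]], of "\<lambda>T. T x", unfolded dif]
      by (simp add: blinfun.diff_left blinfun.minus_left blinfun.minus_right algebra_simps)
    show ?thesis
    proof (rule blinfun_eqI)
      fix x
      have "(log_integrand (A + H) t - log_integrand A t + (?R t o\<^sub>L H o\<^sub>L ?R t)) x
          = ?S t x - ?R t x + ?R t (H (?R t x))"
        by (simp add: blinfun.diff_left blinfun.add_left)
      also have "\<dots> = ?R t (H (?R t x)) - ?S t (H (?R t x))" using 1[of x] by simp
      also have "\<dots> = ?S t (H (?R t (H (?R t x))))" using 1[of "H (?R t x)"] by simp
      finally show "(log_integrand (A + H) t - log_integrand A t + (?R t o\<^sub>L H o\<^sub>L ?R t)) x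
          = ((?S t o\<^sub>L H o\<^sub>L ?R t) o\<^sub>L H o\<^sub>L ?R t) x" by simp
    qed
  qed
  let ?f = "\<lambda>t. (?S t o\<^sub>L H o\<^sub>L ?R t) o\<^sub>L H o\<^sub>L ?R t"
  have cont: "continuous_on {0..} ?f"
    by (intro bounded_bilinear.continuous_on[OF bounded_bilinear_blinfun_compose] continuous_on_resolvent[OF A]
        continuous_on_resolvent[OF AH] continuous_on_const)
  have bound: "norm (?f t) \<le> (2 / c ^ 3 * (norm H)\<^sup>2) / (1 + t)\<^sup>2" if t: "t \<ge> 0" for t
  proof -
    have c: "c > 0" by (rule D(2))
    have R1: "norm (?R t) \<le> 1 / c"
    proof (rule order_trans[OF D(4)[OF t]])
      show "1 / (c * (1 + t)) \<le> 1 / c" using c t by (intro divide_left_mono) auto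
    qed
    have "norm (?f t) \<le> (norm (?S t) * norm H * norm (?R t)) * norm H * norm (?R t)"
      by (rule order_trans[OF norm_blinfun_compose3]) (intro mult_right_mono norm_blinfun_compose3 norm_ge_zero)
    also have "\<dots> \<le> ((1 / (c / 2 * (1 + t))) * norm H * (1 / c)) * norm H * (1 / (c * (1 + t)))"
      using c t by (intro mult_mono E(4) D(4) R1 mult_nonneg_nonneg) auto
    also have "\<dots> = (2 / c ^ 3 * (norm H)\<^sup>2) / (1 + t)\<^sup>2"
      by (simp add: power2_eq_square power3_eq_cube mult_ac)
    finally show ?thesis .
  qed
  have "op_log (A + H) - op_log A - op_log_deriv A H
      = (- \<i>) *\<^sub>C (integral {0..} (log_integrand (A + H)) - integral {0..} (log_integrand A)
          + integral {0..} (\<lambda>t. ?R t o\<^sub>L H o\<^sub>L ?R t))"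
    unfolding op_log_def op_log_deriv_def by (simp add: scaleC.diff_right scaleC.add_right scaleC.minus_left)
  also have "integral {0..} (log_integrand (A + H)) - integral {0..} (log_integrand A)
          + integral {0..} (\<lambda>t. ?R t o\<^sub>L H o\<^sub>L ?R t)
      = integral {0..} (\<lambda>t. log_integrand (A + H) t - log_integrand A t + (?R t o\<^sub>L H o\<^sub>L ?R t))"
    by (subst Henstock_Kurzweil_Integration.integral_add;
        (subst Henstock_Kurzweil_Integration.integral_diff)?;
        intro log_integrand_integrable[OF A] log_integrand_integrable[OF AH] sandwich_integral(1)[OF A A]
          integrable_diff refl)
  also have "\<dots> = integral {0..} ?f"
    by (rule Henstock_Kurzweil_Integration.integral_cong) (use rem in simp)
  finally show ?thesis
    using improper_integral_quadratic_decay(2)[OF cont bound] by (simp add: norm_scaleC)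
qed

text \<open>Only perturbations by complex-linear operators keep \<open>A\<close> admissible, hence the restricted filter.\<close>
lemma op_log_has_derivative:
  fixes A :: "'a::chilbert_space \<Rightarrow>\<^sub>L 'a"
  assumes A: "log_admissible c A"
  shows "(op_log has_derivative op_log_deriv A) (at A within bounded_ops)"
  unfolding has_derivative_within_alt
proof (intro conjI allI impI bounded_linear_op_log_deriv[OF A])
  fix e :: real assume e: "e > 0"
  note D = log_admissibleD[OF A]
  define d where "d = min (c / 2) (e * c ^ 3 / 2)"
  have d: "d > 0" using D(2) e by (simp add: d_def)
  show "\<exists>d>0. \<forall>B\<in>bounded_ops. norm (B - A) < d \<longrightarrow> norm (op_log B - op_log A - op_log_deriv A (B - A)) \<le> e * norm (B - A)"
  proof (intro exI[of _ d] conjI ballI impI d)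
    fix B :: "'a \<Rightarrow>\<^sub>L 'a" assume B: "B \<in> bounded_ops" "norm (B - A) < d"
    have "norm (op_log (A + (B - A)) - op_log A - op_log_deriv A (B - A)) \<le> 2 / c ^ 3 * (norm (B - A))\<^sup>2"
      by (rule op_log_expansion[OF A]) (use B D(1) in \<open>auto intro: bounded_ops_diff simp: d_def\<close>)
    also have "\<dots> = (2 / c ^ 3 * norm (B - A)) * norm (B - A)" by (simp add: power2_eq_square)
    also have "\<dots> \<le> e * norm (B - A)"
    proof (rule mult_right_mono)
      have "2 / c ^ 3 * norm (B - A) \<le> 2 / c ^ 3 * (e * c ^ 3 / 2)"
        using B D(2) by (intro mult_left_mono) (auto simp: d_def)
      then show "2 / c ^ 3 * norm (B - A) \<le> e" using D(2) by simp
    qed simp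
    finally show "norm (op_log B - op_log A - op_log_deriv A (B - A)) \<le> e * norm (B - A)" by simp
  qed
qed

lemma vholomorphic_op_log:
  fixes M :: "complex \<Rightarrow> 'a::chilbert_space \<Rightarrow>\<^sub>L 'a"
  assumes M: "M vholomorphic_on S" and adm: "\<And>z. z \<in> S \<Longrightarrow> \<exists>c. log_admissible c (M z)"
  shows "(\<lambda>z. op_log (M z)) vholomorphic_on S"
  unfolding vholomorphic_on_def
proof
  fix z assume z: "z \<in> S"
  obtain D where D: "(M has_derivative (\<lambda>h. h *\<^sub>C D)) (at z within S)"
    using M z by (auto simp: vholomorphic_on_def)
  obtain c where c: "log_admissible c (M z)" using adm z by blast
  have "M ` S \<subseteq> bounded_ops" using adm log_admissibleD(1) by blast
  then have "((\<lambda>z. op_log (M z)) has_derivative (\<lambda>h. op_log_deriv (M z) (h *\<^sub>C D))) (at z within S)"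
    by (intro has_derivative_in_compose[OF D] has_derivative_subset[OF op_log_has_derivative[OF c]])
  then show "\<exists>D. ((\<lambda>z. op_log (M z)) has_derivative (\<lambda>h. h *\<^sub>C D)) (at z within S)"
    by (auto simp: op_log_deriv_scaleC[OF c])
qed

text \<open>If \<open>H\<close> commutes with \<open>A\<close>, the integrand of the derivative is itself a derivative in \<open>t\<close>.\<close>

lemma op_log_deriv_commuting:
  fixes A H :: "'a::chilbert_space \<Rightarrow>\<^sub>L 'a"
  assumes A: "log_admissible c A" and H: "H \<in> bounded_ops" "commutes A H"
  shows "op_log_deriv A H = H o\<^sub>L op_inverse A"
proof -
  note D = log_admissibleD[OF A]
  define f where "f t = (- \<i>) *\<^sub>C (resolvent A t o\<^sub>L resolvent A t)" for t
  have sq: "resolvent A t o\<^sub>L id_blinfun o\<^sub>L resolvent A t = resolvent A t o\<^sub>L resolvent A t" for t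
    by (rule blinfun_eqI) simp
  have cont: "continuous_on {0..} f"
    unfolding f_def using sandwich_continuous[OF A, of id_blinfun]
    by (intro scaleC.continuous_on continuous_on_const) (simp only: sq)
  have bound: "norm (f t) \<le> (norm (id_blinfun :: 'a \<Rightarrow>\<^sub>L 'a) / c\<^sup>2) / (1 + t)\<^sup>2" if "t \<ge> 0" for t
    using sandwich_bound[OF A that, of id_blinfun] unfolding f_def norm_scaleC sq by simp
  note f = improper_integral_quadratic_decay[OF cont bound]
  have ftc: "integral {0..real n} f = resolvent A (real n) - resolvent A 0" for n
    by (rule integral_unique, rule fundamental_theorem_of_calculus)
      (auto simp: f_def intro!: has_vector_derivative_within_subset[OF resolvent_derivative[OF A]])
  have "(\<lambda>n. resolvent A (real n)) \<longlonglongrightarrow> 0"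
  proof (rule Lim_null_comparison)
    show "\<forall>\<^sub>F n in sequentially. norm (resolvent A (real n)) \<le> (1 / c) * (1 / real (Suc n))"
      using D(4)[of "real _"] by (simp add: add.commute)
    show "(\<lambda>n. (1 / c) * (1 / real (Suc n))) \<longlonglongrightarrow> 0"
      by (rule tendsto_mult_right_zero) (rule LIMSEQ_Suc[OF lim_1_over_n])
  qed
  then have "(\<lambda>n. integral {0..real n} f) \<longlonglongrightarrow> 0 - resolvent A 0"
    unfolding ftc by (intro tendsto_intros)
  then have int: "integral {0..} f = - resolvent A 0"
    using f(3) LIMSEQ_unique by fastforce
  have com: "resolvent A t (H x) = H (resolvent A t x)" if "t \<ge> 0" for t x
  proof -
    have "shifted A t (H y) = H (shifted A t y)" for y
      unfolding shifted_apply by (simp add: blinfun.add_right commutesD[OF H(2)] bounded_opsD[OF H(1)])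
    then show ?thesis using D(3)[OF that] by (metis op_inverse_apply)
  qed
  have bl: "bounded_linear (\<lambda>T. H o\<^sub>L (\<i> *\<^sub>C T))"
    by (intro bounded_linear_compose[OF bounded_bilinear.bounded_linear_right[OF bounded_bilinear_blinfun_compose]]
        bounded_linear_scaleC)
  have "integral {0..} (\<lambda>t. resolvent A t o\<^sub>L H o\<^sub>L resolvent A t) = integral {0..} ((\<lambda>T. H o\<^sub>L (\<i> *\<^sub>C T)) \<circ> f)"
    by (rule Henstock_Kurzweil_Integration.integral_cong)
      (auto intro!: blinfun_eqI simp: f_def com scaleC_scaleC)
  also have "\<dots> = H o\<^sub>L (\<i> *\<^sub>C (- resolvent A 0))"
    unfolding int[symmetric] by (rule integral_linear[OF f(1) bl])
  finally have "op_log_deriv A H = \<i> *\<^sub>C (H o\<^sub>L (\<i> *\<^sub>C (- resolvent A 0)))" by (simp only: op_log_deriv_def)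
  also have "\<dots> = H o\<^sub>L resolvent A 0"
    by (rule blinfun_eqI)
      (simp add: bounded_opsD[OF H(1)] scaleC_scaleC blinfun.minus_left blinfun.minus_right scaleC.minus_left scaleC.minus_right)
  finally show ?thesis by simp
qed

lemma accretive_log_admissible:
  fixes A :: "'a::chilbert_space \<Rightarrow>\<^sub>L 'a"
  assumes A: "A \<in> bounded_ops" and \<delta>: "\<delta> > 0" and acc: "\<And>x. \<delta> * (norm x)\<^sup>2 \<le> Re (cinner (A x) x)"
  shows "\<exists>c. log_admissible c A"
proof -
  have Re: "\<delta> * (norm x)\<^sup>2 \<le> Re (cinner (shifted A t x) x)" for t x
    unfolding shifted_apply using acc[of x] by (simp add: cinner_simps cinner_self flip: of_real_power)
  then have "\<delta> * (norm x)\<^sup>2 \<le> cmod (cinner (shifted A t x) x)" for t x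
    using complex_Re_le_cmod order_trans by blast
  then show ?thesis
    by (intro log_admissibleI[OF A \<delta>] coercive_invertible[OF \<delta> Re] coercive_lower_bound)
qed

lemma dissipative_shifted:
  fixes A :: "'a::chilbert_space \<Rightarrow>\<^sub>L 'a"
  assumes A: "A \<in> bounded_ops" and dis: "\<And>x. 0 \<le> Im (cinner (A x) x)"
  shows "t * (norm x)\<^sup>2 \<le> Im (cinner (shifted A t x) x)"
    and "t > 0 \<Longrightarrow> op_invertible (shifted A t)"
proof -
  show Im: "t * (norm x)\<^sup>2 \<le> Im (cinner (shifted A t x) x)" for x
    unfolding shifted_apply using dis[of x] by (simp add: cinner_simps cinner_self flip: of_real_power)
  assume t: "t > 0"
  have "op_invertible ((- \<i>) *\<^sub>C shifted A t)"
    by (rule coercive_invertible[OF t]) (use Im in \<open>simp add: cinner_simps scaleC.minus_left blinfun.minus_left\<close>)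
  then have "op_invertible (\<i> *\<^sub>C ((- \<i>) *\<^sub>C shifted A t))"
    by (rule op_invertible_scaleC) (auto intro: bounded_ops_scaleC shifted_bounded_ops A)
  then show "op_invertible (shifted A t)" by (simp add: scaleC_scaleC)
qed

text \<open>For \<open>t\<close> bounded away from \<open>0\<close> the operator \<open>-i (A + i t)\<close> is coercive, and for small \<open>t\<close> the lower bound
  is inherited from the invertible \<open>A\<close>.\<close>
lemma dissipative_log_admissible:
  fixes A :: "'a::chilbert_space \<Rightarrow>\<^sub>L 'a"
  assumes A: "A \<in> bounded_ops" and inv: "op_invertible A" and dis: "\<And>x. 0 \<le> Im (cinner (A x) x)"
  shows "\<exists>c. log_admissible c A"
proof -
  define m where "m = norm (op_inverse A) + 1"
  have m: "m > 0" by (simp add: m_def add_nonneg_pos)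
  have low0: "norm x \<le> m * norm (A x)" for x
  proof -
    have "norm x = norm (op_inverse A (A x))" using inv by simp
    also have "\<dots> \<le> norm (op_inverse A) * norm (A x)" by (rule norm_blinfun)
    also have "\<dots> \<le> m * norm (A x)" by (intro mult_right_mono) (auto simp: m_def)
    finally show ?thesis .
  qed
  note Im = dissipative_shifted(1)[OF A dis] and inv_t = dissipative_shifted(2)[OF A dis]
  show ?thesis
  proof (rule log_admissibleI[OF A, of "1 / (2 * m)"])
    show "op_invertible (shifted A t)" if "t \<ge> 0" for t
      using that inv_t[of t] inv by (cases "t = 0") auto
    fix t :: real and x assume t: "t \<ge> 0"
    show "1 / (2 * m) * norm x \<le> norm (shifted A t x)"
    proof (cases "t \<le> 1 / (2 * m)")
      case True
      have "norm (A x) \<le> norm (shifted A t x) + t * norm x"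
        unfolding shifted_apply
        using norm_triangle_ineq4[of "A x + (\<i> * complex_of_real t) *\<^sub>C x" "(\<i> * complex_of_real t) *\<^sub>C x"] t
        by (simp add: norm_scaleC norm_mult)
      moreover have "t * norm x \<le> 1 / (2 * m) * norm x" by (intro mult_right_mono True) simp
      moreover have "1 / m * norm x \<le> norm (A x)" using low0[of x] m by (simp add: field_simps)
      moreover have "1 / m * norm x = 1 / (2 * m) * norm x + 1 / (2 * m) * norm x" by simp
      ultimately show ?thesis by linarith
    next
      case False
      have "t * (norm x)\<^sup>2 \<le> cmod (cinner (shifted A t x) x)"
        using Im[of t x] abs_Im_le_cmod[of "cinner (shifted A t x) x"] by linarith
      then have "t * norm x \<le> norm (shifted A t x)" by (rule coercive_lower_bound)
      moreover have "1 / (2 * m) * norm x \<le> t * norm x" using False by (intro mult_right_mono) auto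
      ultimately show ?thesis by linarith
    qed
  qed (use m in simp)
qed

lemma op_log_id: "op_log (id_blinfun :: 'a::chilbert_space \<Rightarrow>\<^sub>L 'a) = 0"
proof -
  have "resolvent (id_blinfun :: 'a \<Rightarrow>\<^sub>L 'a) t = inverse (1 + \<i> * complex_of_real t) *\<^sub>C id_blinfun" for t
  proof -
    have sh: "shifted (id_blinfun :: 'a \<Rightarrow>\<^sub>L 'a) t = (1 + \<i> * complex_of_real t) *\<^sub>C id_blinfun"
      by (simp add: scaleC.add_left)
    show ?thesis unfolding sh
      by (rule op_inverse_unique) (auto intro!: blinfun_eqI simp: scaleC_scaleC one_plus_neq_0)
  qed
  then show ?thesis by (simp add: op_log_def)
qed

text \<open>For an accretive \<open>A\<close> both \<open>log A\<close> and \<open>(log A\<^sup>*)\<^sup>*\<close> have derivative \<open>(A - 1) A\<^sub>s\<^sup>-\<^sup>1\<close> along the segment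
  \<open>A\<^sub>s = 1 + s (A - 1)\<close> of accretive operators, and both vanish at \<open>s = 0\<close>.\<close>

lemma op_adj_op_log:
  fixes A :: "'a::chilbert_space \<Rightarrow>\<^sub>L 'a"
  assumes A: "A \<in> bounded_ops" and \<delta>: "\<delta> > 0" and acc: "\<And>x. \<delta> * (norm x)\<^sup>2 \<le> Re (cinner (A x) x)"
  shows "op_adj (op_log A) = op_log (op_adj A)"
proof (rule op_adj_unique)
  fix x y :: 'a
  define P where "P B s = id_blinfun + s *\<^sub>R (B - id_blinfun)" for B :: "'a \<Rightarrow>\<^sub>L 'a" and s :: real
  have Pop: "P B s \<in> bounded_ops" if "B \<in> bounded_ops" for B s
    unfolding P_def by (intro bounded_ops_intros that)
  have Padm: "\<exists>c. log_admissible c (P B s)"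
    if B: "B \<in> bounded_ops" "\<And>x :: 'a. \<delta> * (norm x)\<^sup>2 \<le> Re (cinner (B x) x)" and s: "s \<in> {0..1}" for B :: "'a \<Rightarrow>\<^sub>L 'a" and s
  proof (rule accretive_log_admissible[OF Pop[OF B(1)]])
    show "min 1 \<delta> > 0" using \<delta> by simp
    fix x :: 'a
    have "min 1 \<delta> * (norm x)\<^sup>2 = (1 - s) * (min 1 \<delta> * (norm x)\<^sup>2) + s * (min 1 \<delta> * (norm x)\<^sup>2)"
      by (simp add: algebra_simps)
    also have "\<dots> \<le> (1 - s) * (1 * (norm x)\<^sup>2) + s * (\<delta> * (norm x)\<^sup>2)"
      using s by (intro add_mono mult_left_mono mult_right_mono) auto
    also have "\<dots> \<le> (1 - s) * (norm x)\<^sup>2 + s * Re (cinner (B x) x)"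
      using s B(2)[of x] by (intro add_mono mult_left_mono) auto
    also have "\<dots> = Re (cinner (P B s x) x)"
      by (simp add: P_def blinfun.add_left blinfun.scaleR_left blinfun.diff_left cinner_simps cinner_self
          algebra_simps flip: of_real_power)
    finally show "min 1 \<delta> * (norm x)\<^sup>2 \<le> Re (cinner (P B s x) x)" .
  qed
  have deriv: "((\<lambda>s. op_log (P B s)) has_vector_derivative ((B - id_blinfun) o\<^sub>L op_inverse (P B s))) (at s within {0..1})"
    if B: "B \<in> bounded_ops" "\<And>x :: 'a. \<delta> * (norm x)\<^sup>2 \<le> Re (cinner (B x) x)" and s: "s \<in> {0..1}" for B :: "'a \<Rightarrow>\<^sub>L 'a" and s
  proof -
    obtain c where c: "log_admissible c (P B s)" using Padm[OF B s] by blast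
    have H: "B - id_blinfun \<in> bounded_ops" by (intro bounded_ops_intros B)
    have com: "commutes (P B s) (B - id_blinfun)"
      by (rule commutesI) (simp add: P_def blinfun.add_left blinfun.scaleR_left blinfun.diff_left
          blinfun.add_right blinfun.scaleR_right blinfun.diff_right scaleR_diff_right)
    have "(P B has_derivative (\<lambda>h. h *\<^sub>R (B - id_blinfun))) (at s within {0..1})"
      unfolding P_def by (auto intro!: derivative_eq_intros)
    moreover have "(op_log has_derivative op_log_deriv (P B s)) (at (P B s) within P B ` {0..1})"
      by (rule has_derivative_subset[OF op_log_has_derivative[OF c]]) (use Pop B in auto)
    ultimately have "((\<lambda>s. op_log (P B s)) has_derivative (\<lambda>h. op_log_deriv (P B s) (h *\<^sub>R (B - id_blinfun)))) (at s within {0..1})"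
      by (rule has_derivative_in_compose)
    then show ?thesis
      unfolding has_vector_derivative_def
      by (simp add: linear_simps(5)[OF bounded_linear_op_log_deriv[OF c]] op_log_deriv_commuting[OF c H com])
  qed
  have Aop: "op_adj A \<in> bounded_ops" by (rule op_adj_in_bounded_ops[OF A])
  have acc': "\<delta> * (norm x)\<^sup>2 \<le> Re (cinner (op_adj A x) x)" for x
    using acc[of x] cinner_op_adj[OF A, of x x] cinner_commute[of x "op_adj A x"] by simp
  have adjP: "op_adj (P A s) = P (op_adj A) s" for s
    by (rule op_adj_unique)
      (simp add: P_def blinfun.add_left blinfun.scaleR_left blinfun.diff_left cinner_simps cinner_op_adj[OF A])
  define \<phi> where "\<phi> s = cinner (op_log (P A s) x) y - cinner x (op_log (P (op_adj A) s) y)" for s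
  have "(\<phi> has_derivative (\<lambda>h. 0)) (at s within {0..1})" if s: "s \<in> {0..1}" for s
  proof -
    obtain c where c: "log_admissible c (P A s)" using Padm[OF A acc s] by blast
    have inv: "op_invertible (P A s)" using log_admissibleD(3)[OF c, of 0] by simp
    have adj_inv: "op_inverse (P (op_adj A) s) = op_adj (op_inverse (P A s))"
      using op_invertible_op_adj(2)[OF inv Pop[OF A]] by (simp add: adjP)
    define K where "K = op_inverse (P A s)"
    have Kop: "K \<in> bounded_ops" unfolding K_def by (rule op_inverse_bounded_ops[OF Pop[OF A] inv])
    have com: "K (A z) = A (K z)" for z
    proof -
      have "P A s (A z) = A (P A s z)" for z
        by (simp add: P_def blinfun.add_left blinfun.scaleR_left blinfun.diff_left
          blinfun.add_right blinfun.scaleR_right blinfun.diff_right)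
      then show ?thesis unfolding K_def using inv by (metis op_inverse_apply)
    qed
    have "cinner (((A - id_blinfun) o\<^sub>L K) x) y = cinner x (((op_adj A - id_blinfun) o\<^sub>L op_adj K) y)"
      by (simp add: blinfun.diff_left cinner_simps com[symmetric] cinner_op_adj[OF Kop] cinner_op_adj[OF A])
    then have zero: "cinner (((A - id_blinfun) o\<^sub>L op_inverse (P A s)) x) y
        - cinner x (((op_adj A - id_blinfun) o\<^sub>L op_inverse (P (op_adj A) s)) y) = 0"
      by (simp add: K_def adj_inv)
    have d1: "((\<lambda>s. cinner (op_log (P A s) x) y) has_derivative
        (\<lambda>h. cinner ((h *\<^sub>R ((A - id_blinfun) o\<^sub>L op_inverse (P A s))) x) y)) (at s within {0..1})"
      by (intro bounded_linear.has_derivative[OF cinner.bounded_linear_left]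
          bounded_linear.has_derivative[OF blinfun.bounded_linear_left]
          deriv[OF A acc s, unfolded has_vector_derivative_def])
    have d2: "((\<lambda>s. cinner x (op_log (P (op_adj A) s) y)) has_derivative
        (\<lambda>h. cinner x ((h *\<^sub>R ((op_adj A - id_blinfun) o\<^sub>L op_inverse (P (op_adj A) s))) y))) (at s within {0..1})"
      by (intro bounded_linear.has_derivative[OF cinner.bounded_linear_right]
          bounded_linear.has_derivative[OF blinfun.bounded_linear_left]
          deriv[OF Aop acc' s, unfolded has_vector_derivative_def])
    have "(\<phi> has_derivative (\<lambda>h. cinner ((h *\<^sub>R ((A - id_blinfun) o\<^sub>L op_inverse (P A s))) x) y
        - cinner x ((h *\<^sub>R ((op_adj A - id_blinfun) o\<^sub>L op_inverse (P (op_adj A) s))) y))) (at s within {0..1})"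
      unfolding \<phi>_def by (intro has_derivative_diff d1 d2)
    moreover have "cinner ((h *\<^sub>R ((A - id_blinfun) o\<^sub>L op_inverse (P A s))) x) y
        - cinner x ((h *\<^sub>R ((op_adj A - id_blinfun) o\<^sub>L op_inverse (P (op_adj A) s))) y) = 0" for h
      unfolding blinfun.scaleR_left cinner_scaleR_left cinner_scaleR_right scaleR_diff_right[symmetric] zero by simp
    ultimately show ?thesis by simp
  qed
  then obtain k where k: "\<And>s. s \<in> {0..1} \<Longrightarrow> \<phi> s = k"
    using has_derivative_zero_constant[of "{0..1::real}" \<phi>] by auto
  have "\<phi> 1 = \<phi> 0" using k[of 0] k[of 1] by simp
  then show "cinner (op_log A x) y = cinner x (op_log (op_adj A) y)"
    by (simp add: \<phi>_def P_def op_log_id)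
qed

section \<open>Nevanlinna functions and the continuation of their logarithm\<close>

lemma half_plane_moebius:
  assumes "Im a > 0" "Im b > 0"
  shows "cmod (a - b) < cmod (a - cnj b)"
proof (rule power2_less_imp_less)
  have "(cmod (a - cnj b))\<^sup>2 - (cmod (a - b))\<^sup>2 = 4 * Im a * Im b"
    unfolding cmod_power2 by (simp add: power2_eq_square algebra_simps)
  moreover have "4 * Im a * Im b > 0" using assms by simp
  ultimately show "(cmod (a - b))\<^sup>2 < (cmod (a - cnj b))\<^sup>2" by linarith
qed simp

text \<open>A Harnack inequality, from the Schwarz-Pick lemma: the constant does not depend on \<open>f\<close>.\<close>

lemma half_plane_harnack:
  assumes z: "Im z > 0" and z0: "Im z0 > 0"
  obtains c where "c \<ge> 0" "\<And>f. f holomorphic_on {z. Im z > 0} \<Longrightarrow> (\<And>z. Im z > 0 \<Longrightarrow> Im (f z) > 0) \<Longrightarrow>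
    cmod (f z) \<le> c * cmod (f z0)"
proof -
  define w where "w = (z - z0) / (z - cnj z0)"
  define r where "r = cmod w"
  have zc: "z - cnj z0 \<noteq> 0" using z z0 by (auto simp: complex_eq_iff)
  have r: "r < 1" using half_plane_moebius[OF z z0] zc unfolding r_def w_def norm_divide
    by (simp add: divide_less_eq)
  have r0: "r \<ge> 0" by (simp add: r_def)
  show thesis
  proof (rule that[of "(1 + r) / (1 - r)"])
    show "(1 + r) / (1 - r) \<ge> 0" using r r0 by simp
    fix f assume f: "f holomorphic_on {z. Im z > 0}" and fpos: "\<And>z. Im z > 0 \<Longrightarrow> Im (f z) > 0"
    define \<phi> where "\<phi> u = (z0 - u * cnj z0) / (1 - u)" for u
    define F where "F u = (f (\<phi> u) - f z0) / (f (\<phi> u) - cnj (f z0))" for u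
    have u1: "1 - u \<noteq> 0" if "cmod u < 1" for u using that by auto
    have \<phi>: "Im (\<phi> u) > 0" if u: "cmod u < 1" for u
    proof -
      have "\<phi> u = (z0 - u * cnj z0) * cnj (1 - u) / complex_of_real ((cmod (1 - u))\<^sup>2)"
        unfolding \<phi>_def by (subst complex_div_cnj) simp
      then have "Im (\<phi> u) = Im ((z0 - u * cnj z0) * cnj (1 - u)) / (cmod (1 - u))\<^sup>2"
        by (simp add: Im_divide_of_real)
      also have "Im ((z0 - u * cnj z0) * cnj (1 - u)) = Im z0 * (1 - (cmod u)\<^sup>2)"
        unfolding cmod_power2 by (simp add: power2_eq_square algebra_simps)
      finally show ?thesis using u u1[OF u] z0 by (simp add: abs_square_less_1)
    qed
    have den: "f (\<phi> u) - cnj (f z0) \<noteq> 0" if "cmod u < 1" for u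
      using fpos[OF \<phi>[OF that]] fpos[OF z0] by (auto simp: complex_eq_iff)
    have "F holomorphic_on ball 0 1"
    proof -
      have "\<phi> holomorphic_on ball 0 1" unfolding \<phi>_def using u1 by (intro holomorphic_intros) auto
      then have "(f \<circ> \<phi>) holomorphic_on ball 0 1"
        by (rule holomorphic_on_compose_gen[OF _ f]) (use \<phi> in auto)
      then show ?thesis unfolding F_def o_def using den by (intro holomorphic_intros) auto
    qed
    moreover have "F 0 = 0" by (simp add: F_def \<phi>_def)
    moreover have "cmod (F u) < 1" if "cmod u < 1" for u
      using half_plane_moebius[OF fpos[OF \<phi>[OF that]] fpos[OF z0]] den[OF that]
      unfolding F_def norm_divide by (simp add: divide_less_eq)
    ultimately have "cmod (F w) \<le> cmod w" by (rule Schwarz_Lemma(1)[OF _ _ _ r[unfolded r_def]])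
    moreover have "\<phi> w = z"
    proof -
      have "1 - w = (z0 - cnj z0) / (z - cnj z0)" using zc by (simp add: w_def field_simps)
      moreover have "z0 - w * cnj z0 = z * (z0 - cnj z0) / (z - cnj z0)" using zc by (simp add: w_def field_simps)
      moreover have "z0 - cnj z0 \<noteq> 0" using z0 by (auto simp: complex_eq_iff)
      ultimately show ?thesis using zc by (simp add: \<phi>_def)
    qed
    ultimately have "cmod (f z - f z0) / cmod (f z - cnj (f z0)) \<le> r"
      by (simp add: F_def r_def norm_divide)
    moreover have "f z - cnj (f z0) \<noteq> 0" using fpos[OF z] fpos[OF z0] by (auto simp: complex_eq_iff)
    ultimately have "cmod (f z - f z0) \<le> r * cmod (f z - cnj (f z0))" by (simp add: divide_le_eq)
    also have "\<dots> \<le> r * (cmod (f z) + cmod (f z0))"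
      using norm_triangle_ineq4[of "f z" "cnj (f z0)"] r0 by (intro mult_left_mono) auto
    finally have "cmod (f z) - cmod (f z0) \<le> r * (cmod (f z) + cmod (f z0))"
      using norm_triangle_ineq2[of "f z" "f z0"] by linarith
    then have "(1 - r) * cmod (f z) \<le> (1 + r) * cmod (f z0)" by (simp add: algebra_simps)
    then show "cmod (f z) \<le> (1 + r) / (1 - r) * cmod (f z0)" using r by (simp add: field_simps)
  qed
qed

lemma polarization:
  fixes R :: "'a::chilbert_space \<Rightarrow>\<^sub>L 'a"
  assumes R: "R \<in> bounded_ops"
  defines "q \<equiv> \<lambda>w. cinner (R w) w"
  shows "4 * cinner (R u) v = q (u + v) - q (u - v) + \<i> * q (u + \<i> *\<^sub>C v) - \<i> * q (u - \<i> *\<^sub>C v)"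
  unfolding q_def
  by (simp add: blinfun.add_right blinfun.diff_right bounded_opsD[OF R] cinner_simps algebra_simps)

lemma norm_le_numerical_radius:
  fixes R :: "'a::chilbert_space \<Rightarrow>\<^sub>L 'a"
  assumes R: "R \<in> bounded_ops" and M: "\<And>x. cmod (cinner (R x) x) \<le> M * (norm x)\<^sup>2" "M \<ge> 0"
  shows "norm R \<le> 2 * M"
proof (rule norm_blinfun_le_cinner)
  fix x y :: 'a
  have pol: "cmod (cinner (R u) v) \<le> M * ((norm u)\<^sup>2 + (norm v)\<^sup>2)" for u v
  proof -
    let ?q = "\<lambda>w. cinner (R w) w"
    have "4 * cmod (cinner (R u) v) = cmod (?q (u + v) - ?q (u - v) + \<i> * ?q (u + \<i> *\<^sub>C v) - \<i> * ?q (u - \<i> *\<^sub>C v))"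
      using arg_cong[OF polarization[OF R, of u v], of cmod] by (simp add: norm_mult)
    also have "\<dots> \<le> cmod (?q (u + v)) + cmod (?q (u - v)) + cmod (?q (u + \<i> *\<^sub>C v)) + cmod (?q (u - \<i> *\<^sub>C v))"
      by (rule order_trans[OF norm_triangle_ineq4] add_mono order_trans[OF norm_triangle_ineq] | simp add: norm_mult)+
    also have "\<dots> \<le> M * (norm (u + v))\<^sup>2 + M * (norm (u - v))\<^sup>2 + M * (norm (u + \<i> *\<^sub>C v))\<^sup>2 + M * (norm (u - \<i> *\<^sub>C v))\<^sup>2"
      by (intro add_mono M)
    also have "\<dots> = 4 * (M * ((norm u)\<^sup>2 + (norm v)\<^sup>2))"
    proof -
      have p: "(norm (a + b))\<^sup>2 + (norm (a - b))\<^sup>2 = 2 * (norm a)\<^sup>2 + 2 * (norm b)\<^sup>2" for a b :: 'a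
        by (simp add: power2_norm_eq_inner algebra_simps inner_commute)
      have "M * a + M * b + M * c + M * d = M * ((a + b) + (c + d))" for a b c d
        by (simp add: distrib_left)
      then show ?thesis unfolding p by (simp add: p norm_scaleC)
    qed
    finally show ?thesis by simp
  qed
  show "cmod (cinner (R x) y) \<le> 2 * M * norm x * norm y"
  proof (cases "x = 0 \<or> y = 0")
    case False
    then have n: "norm x > 0" "norm y > 0" by auto
    have "cmod (cinner (R ((1 / norm x) *\<^sub>R x)) ((1 / norm y) *\<^sub>R y)) \<le> M * (1 + 1)"
      using pol[of "(1 / norm x) *\<^sub>R x" "(1 / norm y) *\<^sub>R y"] n by simp
    then have "cmod (cinner (R x) y) / (norm x * norm y) \<le> 2 * M"
      by (simp add: blinfun.scaleR_right cinner_simps field_simps)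
    then show ?thesis using n by (simp add: divide_le_eq mult.assoc)
  qed auto
qed (use M in simp)

lemma vholomorphic_quotient:
  assumes "N vholomorphic_on S" "open S" "z \<in> S"
  obtains D where "((\<lambda>w. inverse (w - z) *\<^sub>C (N w - N z)) \<longlongrightarrow> D) (at z)" "isCont N z"
proof -
  obtain D where "(N has_derivative (\<lambda>h. h *\<^sub>C D)) (at z within S)"
    using assms by (auto simp: vholomorphic_on_def)
  then have D: "(N has_derivative (\<lambda>h. h *\<^sub>C D)) (at z)" using at_within_open[OF assms(3,2)] by simp
  show thesis
  proof (rule that)
    show "isCont N z" by (rule has_derivative_continuous[OF D])
    have "((\<lambda>w. (1 / norm (w - z)) *\<^sub>R (N w - (N z + (w - z) *\<^sub>C D))) \<longlongrightarrow> 0) (at z)"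
      using D by (simp add: has_derivative_within)
    then have "((\<lambda>w. norm ((1 / norm (w - z)) *\<^sub>R (N w - (N z + (w - z) *\<^sub>C D)))) \<longlongrightarrow> 0) (at z)"
      by (rule tendsto_norm_zero)
    moreover have "\<forall>\<^sub>F w in at z. norm ((1 / norm (w - z)) *\<^sub>R (N w - (N z + (w - z) *\<^sub>C D)))
        = norm (inverse (w - z) *\<^sub>C (N w - N z) - D)"
      unfolding eventually_at_filter
    proof (rule always_eventually, intro allI impI)
      fix w assume "w \<noteq> z"
      then have "inverse (w - z) *\<^sub>C (N w - N z) - D = inverse (w - z) *\<^sub>C (N w - (N z + (w - z) *\<^sub>C D))"
        by (simp add: scaleC.diff_right scaleC.add_right scaleC_scaleC)
      then show "norm ((1 / norm (w - z)) *\<^sub>R (N w - (N z + (w - z) *\<^sub>C D))) = norm (inverse (w - z) *\<^sub>C (N w - N z) - D)"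
        by (simp add: norm_scaleC norm_inverse divide_inverse)
    qed
    ultimately have "((\<lambda>w. norm (inverse (w - z) *\<^sub>C (N w - N z) - D)) \<longlongrightarrow> 0) (at z)"
      by (rule Lim_transform_eventually)
    then show "((\<lambda>w. inverse (w - z) *\<^sub>C (N w - N z)) \<longlongrightarrow> D) (at z)"
      by (simp add: tendsto_norm_zero_iff LIM_zero_iff)
  qed
qed

lemma vholomorphic_isCont: "N vholomorphic_on S \<Longrightarrow> open S \<Longrightarrow> z \<in> S \<Longrightarrow> isCont N z"
  by (rule vholomorphic_quotient)

lemma open_upper_half_plane: "open {z. Im z > 0}"
  by (rule open_halfspace_Im_gt)

lemma cinner_op_Im:
  assumes "A \<in> bounded_ops"
  shows "cinner (op_Im A x) y = (1 / (2 * \<i>)) * (cinner (A x) y - cnj (cinner (A y) x))"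
proof -
  have "cinner (op_adj A x) y = cnj (cinner (A y) x)"
    by (metis assms cinner_commute cinner_op_adj)
  then show ?thesis by (simp add: op_Im_def blinfun.diff_left cinner_simps)
qed

lemma Re_cinner_op_Im:
  assumes "A \<in> bounded_ops" shows "Re (cinner (op_Im A x) x) = Im (cinner (A x) x)"
  unfolding cinner_op_Im[OF assms] by (simp add: Re_divide)

lemma nevanlinnaD:
  assumes N: "nevanlinna N" and z: "Im z > 0"
  shows "N z \<in> bounded_ops" "0 \<le> Im (cinner (N z x) x)"
proof -
  show 1: "N z \<in> bounded_ops" using assms by (simp add: nevanlinna_def)
  have "op_nonneg (op_Im (N z))" using assms by (simp add: nevanlinna_def)
  then show "0 \<le> Im (cinner (N z x) x)"
    using op_nonnegD(1)[of "op_Im (N z)" x] Re_cinner_op_Im[OF 1, of x] by simp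
qed

text \<open>For \<open>\<epsilon> > 0\<close> the functions \<open>-\<langle>(N(z) + i \<epsilon>)\<^sup>-\<^sup>1 x, x\<rangle>\<close> map the upper half-plane to itself, so the norms
  of \<open>(N(z) + i \<epsilon>)\<^sup>-\<^sup>1\<close> at two points are comparable, uniformly in \<open>\<epsilon>\<close>.\<close>

lemma nevanlinna_invertible:
  fixes N :: "complex \<Rightarrow> 'a::chilbert_space \<Rightarrow>\<^sub>L 'a"
  assumes N: "nevanlinna N" and z0: "Im z0 > 0" "op_invertible (N z0)" and z: "Im z > 0"
  shows "op_invertible (N z)"
proof -
  obtain c0 where c0: "log_admissible c0 (N z0)"
    using dissipative_log_admissible[OF nevanlinnaD(1)[OF N z0(1)] z0(2) nevanlinnaD(2)[OF N z0(1)]] by blast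
  obtain c where c: "c \<ge> 0" "\<And>f. f holomorphic_on {z. Im z > 0} \<Longrightarrow> (\<And>z. Im z > 0 \<Longrightarrow> Im (f z) > 0) \<Longrightarrow>
    cmod (f z) \<le> c * cmod (f z0)"
    using half_plane_harnack[OF z z0(1)] by metis
  define L where "L = 2 * (c * (1 / c0))"
  have L: "L \<ge> 0" using c log_admissibleD(2)[OF c0] by (simp add: L_def)
  \<comment> \<open>\<open>L\<close> will bound the inverse of \<open>N(z) + i \<epsilon>\<close> whatever \<open>\<epsilon>\<close>; with \<open>\<epsilon> L < 1\<close> the shift can be undone\<close>
  define \<epsilon> where "\<epsilon> = 1 / (L + 1)"
  have \<epsilon>: "\<epsilon> > 0" using L by (simp add: \<epsilon>_def)
  define R where "R w = resolvent (N w) \<epsilon>" for w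
  have Nop: "shifted (N w) \<epsilon> \<in> bounded_ops" if "Im w > 0" for w
    by (rule shifted_bounded_ops[OF nevanlinnaD(1)[OF N that]])
  have Im: "\<epsilon> * (norm x)\<^sup>2 \<le> Im (cinner (shifted (N w) \<epsilon> x) x)" if "Im w > 0" for w x
    by (rule dissipative_shifted(1)[OF nevanlinnaD[OF N that]])
  have inv: "op_invertible (shifted (N w) \<epsilon>)" if "Im w > 0" for w
    by (rule dissipative_shifted(2)[OF nevanlinnaD[OF N that] \<epsilon>])
  have Rop: "R w \<in> bounded_ops" if "Im w > 0" for w
    unfolding R_def by (rule op_inverse_bounded_ops[OF Nop[OF that] inv[OF that]])
  have nR: "norm (R w) \<le> 1 / \<epsilon>" if w: "Im w > 0" for w
    unfolding R_def
  proof (rule norm_op_inverse_le[OF inv[OF w] _ \<epsilon>])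
    show "\<epsilon> * norm x \<le> norm (shifted (N w) \<epsilon> x)" for x
      by (rule coercive_lower_bound) (use Im[OF w, of x] abs_Im_le_cmod[of "cinner (shifted (N w) \<epsilon> x) x"] in linarith)
  qed
  have Rdiff: "R v - R w = - (R v o\<^sub>L (N v - N w) o\<^sub>L R w)" if "Im v > 0" "Im w > 0" for v w
    unfolding R_def op_inverse_difference[OF inv[OF that(1)] inv[OF that(2)]]
    by (rule blinfun_eqI) (simp add: blinfun.diff_left blinfun.add_left blinfun.minus_left blinfun.diff_right)
  have hol: "(\<lambda>w. - cinner (R w x) x) holomorphic_on {z. Im z > 0}" for x
    unfolding holomorphic_on_def
  proof
    fix w assume w: "w \<in> {z. Im z > 0}"
    have Nv: "N vholomorphic_on {z. Im z > 0}" using N by (simp add: nevanlinna_def)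
    obtain D where D: "((\<lambda>v. inverse (v - w) *\<^sub>C (N v - N w)) \<longlongrightarrow> D) (at w)" "isCont N w"
      using vholomorphic_quotient[OF Nv open_upper_half_plane w] by blast
    have up: "\<forall>\<^sub>F v in at w. Im v > 0"
      using w eventually_at_in_open'[OF open_upper_half_plane, of w] by simp
    have "((\<lambda>v. norm (R v - R w)) \<longlongrightarrow> 0) (at w)"
    proof (rule tendsto_sandwich[OF _ _ tendsto_const])
      show "\<forall>\<^sub>F v in at w. norm (R v - R w) \<le> (1 / \<epsilon>) * norm (N v - N w) * (1 / \<epsilon>)"
        using up
      proof eventually_elim
        case (elim v)
        have "norm (R v - R w) \<le> norm (R v) * norm (N v - N w) * norm (R w)"
          using elim w by (simp only: Rdiff mem_Collect_eq norm_minus_cancel norm_blinfun_compose3)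
        also have "\<dots> \<le> (1 / \<epsilon>) * norm (N v - N w) * (1 / \<epsilon>)"
          using elim w \<epsilon> by (intro mult_mono nR mult_nonneg_nonneg) auto
        finally show ?case .
      qed
      have "((\<lambda>v. N v - N w) \<longlongrightarrow> 0) (at w)" using D(2) by (simp add: isCont_def LIM_zero)
      then have "((\<lambda>v. (1 / \<epsilon>) * norm (N v - N w) * (1 / \<epsilon>)) \<longlongrightarrow> (1 / \<epsilon>) * 0 * (1 / \<epsilon>)) (at w)"
        by (intro tendsto_intros tendsto_norm_zero)
      then show "((\<lambda>v. (1 / \<epsilon>) * norm (N v - N w) * (1 / \<epsilon>)) \<longlongrightarrow> 0) (at w)" by simp
    qed auto
    then have Rc: "(R \<longlongrightarrow> R w) (at w)" by (simp add: tendsto_norm_zero_iff LIM_zero_iff)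
    have "((\<lambda>v. cinner (R v ((inverse (v - w) *\<^sub>C (N v - N w)) (R w x))) x) \<longlongrightarrow> cinner (R w (D (R w x))) x) (at w)"
      by (intro cinner.tendsto blinfun.tendsto Rc D tendsto_const)
    moreover have "\<forall>\<^sub>F v in at w. cinner (R v ((inverse (v - w) *\<^sub>C (N v - N w)) (R w x))) x
        = (- cinner (R v x) x - - cinner (R w x) x) / (v - w)"
      using up
    proof eventually_elim
      case (elim v)
      have "R v x - R w x = - R v ((N v - N w) (R w x))"
        using arg_cong[OF Rdiff[OF elim], of w "\<lambda>T. T x"] w by (simp add: blinfun.diff_left blinfun.minus_left)
      then have "cinner (R v ((N v - N w) (R w x))) x = - (cinner (R v x) x - cinner (R w x) x)"
        by (metis cinner.diff_left cinner.minus_left minus_minus)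
      then show ?case
        by (simp add: bounded_opsD[OF Rop[OF elim]] cinner_scaleC_left field_simps)
    qed
    ultimately have "((\<lambda>v. (- cinner (R v x) x - - cinner (R w x) x) / (v - w)) \<longlongrightarrow> cinner (R w (D (R w x))) x) (at w)"
      by (rule Lim_transform_eventually)
    then have "((\<lambda>w. - cinner (R w x) x) has_field_derivative cinner (R w (D (R w x))) x) (at w)"
      by (simp only: has_field_derivative_iff)
    then show "(\<lambda>w. - cinner (R w x) x) field_differentiable at w within {z. Im z > 0}"
      using field_differentiable_at_within field_differentiable_def by blast
  qed
  have pos: "Im (- cinner (R w x) x) > 0" if w: "Im w > 0" and x: "x \<noteq> 0" for w x
  proof -
    define u where "u = R w x"
    have xu: "x = shifted (N w) \<epsilon> u" unfolding u_def R_def using inv[OF w] by simp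
    then have "u \<noteq> 0" using x by auto
    then have "0 < \<epsilon> * (norm u)\<^sup>2" using \<epsilon> by simp
    also have "\<dots> \<le> Im (cinner x u)" unfolding xu by (rule Im[OF w])
    also have "\<dots> = Im (- cinner u x)" using cinner_commute[of x u] by simp
    finally show ?thesis by (simp add: u_def)
  qed
  have "norm (R z) \<le> 2 * (c * (1 / c0))"
  proof (rule norm_le_numerical_radius[OF Rop[OF z]])
    fix x
    show "cmod (cinner (R z x) x) \<le> c * (1 / c0) * (norm x)\<^sup>2"
    proof (cases "x = 0")
      case False
      have "cmod (- cinner (R z x) x) \<le> c * cmod (- cinner (R z0 x) x)"
        by (rule c(2)[OF hol]) (use pos False in auto)
      also have "\<dots> \<le> c * ((1 / c0) * norm x * norm x)"
      proof (rule mult_left_mono[OF _ c(1)])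
        have "norm (R z0) \<le> 1 / (c0 * (1 + \<epsilon>))" unfolding R_def by (rule log_admissibleD(4)[OF c0]) (use \<epsilon> in simp)
        also have "\<dots> \<le> 1 / c0" using log_admissibleD(2)[OF c0] \<epsilon> by (intro divide_left_mono) auto
        finally have "norm (R z0) * norm x * norm x \<le> (1 / c0) * norm x * norm x" by (intro mult_right_mono) auto
        then show "cmod (- cinner (R z0 x) x) \<le> (1 / c0) * norm x * norm x"
          using cmod_cinner_blinfun_le[of "R z0" x x] by simp
      qed
      finally show ?thesis by (simp add: power2_eq_square mult.assoc)
    qed simp
  qed (use c log_admissibleD(2)[OF c0] in simp)
  then have nRz: "norm (R z) \<le> L" by (simp add: L_def)
  have "op_invertible (shifted (N z) \<epsilon> + (- (\<i> * complex_of_real \<epsilon>)) *\<^sub>C id_blinfun)"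
  proof (rule op_invertible_perturb[OF inv[OF z] _ _ L])
    show "norm (op_inverse (shifted (N z) \<epsilon>) x) \<le> L * norm x" for x
      using norm_blinfun[of "R z" x] mult_right_mono[OF nRz, of "norm x"] unfolding R_def by simp
    have "norm ((- (\<i> * complex_of_real \<epsilon>)) *\<^sub>C (id_blinfun :: 'a \<Rightarrow>\<^sub>L 'a)) \<le> \<epsilon> * 1"
      unfolding norm_scaleC norm_minus_cancel norm_mult norm_ii norm_of_real using \<epsilon>
      by (intro mult_mono norm_blinfun_id_le) auto
    then have "norm ((- (\<i> * complex_of_real \<epsilon>)) *\<^sub>C (id_blinfun :: 'a \<Rightarrow>\<^sub>L 'a)) * L \<le> \<epsilon> * L"
      using L by (intro mult_right_mono) auto
    also have "\<dots> < 1" using L by (simp add: \<epsilon>_def)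
    finally show "norm ((- (\<i> * complex_of_real \<epsilon>)) *\<^sub>C (id_blinfun :: 'a \<Rightarrow>\<^sub>L 'a)) * L < 1" .
  qed
  then show ?thesis by (simp add: scaleC.minus_left)
qed

lemma nevanlinna_log_admissible:
  fixes N :: "complex \<Rightarrow> 'a::chilbert_space \<Rightarrow>\<^sub>L 'a"
  assumes N: "nevanlinna N" and inv: "\<exists>z. Im z \<noteq> 0 \<and> op_invertible (N z)" and z: "Im z > 0"
  shows "\<exists>c. log_admissible c (N z)"
proof -
  obtain z1 where z1: "Im z1 \<noteq> 0" "op_invertible (N z1)" using inv by blast
  obtain z0 where z0: "Im z0 > 0" "op_invertible (N z0)"
  proof (cases "Im z1 > 0")
    case False
    then have neg: "Im z1 < 0" using z1 by simp
    then have up: "Im (cnj z1) > 0" by simp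
    have "N z1 = op_adj (N (cnj z1))" using N neg by (simp add: nevanlinna_def)
    then have "op_adj (N z1) = N (cnj z1)" "N z1 \<in> bounded_ops"
      using nevanlinnaD(1)[OF N up] by (simp_all add: op_adj_op_adj op_adj_in_bounded_ops)
    then show thesis using op_invertible_op_adj(1)[OF z1(2)] that[OF up] by simp
  qed (use z1 that in blast)
  show ?thesis
    by (rule dissipative_log_admissible[OF nevanlinnaD(1)[OF N z] nevanlinna_invertible[OF N z0 z] nevanlinnaD(2)[OF N z]])
qed

lemma reflection_continuation_tendsto:
  assumes M: "reflection_continuation N I M" and \<zeta>: "\<zeta> \<in> I"
  shows "((\<lambda>\<epsilon>. M (Complex \<zeta> \<epsilon>)) \<longlongrightarrow> M (complex_of_real \<zeta>)) (at 0)"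
proof -
  obtain U where U: "open U" "complex_of_real ` I \<subseteq> U" "M vholomorphic_on ({z. Im z > 0} \<union> U)"
    using M by (auto simp: reflection_continuation_def)
  have "open ({z. Im z > 0} \<union> U)" "complex_of_real \<zeta> \<in> {z. Im z > 0} \<union> U"
    using U \<zeta> open_upper_half_plane by auto
  then have "isCont M (complex_of_real \<zeta>)" by (rule vholomorphic_isCont[OF U(3)])
  moreover have "((\<lambda>\<epsilon>. Complex \<zeta> \<epsilon>) \<longlongrightarrow> complex_of_real \<zeta>) (at 0)"
    unfolding complex_of_real_def by (intro tendsto_intros)
  ultimately show ?thesis by (rule isCont_tendsto_compose)
qed

text \<open>Two continuations agree off the real line, hence on \<open>I\<close> by continuity.\<close>
lemma refl_ext_eq:
  assumes M: "reflection_continuation N I M" and z: "Im z \<noteq> 0 \<or> z \<in> complex_of_real ` I"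
  shows "refl_ext N I z = M z"
  unfolding refl_ext_def
proof (rule the_equality)
  fix A assume "\<exists>M. reflection_continuation N I M \<and> M z = A"
  then obtain M' where M': "reflection_continuation N I M'" "M' z = A" by blast
  show "A = M z"
  proof (cases "Im z = 0")
    case True
    then obtain \<zeta> where \<zeta>: "\<zeta> \<in> I" "z = complex_of_real \<zeta>" using z by auto
    have "\<forall>\<^sub>F \<epsilon> in at 0. M (Complex \<zeta> \<epsilon>) = M' (Complex \<zeta> \<epsilon>)"
      unfolding eventually_at_filter using M M' by (intro always_eventually) (simp add: reflection_continuation_def)
    then have "((\<lambda>\<epsilon>. M' (Complex \<zeta> \<epsilon>)) \<longlongrightarrow> M z) (at 0)"
      unfolding \<zeta>(2) by (rule Lim_transform_eventually[OF reflection_continuation_tendsto[OF M \<zeta>(1)]])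
    then show ?thesis
      using reflection_continuation_tendsto[OF M'(1) \<zeta>(1)] LIM_unique \<zeta>(2) M'(2) by blast
  qed (use M M' in \<open>simp add: reflection_continuation_def\<close>)
qed (use M in blast)

text \<open>The limits from above and from below agree, and they are adjoint to each other.\<close>
lemma reflection_continuation_symmetric:
  fixes N :: "complex \<Rightarrow> 'a::chilbert_space \<Rightarrow>\<^sub>L 'a"
  assumes M: "reflection_continuation N I M" and \<zeta>: "\<zeta> \<in> I"
    and refl: "\<And>z. Im z < 0 \<Longrightarrow> N z = op_adj (N (cnj z))"
  shows "op_adj (M (complex_of_real \<zeta>)) = M (complex_of_real \<zeta>)"
proof -
  note lim = reflection_continuation_tendsto[OF M \<zeta>]
  obtain U where U: "complex_of_real ` I \<subseteq> U" "\<forall>z\<in>{z. Im z > 0} \<union> U. M z \<in> bounded_ops"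
    and eq: "\<And>z. Im z \<noteq> 0 \<Longrightarrow> M z = N z"
    using M by (auto simp: reflection_continuation_def)
  have M0: "M (complex_of_real \<zeta>) \<in> bounded_ops" and up: "\<And>z. Im z > 0 \<Longrightarrow> M z \<in> bounded_ops"
    using U \<zeta> by blast+
  have "((\<lambda>\<epsilon>. M (Complex \<zeta> \<epsilon>)) \<longlongrightarrow> M (complex_of_real \<zeta>)) (at_right 0)"
    using lim by (rule tendsto_mono[rotated]) (simp add: at_within_le_at)
  then have "((\<lambda>\<epsilon>. op_adj (M (Complex \<zeta> \<epsilon>))) \<longlongrightarrow> op_adj (M (complex_of_real \<zeta>))) (at_right 0)"
    by (rule tendsto_op_adj[OF _ _ M0]) (use up in \<open>auto simp: eventually_at_filter\<close>)
  moreover have "\<forall>\<^sub>F \<epsilon> in at_right 0. op_adj (M (Complex \<zeta> \<epsilon>)) = M (Complex \<zeta> (- \<epsilon>))"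
    unfolding eventually_at_filter
  proof (rule always_eventually, intro allI impI)
    fix \<epsilon> :: real assume "\<epsilon> \<noteq> 0" "\<epsilon> \<in> {0<..}"
    moreover have "cnj (Complex \<zeta> (- \<epsilon>)) = Complex \<zeta> \<epsilon>" by (simp add: complex_eq_iff)
    ultimately show "op_adj (M (Complex \<zeta> \<epsilon>)) = M (Complex \<zeta> (- \<epsilon>))"
      using refl[of "Complex \<zeta> (- \<epsilon>)"] by (simp add: eq)
  qed
  ultimately have "((\<lambda>\<epsilon>. M (Complex \<zeta> (- \<epsilon>))) \<longlongrightarrow> op_adj (M (complex_of_real \<zeta>))) (at_right 0)"
    by (rule Lim_transform_eventually)
  moreover have "((\<lambda>\<epsilon>. M (Complex \<zeta> (- \<epsilon>))) \<longlongrightarrow> M (complex_of_real \<zeta>)) (at_right 0)"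
  proof (rule filterlim_compose[OF lim])
    show "LIM \<epsilon> at_right 0. - \<epsilon> :> at (0::real)"
      unfolding filterlim_at by (auto simp: eventually_at_filter intro!: tendsto_eq_intros)
  qed
  ultimately show ?thesis using tendsto_unique trivial_limit_at_right_real by blast
qed

text \<open>The bottom of the numerical range of a symmetric operator is an approximate eigenvalue.\<close>

lemma symmetric_spectrum_lower_bound:
  fixes A :: "'a::chilbert_space \<Rightarrow>\<^sub>L 'a"
  assumes A: "A \<in> bounded_ops" "\<And>x y. cinner (A x) y = cinner x (A y)"
    and spec: "op_spectrum A \<subseteq> complex_of_real ` {\<epsilon><..}"
  shows "\<epsilon> * (norm x)\<^sup>2 \<le> Re (cinner (A x) x)"
proof (rule ccontr)
  assume neg: "\<not> \<epsilon> * (norm x)\<^sup>2 \<le> Re (cinner (A x) x)"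
  define q where "q y = Re (cinner (A y) y)" for y
  have qs: "q (r *\<^sub>R y) = r\<^sup>2 * q y" for r y
    by (simp add: q_def blinfun.scaleR_right cinner_simps power2_eq_square)
  have lb: "- norm A \<le> q y" if "norm y = 1" for y
    using cmod_cinner_blinfun_le[of A y y] abs_Re_le_cmod[of "cinner (A y) y"] that by (simp add: q_def)
  define m where "m = Inf (q ` {y. norm y = 1})"
  have bdd: "bdd_below (q ` {y. norm y = 1})" using lb by (intro bdd_belowI2) auto
  have x: "x \<noteq> 0" using neg by auto
  define u where "u = (1 / norm x) *\<^sub>R x"
  have u: "norm u = 1" using x by (simp add: u_def)
  have "q u < \<epsilon>" using neg x unfolding u_def qs by (simp add: q_def field_simps)
  moreover have mle: "m \<le> q y" if "norm y = 1" for y unfolding m_def using that by (intro cINF_lower[OF bdd]) simp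
  ultimately have m: "m < \<epsilon>" using u by fastforce
  define P where "P = A - complex_of_real m *\<^sub>C id_blinfun"
  have Pop: "P \<in> bounded_ops" unfolding P_def by (intro bounded_ops_intros A)
  have Pq: "Re (cinner (P y) y) = q y - m * (norm y)\<^sup>2" for y
    by (simp add: P_def q_def blinfun.diff_left blinfun.scaleR_left cinner_simps cinner_self flip: of_real_power)
  have Ppos: "op_nonneg P"
  proof (rule op_nonnegI)
    show "cinner (P a) b = cinner a (P b)" for a b
      by (simp add: P_def blinfun.diff_left blinfun.scaleR_left cinner_simps A)
    fix y
    show "0 \<le> Re (cinner (P y) y)"
    proof (cases "y = 0")
      case False
      then have "m \<le> q ((1 / norm y) *\<^sub>R y)" by (intro mle) simp
      then show ?thesis using False unfolding Pq qs by (simp add: field_simps)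
    qed simp
  qed
  have "\<not> op_invertible P"
  proof
    assume inv: "op_invertible P"
    define K where "K = (norm (op_inverse P))\<^sup>2 * norm P + 1"
    have K: "K > 0" by (simp add: K_def add_nonneg_pos)
    have "\<exists>v\<in>q ` {y. norm y = 1}. v < m + 1 / K"
      unfolding m_def using u K by (subst cInf_less_iff[symmetric]) (auto simp: bdd)
    then obtain y where y: "norm y = 1" "q y < m + 1 / K" by auto
    have "1 = norm (op_inverse P (P y))" using inv y by simp
    also have "\<dots> \<le> norm (op_inverse P) * norm (P y)" by (rule norm_blinfun)
    finally have "1 \<le> (norm (op_inverse P) * norm (P y))\<^sup>2" by (simp add: one_le_power)
    also have "\<dots> = (norm (op_inverse P))\<^sup>2 * (norm (P y))\<^sup>2" by (simp add: power_mult_distrib)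
    also have "\<dots> \<le> (norm (op_inverse P))\<^sup>2 * (norm P * Re (cinner (P y) y))"
    proof (rule mult_left_mono)
      have "((norm (P y))\<^sup>2)\<^sup>2 \<le> Re (cinner (P y) y) * Re (cinner (P (P y)) (P y))"
        using positive_cauchy_schwarz[OF Pop Ppos, of y "P y"] by (simp add: cinner_self norm_power)
      also have "\<dots> \<le> Re (cinner (P y) y) * (norm P * norm (P y) * norm (P y))"
        by (intro mult_left_mono op_nonnegD(1)[OF Ppos] order_trans[OF complex_Re_le_cmod cmod_cinner_blinfun_le])
      finally have "(norm (P y))\<^sup>2 * (norm (P y))\<^sup>2 \<le> (norm P * Re (cinner (P y) y)) * (norm (P y))\<^sup>2"
        by (simp add: power2_eq_square mult_ac)
      then show "(norm (P y))\<^sup>2 \<le> norm P * Re (cinner (P y) y)"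
        using op_nonnegD(1)[OF Ppos, of y] mult_right_le_imp_le[of _ "(norm (P y))\<^sup>2"]
        by (cases "P y = 0") (simp, metis zero_less_norm_iff zero_less_power)
    qed simp
    also have "\<dots> \<le> K * Re (cinner (P y) y)"
      using op_nonnegD(1)[OF Ppos, of y] by (simp add: K_def algebra_simps)
    also have "\<dots> < K * (1 / K)" using y K unfolding Pq by (intro mult_strict_left_mono) auto
    finally show False using K by simp
  qed
  then have "complex_of_real m \<in> op_spectrum A" by (simp add: op_spectrum_def P_def)
  then have "m > \<epsilon>" using spec by auto
  then show False using m by simp
qed

lemma nev_log_bounded_ops:
  assumes N: "nevanlinna N" and inv: "\<exists>z. Im z \<noteq> 0 \<and> op_invertible (N z)" and z: "Im z \<noteq> 0"
  shows "nev_log N z \<in> bounded_ops"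
proof -
  have "op_log (N w) \<in> bounded_ops" if "Im w > 0" for w
    using nevanlinna_log_admissible[OF N inv that] op_log_bounded_ops by blast
  from this[of z] this[of "cnj z"] show ?thesis
    using z by (cases "Im z > 0") (auto simp: nev_log_def intro!: op_adj_in_bounded_ops)
qed

lemma nev_log_reflection: "Im z < 0 \<Longrightarrow> nev_log N z = op_adj (nev_log N (cnj z))"
  by (simp add: nev_log_def)

text \<open>Near \<open>I\<close> the continuation of \<open>N\<close> is accretive, so \<open>log N\<close> continues analytically across \<open>I\<close> by the same
  integral, and the values below the axis are the reflected ones because \<open>log A\<^sup>* = (log A)\<^sup>*\<close> for
  accretive \<open>A\<close>.\<close>

lemma nev_log_reflection_continuation:
  fixes N :: "complex \<Rightarrow> 'a::chilbert_space \<Rightarrow>\<^sub>L 'a"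
  assumes N: "nevanlinna N" and inv: "\<exists>z. Im z \<noteq> 0 \<and> op_invertible (N z)"
    and adm: "admits_reflection_continuation N I"
    and spec: "\<epsilon> > 0" "\<forall>\<zeta>\<in>I. op_spectrum (refl_ext N I (complex_of_real \<zeta>)) \<subseteq> complex_of_real ` {\<epsilon><..}"
  obtains M where "reflection_continuation (nev_log N) I M"
proof -
  obtain M0 where M0: "reflection_continuation N I M0" using adm by (auto simp: admits_reflection_continuation_def)
  obtain U where U: "open U" "complex_of_real ` I \<subseteq> U" "\<And>z. z \<in> {z. Im z > 0} \<union> U \<Longrightarrow> M0 z \<in> bounded_ops"
    "M0 vholomorphic_on ({z. Im z > 0} \<union> U)" and eq: "\<And>z. Im z \<noteq> 0 \<Longrightarrow> M0 z = N z"
    using M0 by (auto simp: reflection_continuation_def)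
  have Nrefl: "N z = op_adj (N (cnj z))" if "Im z < 0" for z using N that by (simp add: nevanlinna_def)
  have low: "\<epsilon> * (norm x)\<^sup>2 \<le> Re (cinner (M0 (complex_of_real \<zeta>) x) x)" if \<zeta>: "\<zeta> \<in> I" for \<zeta> x
  proof (rule symmetric_spectrum_lower_bound)
    show op: "M0 (complex_of_real \<zeta>) \<in> bounded_ops" using U \<zeta> by auto
    have "op_adj (M0 (complex_of_real \<zeta>)) = M0 (complex_of_real \<zeta>)"
      by (rule reflection_continuation_symmetric[OF M0 \<zeta> Nrefl])
    then show "cinner (M0 (complex_of_real \<zeta>) x) y = cinner x (M0 (complex_of_real \<zeta>) y)" for x y
      using cinner_op_adj[OF op] by simp
    show "op_spectrum (M0 (complex_of_real \<zeta>)) \<subseteq> complex_of_real ` {\<epsilon><..}"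
      using bspec[OF spec(2) \<zeta>] refl_ext_eq[OF M0, of "complex_of_real \<zeta>"] \<zeta> by simp
  qed
  \<comment> \<open>the points where the continuation is within \<open>\<epsilon> / 2\<close> of one of its values on \<open>I\<close>, all of which are
    at least \<open>\<epsilon>\<close>\<close>
  define V where "V = (\<Union>\<zeta>\<in>I. U \<inter> M0 -` ball (M0 (complex_of_real \<zeta>)) (\<epsilon> / 2))"
  define S where "S = {z. Im z > 0} \<union> V"
  have VU: "V \<subseteq> U" by (auto simp: V_def)
  then have SU: "S \<subseteq> {z. Im z > 0} \<union> U" by (auto simp: S_def)
  have cont: "continuous_on U M0"
  proof -
    have "isCont M0 z" if "z \<in> U" for z
      by (rule vholomorphic_isCont[OF U(4)]) (use that U(1) open_upper_half_plane in auto)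
    then show ?thesis by (rule continuous_at_imp_continuous_on[OF ballI])
  qed
  have Vopen: "open V"
    unfolding V_def by (intro open_UN ballI continuous_open_preimage[OF cont U(1)]) simp
  have acc: "\<epsilon> / 2 * (norm x)\<^sup>2 \<le> Re (cinner (M0 z x) x)" if z: "z \<in> V" for z x
  proof -
    obtain \<zeta> where \<zeta>: "\<zeta> \<in> I" "norm (M0 (complex_of_real \<zeta>) - M0 z) < \<epsilon> / 2"
      using z by (auto simp: V_def dist_norm)
    let ?D = "M0 (complex_of_real \<zeta>) - M0 z"
    have "Re (cinner (?D x) x) \<le> norm ?D * norm x * norm x"
      by (rule order_trans[OF complex_Re_le_cmod cmod_cinner_blinfun_le])
    also have "\<dots> \<le> \<epsilon> / 2 * norm x * norm x" using \<zeta>(2) by (intro mult_right_mono) auto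
    finally have "Re (cinner (M0 (complex_of_real \<zeta>) x) x) - Re (cinner (M0 z x) x) \<le> \<epsilon> / 2 * (norm x)\<^sup>2"
      by (simp add: blinfun.diff_left cinner_simps power2_eq_square mult.assoc)
    then show ?thesis using low[OF \<zeta>(1), of x] by simp
  qed
  define M where "M z = (if Im z = 0 then op_log (M0 z) else nev_log N z)" for z
  have M: "M z = op_log (M0 z)" if z: "z \<in> S" for z
  proof (cases "Im z < 0")
    case True
    then have zV: "z \<in> V" using z by (auto simp: S_def)
    have Nz: "N z \<in> bounded_ops" using U(3)[of z] zV VU eq[of z] True by auto
    have up: "Im (cnj z) > 0" using True by simp
    have "N (cnj z) = op_adj (N z)"
      using Nrefl[OF True] op_adj_op_adj[OF nevanlinnaD(1)[OF N up]] by simp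
    then have "M z = op_adj (op_log (op_adj (N z)))" using True by (simp add: M_def nev_log_def)
    also have "op_log (op_adj (N z)) = op_adj (op_log (N z))"
      using acc[OF zV] eq[of z] True spec(1)
      by (intro op_adj_op_log[symmetric, OF Nz, of "\<epsilon> / 2"]) auto
    also have "op_adj (op_adj (op_log (N z))) = op_log (N z)"
    proof -
      obtain c where "log_admissible c (N z)"
        using accretive_log_admissible[OF Nz, of "\<epsilon> / 2"] acc[OF zV] eq[of z] True spec(1) by auto
      then show ?thesis by (intro op_adj_op_adj op_log_bounded_ops)
    qed
    finally show ?thesis using eq[of z] True by simp
  next
    case False
    then show ?thesis by (cases "Im z = 0") (simp_all add: M_def nev_log_def eq)
  qed
  have admis: "\<exists>c. log_admissible c (M0 z)" if z: "z \<in> S" for z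
  proof (cases "Im z > 0")
    case True
    then show ?thesis using nevanlinna_log_admissible[OF N inv True] eq[of z] by simp
  next
    case False
    then have "z \<in> V" using z by (simp add: S_def)
    then show ?thesis
      using accretive_log_admissible[OF U(3)[of z], of "\<epsilon> / 2"] acc VU spec(1) by auto
  qed
  have "M0 vholomorphic_on S"
    using U(4) SU unfolding vholomorphic_on_def by (meson has_derivative_subset subsetD)
  then have "(\<lambda>z. op_log (M0 z)) vholomorphic_on S" by (rule vholomorphic_op_log[OF _ admis])
  then have "M vholomorphic_on S"
    unfolding vholomorphic_on_def
  proof (intro ballI)
    fix z assume hol: "\<forall>z\<in>S. \<exists>D. ((\<lambda>z. op_log (M0 z)) has_derivative (\<lambda>h. h *\<^sub>C D)) (at z within S)"
      and z: "z \<in> S"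
    obtain D where "((\<lambda>z. op_log (M0 z)) has_derivative (\<lambda>h. h *\<^sub>C D)) (at z within S)"
      using hol z by blast
    from has_derivative_transform[OF z M this]
    show "\<exists>D. (M has_derivative (\<lambda>h. h *\<^sub>C D)) (at z within S)" by blast
  qed
  moreover have "complex_of_real ` I \<subseteq> V" using U(2) spec(1) by (auto simp: V_def)
  moreover have "\<forall>z\<in>S. M z \<in> bounded_ops" using M admis op_log_bounded_ops by metis
  ultimately have "reflection_continuation (nev_log N) I M"
    unfolding reflection_continuation_def S_def using Vopen
    by (intro conjI exI[of _ V]) (auto simp: M_def)
  then show thesis by (rule that)
qed

section \<open>Weak integrals against an operator density\<close>

lemma has_weak_integral_diff:
  "has_weak_integral F A \<Longrightarrow> has_weak_integral G B \<Longrightarrow> has_weak_integral (\<lambda>t. F t - G t) (A - B)"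
  unfolding has_weak_integral_def by (simp add: blinfun.diff_left cinner_simps has_bochner_integral_diff)

lemma has_weak_integral_scaleR:
  "has_weak_integral F A \<Longrightarrow> has_weak_integral (\<lambda>t. r *\<^sub>R F t) (r *\<^sub>R A)"
  unfolding has_weak_integral_def
  by (simp add: blinfun.scaleR_left cinner_simps has_bochner_integral_scaleR_right)

lemma norm_has_weak_integral_le:
  assumes A: "has_weak_integral F A" and G: "integrable lebesgue G"
    and bound: "\<And>x y. AE t in lebesgue. cmod (cinner (F t x) y) \<le> G t * (norm x * norm y)"
  shows "norm A \<le> \<bar>LINT t|lebesgue. G t\<bar>"
proof (rule norm_blinfun_le_cinner)
  fix x y
  have b: "has_bochner_integral lebesgue (\<lambda>t. cinner (F t x) y) (cinner (A x) y)"
    using A by (simp add: has_weak_integral_def)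
  have "cmod (cinner (A x) y) = cmod (LINT t|lebesgue. cinner (F t x) y)"
    using has_bochner_integral_integral_eq[OF b] by simp
  also have "\<dots> \<le> (LINT t|lebesgue. cmod (cinner (F t x) y))" by (rule integral_norm_bound)
  also have "\<dots> \<le> (LINT t|lebesgue. G t * (norm x * norm y))"
    by (rule integral_mono_AE) (use b G bound in \<open>auto simp: has_bochner_integral_iff\<close>)
  also have "\<dots> = (LINT t|lebesgue. G t) * (norm x * norm y)" by simp
  also have "\<dots> \<le> \<bar>LINT t|lebesgue. G t\<bar> * (norm x * norm y)" by (intro mult_right_mono) auto
  finally show "cmod (cinner (A x) y) \<le> \<bar>LINT t|lebesgue. G t\<bar> * norm x * norm y" by (simp add: mult.assoc)
qed simp

lemma weak_integral_exists:
  fixes F :: "real \<Rightarrow> 'a::chilbert_space \<Rightarrow>\<^sub>L 'a"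
  assumes F: "\<And>t. F t \<in> bounded_ops" "weakly_measurable F" and G: "integrable lebesgue G"
    and bound: "\<And>x y. AE t in lebesgue. cmod (cinner (F t x) y) \<le> G t * (norm x * norm y)"
  obtains A where "A \<in> bounded_ops" "has_weak_integral F A"
proof -
  have int: "integrable lebesgue (\<lambda>t. cinner (F t x) y)" for x y
  proof (rule Bochner_Integration.integrable_bound[OF integrable_mult_left[OF G]])
    show "(\<lambda>t. cinner (F t x) y) \<in> borel_measurable lebesgue" using F by (simp add: weakly_measurable_def)
    show "AE t in lebesgue. norm (cinner (F t x) y) \<le> norm (G t * (norm x * norm y))"
      using bound[of x y] by eventually_elim simp
  qed
  obtain A where A: "A \<in> bounded_ops" "\<And>x y. cinner (A x) y = (LINT t|lebesgue. cinner (F t x) y)"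
  proof (rule sesquilinear_representation[of "\<lambda>x y. LINT t|lebesgue. cinner (F t x) y" "LINT t|lebesgue. G t"])
    show "cmod (LINT t|lebesgue. cinner (F t x) y) \<le> (LINT t|lebesgue. G t) * norm x * norm y" for x y
    proof -
      have "cmod (LINT t|lebesgue. cinner (F t x) y) \<le> (LINT t|lebesgue. cmod (cinner (F t x) y))"
        by (rule integral_norm_bound)
      also have "\<dots> \<le> (LINT t|lebesgue. G t * (norm x * norm y))"
        by (rule integral_mono_AE) (use int G bound in auto)
      finally show ?thesis by (simp add: mult.assoc)
    qed
  qed (simp_all add: blinfun.add_right bounded_opsD[OF F(1)] cinner_simps int)
  then show thesis by (intro that) (auto simp: has_weak_integral_def has_bochner_integral_iff int)
qed

text \<open>Induction on \<open>m\<close>: passing to \<open>m + 1\<close> adds \<open>(m + 1) x\<^sup>2\<close> to the error and multiplies it by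
  \<open>1 / (1 - x)\<close>, which is at most \<open>2\<close>.\<close>

lemma inverse_power_taylor:
  "\<exists>C\<ge>0. \<forall>x::real. \<bar>x\<bar> \<le> 1/2 \<longrightarrow> \<bar>inverse ((1 - x) ^ m) - 1 - real m * x\<bar> \<le> C * x\<^sup>2"
proof (induction m)
  case 0 then show ?case by (intro exI[of _ 0]) simp
next
  case (Suc m)
  then obtain C where C: "C \<ge> 0" "\<And>x::real. \<bar>x\<bar> \<le> 1/2 \<Longrightarrow> \<bar>inverse ((1 - x) ^ m) - 1 - real m * x\<bar> \<le> C * x\<^sup>2"
    by blast
  show ?case
  proof (intro exI[of _ "2 * (C + real m + 1)"] conjI allI impI)
    fix x :: real assume x: "\<bar>x\<bar> \<le> 1/2"
    then have x1: "1 - x \<ge> 1/2" by (simp add: abs_le_iff)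
    define a where "a = inverse ((1 - x) ^ m)"
    have "inverse ((1 - x) ^ Suc m) - 1 - real (Suc m) * x
        = inverse (1 - x) * ((a - 1 - real m * x) + (real m + 1) * x\<^sup>2)"
      using x1 unfolding a_def by (simp add: field_simps power2_eq_square)
    then have "\<bar>inverse ((1 - x) ^ Suc m) - 1 - real (Suc m) * x\<bar>
        = inverse (1 - x) * \<bar>(a - 1 - real m * x) + (real m + 1) * x\<^sup>2\<bar>"
      using x1 by (simp add: abs_mult)
    also have "\<dots> \<le> 2 * (C * x\<^sup>2 + (real m + 1) * x\<^sup>2)"
    proof (rule mult_mono)
      show "inverse (1 - x) \<le> 2" using le_imp_inverse_le[OF x1] by simp
      have "\<bar>(a - 1 - real m * x) + (real m + 1) * x\<^sup>2\<bar> \<le> \<bar>a - 1 - real m * x\<bar> + \<bar>(real m + 1) * x\<^sup>2\<bar>"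
        by (rule abs_triangle_ineq)
      then show "\<bar>(a - 1 - real m * x) + (real m + 1) * x\<^sup>2\<bar> \<le> C * x\<^sup>2 + (real m + 1) * x\<^sup>2"
        using C(2)[OF x] by (simp add: a_def abs_mult)
    qed auto
    finally show "\<bar>inverse ((1 - x) ^ Suc m) - 1 - real (Suc m) * x\<bar> \<le> 2 * (C + real m + 1) * x\<^sup>2"
      by (simp add: algebra_simps)
  qed (use C in simp)
qed

text \<open>By homogeneity in \<open>s\<close> and \<open>h\<close> this is the preceding estimate at \<open>x = h / s\<close>.\<close>
lemma cauchy_kernel_taylor:
  "\<exists>C\<ge>0. \<forall>s h::real. s \<noteq> 0 \<longrightarrow> \<bar>h\<bar> \<le> \<bar>s\<bar> / 2 \<longrightarrow>
     \<bar>fact n / (s - h) ^ (n + 1) - fact n / s ^ (n + 1) - h * (fact (n + 1) / s ^ (n + 2))\<bar> \<le> C * h\<^sup>2 / \<bar>s\<bar> ^ (n + 3)"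
proof -
  obtain C where C: "C \<ge> 0" "\<And>x::real. \<bar>x\<bar> \<le> 1/2 \<Longrightarrow> \<bar>inverse ((1 - x) ^ (n + 1)) - 1 - real (n + 1) * x\<bar> \<le> C * x\<^sup>2"
    using inverse_power_taylor[of "n + 1"] by blast
  show ?thesis
  proof (intro exI[of _ "fact n * C"] conjI allI impI)
    fix s h :: real assume s: "s \<noteq> 0" and h: "\<bar>h\<bar> \<le> \<bar>s\<bar> / 2"
    define x where "x = h / s"
    have x: "\<bar>x\<bar> \<le> 1/2" using s h by (simp add: x_def abs_divide field_simps)
    have h_eq: "h = x * s" using s by (simp add: x_def)
    have sh: "s - h = s * (1 - x)" by (simp add: h_eq algebra_simps)
    have "fact n / (s - h) ^ (n + 1) - fact n / s ^ (n + 1) - h * (fact (n + 1) / s ^ (n + 2))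
        = fact n / s ^ (n + 1) * (inverse ((1 - x) ^ (n + 1)) - 1 - real (n + 1) * x)"
    proof -
      define a where "a = s ^ (n + 1)"
      define b where "b = (1 - x) ^ (n + 1)"
      have "s ^ (n + 2) = s * a" by (simp add: a_def)
      then have e1: "h * (fact (n + 1) / s ^ (n + 2)) = x * (fact (n + 1) / a)" using s by (simp add: h_eq)
      have e2: "(s - h) ^ (n + 1) = a * b" by (simp only: sh power_mult_distrib a_def b_def)
      show ?thesis unfolding e1 e2 a_def[symmetric] b_def[symmetric]
        by (simp add: divide_inverse algebra_simps)
    qed
    then have "\<bar>fact n / (s - h) ^ (n + 1) - fact n / s ^ (n + 1) - h * (fact (n + 1) / s ^ (n + 2))\<bar>
        = fact n / \<bar>s\<bar> ^ (n + 1) * \<bar>inverse ((1 - x) ^ (n + 1)) - 1 - real (n + 1) * x\<bar>"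
      by (simp add: abs_mult power_abs)
    also have "\<dots> \<le> fact n / \<bar>s\<bar> ^ (n + 1) * (C * x\<^sup>2)" by (intro mult_left_mono C(2)[OF x]) simp
    also have "x\<^sup>2 = h\<^sup>2 / \<bar>s\<bar>\<^sup>2" by (simp add: x_def power_divide)
    also have "fact n / \<bar>s\<bar> ^ (n + 1) * (C * (h\<^sup>2 / \<bar>s\<bar>\<^sup>2)) = fact n * C * h\<^sup>2 / \<bar>s\<bar> ^ (n + 3)"
      using s by (simp add: power_add power2_eq_square power3_eq_cube mult_ac)
    finally show "\<bar>fact n / (s - h) ^ (n + 1) - fact n / s ^ (n + 1) - h * (fact (n + 1) / s ^ (n + 2))\<bar>
        \<le> fact n * C * h\<^sup>2 / \<bar>s\<bar> ^ (n + 3)" .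
  qed (use C in simp)
qed

lemma poisson_kernel_lebesgue:
  fixes r t :: real
  assumes "r > 0" shows "integrable lebesgue (\<lambda>s. r / ((s - t)\<^sup>2 + r\<^sup>2))"
  using poisson_kernel_integral[OF assms, of t] by (subst integrable_completion) (auto simp: has_bochner_integral_iff)

text \<open>\<open>herglotz_kernel n \<zeta>\<close> is the \<open>n\<close>-th derivative in \<open>\<zeta>\<close> of \<open>1 / (t - \<zeta>) - t / (1 + t\<^sup>2)\<close>.\<close>

definition herglotz_kernel :: "nat \<Rightarrow> real \<Rightarrow> real \<Rightarrow> real" where
  "herglotz_kernel n \<zeta> t = fact n / (t - \<zeta>) ^ (n + 1) - (if n = 0 then t / (1 + t\<^sup>2) else 0)"

text \<open>Positivity includes symmetry on a complex space. The bound by the identity makes every integrable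
  weight weakly integrable against the density.\<close>
locale operator_density =
  fixes \<Xi> :: "real \<Rightarrow> 'a::chilbert_space \<Rightarrow>\<^sub>L 'a"
  assumes ops: "\<And>t. \<Xi> t \<in> bounded_ops" and meas: "weakly_measurable \<Xi>"
    and pos: "AE t in lebesgue. op_nonneg (\<Xi> t)"
    and le_id: "AE t in lebesgue. op_nonneg (id_blinfun - \<Xi> t)"
begin

lemma measurable_form [measurable]: "(\<lambda>t. cinner (\<Xi> t x) y) \<in> borel_measurable lebesgue"
  using meas by (simp add: weakly_measurable_def)

lemma measurable_diagonal [measurable]: "(\<lambda>t. Re (cinner (\<Xi> t x) x)) \<in> borel_measurable lebesgue"
  by measurable

lemma diagonal_le: "AE t in lebesgue. \<forall>x. Re (cinner (\<Xi> t x) x) \<le> (norm x)\<^sup>2"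
  using le_id
proof eventually_elim
  case (elim t)
  show ?case
  proof
    fix x show "Re (cinner (\<Xi> t x) x) \<le> (norm x)\<^sup>2"
      using op_nonnegD(1)[OF elim, of x]
      by (simp add: blinfun.diff_left cinner_simps cinner_self flip: of_real_power)
  qed
qed

lemma form_le: "AE t in lebesgue. \<forall>x y. cmod (cinner (\<Xi> t x) y) \<le> norm x * norm y"
  using pos diagonal_le
proof eventually_elim
  case (elim t)
  have "norm (\<Xi> t) \<le> 1" by (rule norm_positive_le[OF ops elim(1)]) (use elim(2) in auto)
  show ?case
  proof (intro allI)
    fix x y
    have "cmod (cinner (\<Xi> t x) y) \<le> norm (\<Xi> t) * norm x * norm y" by (rule cmod_cinner_blinfun_le)
    also have "\<dots> \<le> 1 * norm x * norm y" by (intro mult_right_mono) (use \<open>norm (\<Xi> t) \<le> 1\<close> in auto)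
    finally show "cmod (cinner (\<Xi> t x) y) \<le> norm x * norm y" by simp
  qed
qed

lemma weakly_measurable_scaleR:
  assumes [measurable]: "g \<in> borel_measurable lebesgue"
  shows "weakly_measurable (\<lambda>t. g t *\<^sub>R \<Xi> t)"
  unfolding weakly_measurable_def
proof (intro allI)
  fix x y
  have "(\<lambda>t. complex_of_real (g t) * cinner (\<Xi> t x) y) \<in> borel_measurable lebesgue" by measurable
  then show "(\<lambda>t. cinner ((g t *\<^sub>R \<Xi> t) x) y) \<in> borel_measurable lebesgue"
    by (simp add: blinfun.scaleR_left cinner_simps scaleR_conv_of_real)
qed

lemma diagonal_weak_integral:
  assumes A: "has_weak_integral (\<lambda>t. g t *\<^sub>R \<Xi> t) A"
  shows "has_bochner_integral lebesgue (\<lambda>t. g t * Re (cinner (\<Xi> t x) x)) (Re (cinner (A x) x))"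
proof -
  have "has_bochner_integral lebesgue (\<lambda>t. cinner ((g t *\<^sub>R \<Xi> t) x) x) (cinner (A x) x)"
    using A by (simp add: has_weak_integral_def)
  from has_bochner_integral_Re[OF this] show ?thesis
    by (simp add: blinfun.scaleR_left cinner_simps)
qed

lemma positive_weak_integral:
  assumes A: "has_weak_integral (\<lambda>t. g t *\<^sub>R \<Xi> t) A" and g: "\<And>t. g t \<ge> 0"
  shows "op_nonneg A"
  unfolding op_nonneg_def complex_nonneg_iff
proof (intro allI conjI)
  fix x
  have b: "has_bochner_integral lebesgue (\<lambda>t. cinner ((g t *\<^sub>R \<Xi> t) x) x) (cinner (A x) x)"
    using A by (simp add: has_weak_integral_def)
  have "has_bochner_integral lebesgue (\<lambda>t. Im (cinner ((g t *\<^sub>R \<Xi> t) x) x)) (Im (cinner (A x) x))"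
    by (rule has_bochner_integral_Im[OF b])
  then have "Im (cinner (A x) x) = (LINT t|lebesgue. Im (cinner ((g t *\<^sub>R \<Xi> t) x) x))"
    by (simp add: has_bochner_integral_iff)
  also have "\<dots> = 0"
  proof (rule integral_eq_zero_AE)
    show "AE t in lebesgue. Im (cinner ((g t *\<^sub>R \<Xi> t) x) x) = 0"
      using pos by eventually_elim (simp add: blinfun.scaleR_left cinner_simps op_nonnegD)
  qed
  finally show "Im (cinner (A x) x) = 0" .
  have "Re (cinner (A x) x) = (LINT t|lebesgue. g t * Re (cinner (\<Xi> t x) x))"
    using diagonal_weak_integral[OF A, of x] by (simp add: has_bochner_integral_iff)
  also have "\<dots> \<ge> 0"
  proof (rule integral_nonneg_AE)
    show "AE t in lebesgue. 0 \<le> g t * Re (cinner (\<Xi> t x) x)"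
      using pos by eventually_elim (simp add: g op_nonnegD)
  qed
  finally show "0 \<le> Re (cinner (A x) x)" .
qed

lemma measurable_etrace [measurable]:
  assumes B: "countable B"
  shows "(\<lambda>t. etrace B (\<Xi> t)) \<in> borel_measurable lebesgue"
proof -
  interpret sigma_finite_measure "count_space B" by (rule sigma_finite_measure_count_space_countable[OF B])
  have "(\<lambda>p. ennreal (Re (cinner (\<Xi> (snd p) (fst p)) (fst p)))) \<in> borel_measurable (count_space B \<Otimes>\<^sub>M lebesgue)"
    by (rule measurable_pair_measure_countable1[OF B]) (simp, measurable)
  then have "(\<lambda>(t, e). ennreal (Re (cinner (\<Xi> t e) e))) \<in> borel_measurable (lebesgue \<Otimes>\<^sub>M count_space B)"
    by (subst measurable_pair_swap_iff) (simp add: case_prod_beta)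
  then show ?thesis unfolding etrace_def by (rule borel_measurable_nn_integral)
qed

text \<open>Monotone convergence; both sides may be infinite.\<close>

lemma etrace_weak_integral:
  assumes A: "has_weak_integral (\<lambda>t. g t *\<^sub>R \<Xi> t) A" and g: "\<And>t. g t \<ge> 0"
    and [measurable]: "g \<in> borel_measurable lebesgue" and B: "countable B"
  shows "etrace B A = (\<integral>\<^sup>+t. ennreal (g t) * etrace B (\<Xi> t) \<partial>lebesgue)"
proof -
  have "etrace B A = (\<integral>\<^sup>+e. (\<integral>\<^sup>+t. ennreal (g t) * ennreal (Re (cinner (\<Xi> t e) e)) \<partial>lebesgue) \<partial>count_space B)"
    unfolding etrace_def
  proof (rule nn_integral_cong)
    fix e
    have b: "has_bochner_integral lebesgue (\<lambda>t. g t * Re (cinner (\<Xi> t e) e)) (Re (cinner (A e) e))"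
      by (rule diagonal_weak_integral[OF A])
    have ae: "AE t in lebesgue. 0 \<le> g t * Re (cinner (\<Xi> t e) e)"
      using pos by eventually_elim (simp add: g op_nonnegD)
    have "ennreal (Re (cinner (A e) e)) = (\<integral>\<^sup>+t. ennreal (g t * Re (cinner (\<Xi> t e) e)) \<partial>lebesgue)"
      using nn_integral_eq_integral[OF _ ae] b by (simp add: has_bochner_integral_iff)
    then show "ennreal (Re (cinner (A e) e)) = (\<integral>\<^sup>+t. ennreal (g t) * ennreal (Re (cinner (\<Xi> t e) e)) \<partial>lebesgue)"
      by (simp add: ennreal_mult' g)
  qed
  also have "\<dots> = (\<integral>\<^sup>+t. (\<integral>\<^sup>+e. ennreal (g t) * ennreal (Re (cinner (\<Xi> t e) e)) \<partial>count_space B) \<partial>lebesgue)"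
    by (rule nn_integral_count_space_nn_integral[symmetric, OF B]) measurable
  also have "\<dots> = (\<integral>\<^sup>+t. ennreal (g t) * etrace B (\<Xi> t) \<partial>lebesgue)"
    unfolding etrace_def by (intro nn_integral_cong nn_integral_cmult) simp
  finally show ?thesis .
qed

lemma poisson_diagonal:
  "AE t in lebesgue. ((\<lambda>\<epsilon>. LINT s|lebesgue. \<epsilon> / ((s - t)\<^sup>2 + \<epsilon>\<^sup>2) * Re (cinner (\<Xi> s x) x))
      \<longlongrightarrow> pi * Re (cinner (\<Xi> t x) x)) (at_right 0)"
proof (rule poisson_limit_AE)
  show "AE s in lebesgue. 0 \<le> Re (cinner (\<Xi> s x) x)" using pos by eventually_elim (rule op_nonnegD)
  have k: "(\<lambda>s::real. 1 / (1 + s\<^sup>2)) \<in> borel_measurable lebesgue"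
    by (rule measurable_completion) measurable
  show "integrable lebesgue (\<lambda>s. Re (cinner (\<Xi> s x) x) / (1 + s\<^sup>2))"
  proof (rule Bochner_Integration.integrable_bound)
    have "integrable lebesgue (\<lambda>s::real. 1 / (1 + s\<^sup>2))"
      using poisson_kernel_lebesgue[of 1 0] by (simp add: add.commute)
    then show "integrable lebesgue (\<lambda>s::real. (norm x)\<^sup>2 * (1 / (1 + s\<^sup>2)))"
      by (rule integrable_mult_right)
    have "(\<lambda>s. Re (cinner (\<Xi> s x) x) * (1 / (1 + s\<^sup>2))) \<in> borel_measurable lebesgue"
      by (intro borel_measurable_times k measurable_diagonal)
    then show "(\<lambda>s. Re (cinner (\<Xi> s x) x) / (1 + s\<^sup>2)) \<in> borel_measurable lebesgue" by simp
    show "AE s in lebesgue. norm (Re (cinner (\<Xi> s x) x) / (1 + s\<^sup>2)) \<le> norm ((norm x)\<^sup>2 * (1 / (1 + s\<^sup>2)))"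
      using pos diagonal_le
    proof eventually_elim
      case (elim s)
      have "0 < 1 + s\<^sup>2" by (simp add: add_pos_nonneg)
      then show ?case using elim op_nonnegD(1)[OF elim(1), of x]
        by (simp add: divide_right_mono less_imp_le)
    qed
  qed
qed measurable

end

text \<open>A density that vanishes near \<open>\<zeta>0\<close>: its Herglotz integral is smooth there, and may be
  differentiated under the integral sign in operator norm.\<close>

locale vanishing_density = operator_density +
  fixes \<zeta>0 r :: real
  assumes r: "r > 0" and vanish: "\<And>x. AE t in lebesgue. \<bar>t - \<zeta>0\<bar> < r \<longrightarrow> \<Xi> t x = 0"
begin

lemma scaled_form_le:
  assumes "\<And>t. \<bar>t - \<zeta>0\<bar> \<ge> r \<Longrightarrow> \<bar>g t\<bar> \<le> G t" and G: "\<And>t. G t \<ge> 0"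
  shows "AE t in lebesgue. cmod (cinner ((g t *\<^sub>R \<Xi> t) x) y) \<le> G t * (norm x * norm y)"
  using form_le vanish[of x]
proof eventually_elim
  case (elim t)
  show ?case
  proof (cases "\<bar>t - \<zeta>0\<bar> < r")
    case True
    then show ?thesis using elim G[of t] by (simp add: blinfun.scaleR_left)
  next
    case False
    then have "\<bar>g t\<bar> * cmod (cinner (\<Xi> t x) y) \<le> G t * (norm x * norm y)"
      using elim(1) assms by (intro mult_mono) auto
    then show ?thesis by (simp add: blinfun.scaleR_left cinner_simps)
  qed
qed

lemma inverse_power_le:
  assumes \<zeta>: "\<bar>\<zeta> - \<zeta>0\<bar> < r / 2" and t: "\<bar>t - \<zeta>0\<bar> \<ge> r"
  shows "\<bar>t - \<zeta>\<bar> \<ge> r / 2" "1 / \<bar>t - \<zeta>\<bar> ^ (n + 2) \<le> (2 / r) ^ n * (8 / r) * (r / ((t - \<zeta>0)\<^sup>2 + r\<^sup>2))"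
proof -
  have *: "\<bar>t - \<zeta>\<bar> \<ge> \<bar>t - \<zeta>0\<bar> / 2" "\<bar>t - \<zeta>0\<bar> / 2 \<ge> r / 2" using \<zeta> t by (auto simp: abs_if split: if_splits)
  then show "\<bar>t - \<zeta>\<bar> \<ge> r / 2" by linarith
  have "1 / \<bar>t - \<zeta>\<bar> ^ (n + 2) = (1 / \<bar>t - \<zeta>\<bar>) ^ n * (1 / \<bar>t - \<zeta>\<bar>\<^sup>2)" 
    by (simp only: power_add power_one_over) simp
  also have "\<dots> \<le> (1 / (r / 2)) ^ n * (1 / (\<bar>t - \<zeta>0\<bar> / 2)\<^sup>2)"
    using * r by (intro mult_mono power_mono divide_left_mono mult_pos_pos) (auto intro: zero_less_power)
  also have "\<dots> = (2 / r) ^ n * (4 / (t - \<zeta>0)\<^sup>2)" by (simp add: power_divide)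
  also have "\<dots> \<le> (2 / r) ^ n * (8 / ((t - \<zeta>0)\<^sup>2 + r\<^sup>2))"
  proof (rule mult_left_mono)
    have "r\<^sup>2 \<le> (t - \<zeta>0)\<^sup>2" using t r by (simp add: abs_le_square_iff[symmetric])
    moreover have "0 < r\<^sup>2" using r by simp
    ultimately have "8 / ((t - \<zeta>0)\<^sup>2 + (t - \<zeta>0)\<^sup>2) \<le> 8 / ((t - \<zeta>0)\<^sup>2 + r\<^sup>2)"
      by (intro divide_left_mono mult_pos_pos add_pos_pos) auto
    then show "4 / (t - \<zeta>0)\<^sup>2 \<le> 8 / ((t - \<zeta>0)\<^sup>2 + r\<^sup>2)" by simp
  qed (use r in simp)
  also have "\<dots> = (2 / r) ^ n * (8 / r) * (r / ((t - \<zeta>0)\<^sup>2 + r\<^sup>2))" using r by simp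
  finally show "1 / \<bar>t - \<zeta>\<bar> ^ (n + 2) \<le> (2 / r) ^ n * (8 / r) * (r / ((t - \<zeta>0)\<^sup>2 + r\<^sup>2))" .
qed

definition herglotz_op :: "nat \<Rightarrow> real \<Rightarrow> 'a \<Rightarrow>\<^sub>L 'a" where
  "herglotz_op n \<zeta> = (SOME A. A \<in> bounded_ops \<and> has_weak_integral (\<lambda>t. herglotz_kernel n \<zeta> t *\<^sub>R \<Xi> t) A)"

lemma herglotz_op:
  assumes \<zeta>: "\<bar>\<zeta> - \<zeta>0\<bar> < r / 2" and n: "n > 0"
  shows "herglotz_op n \<zeta> \<in> bounded_ops"
    "has_weak_integral (\<lambda>t. herglotz_kernel n \<zeta> t *\<^sub>R \<Xi> t) (herglotz_op n \<zeta>)"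
proof -
  obtain m where m: "n = Suc m" using n by (cases n) auto
  define G where "G t = fact n * ((2 / r) ^ m * (8 / r)) * (r / ((t - \<zeta>0)\<^sup>2 + r\<^sup>2))" for t
  have "\<exists>A. A \<in> bounded_ops \<and> has_weak_integral (\<lambda>t. herglotz_kernel n \<zeta> t *\<^sub>R \<Xi> t) A"
  proof (rule weak_integral_exists)
    show "herglotz_kernel n \<zeta> t *\<^sub>R \<Xi> t \<in> bounded_ops" for t by (intro bounded_ops_intros ops)
    have "herglotz_kernel n \<zeta> \<in> borel_measurable lebesgue"
      unfolding herglotz_kernel_def by (rule measurable_completion) measurable
    then show "weakly_measurable (\<lambda>t. herglotz_kernel n \<zeta> t *\<^sub>R \<Xi> t)" by (rule weakly_measurable_scaleR)
    show "integrable lebesgue G"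
      unfolding G_def by (intro integrable_mult_right poisson_kernel_lebesgue r)
    show "AE t in lebesgue. cmod (cinner ((herglotz_kernel n \<zeta> t *\<^sub>R \<Xi> t) x) y) \<le> G t * (norm x * norm y)" for x y
    proof (rule scaled_form_le)
      fix t assume "\<bar>t - \<zeta>0\<bar> \<ge> r"
      from inverse_power_le(2)[OF \<zeta> this, of m]
      have "fact n * (1 / \<bar>t - \<zeta>\<bar> ^ (m + 2)) \<le> fact n * ((2 / r) ^ m * (8 / r) * (r / ((t - \<zeta>0)\<^sup>2 + r\<^sup>2)))"
        by (rule mult_left_mono) simp
      then show "\<bar>herglotz_kernel n \<zeta> t\<bar> \<le> G t"
        unfolding herglotz_kernel_def G_def using r by (simp add: m power_abs abs_mult mult.assoc)
    qed (use r in \<open>simp add: G_def\<close>)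
  qed blast
  from someI_ex[OF this] show "herglotz_op n \<zeta> \<in> bounded_ops"
    "has_weak_integral (\<lambda>t. herglotz_kernel n \<zeta> t *\<^sub>R \<Xi> t) (herglotz_op n \<zeta>)"
    by (simp_all add: herglotz_op_def)
qed

text \<open>The Taylor remainder of the kernel is \<open>O(h\<^sup>2)\<close> in the mean, uniformly for \<open>\<zeta>\<close> near \<open>\<zeta>0\<close>, and the norm of a weak
  integral is at most the integral of the absolute value of the weight. The represented
  family \<open>E\<close> is arbitrary, so that \<open>n = 0\<close> covers a function given by its Herglotz representation.\<close>
lemma weak_integral_has_derivative:
  assumes E: "\<And>\<zeta>. \<bar>\<zeta> - \<zeta>0\<bar> < r / 2 \<Longrightarrow> has_weak_integral (\<lambda>t. herglotz_kernel n \<zeta> t *\<^sub>R \<Xi> t) (E \<zeta>)"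
    and \<zeta>: "\<bar>\<zeta> - \<zeta>0\<bar> < r / 2"
  shows "(E has_vector_derivative herglotz_op (Suc n) \<zeta>) (at \<zeta>)"
proof -
  obtain C where C: "C \<ge> 0" "\<And>s h::real. s \<noteq> 0 \<Longrightarrow> \<bar>h\<bar> \<le> \<bar>s\<bar> / 2 \<Longrightarrow>
     \<bar>fact n / (s - h) ^ (n + 1) - fact n / s ^ (n + 1) - h * (fact (n + 1) / s ^ (n + 2))\<bar> \<le> C * h\<^sup>2 / \<bar>s\<bar> ^ (n + 3)"
    using cauchy_kernel_taylor[of n] by blast
  define K where "K = C * ((2 / r) ^ (n + 1) * (8 / r))"
  define p where "p t = r / ((t - \<zeta>0)\<^sup>2 + r\<^sup>2)" for t
  have K: "K \<ge> 0" using C r by (simp add: K_def)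
  have p0: "p t \<ge> 0" for t using r by (simp add: p_def)
  define I where "I = \<bar>LINT t|lebesgue. p t\<bar>"
  have key: "norm (E \<eta> - E \<zeta> - (\<eta> - \<zeta>) *\<^sub>R herglotz_op (Suc n) \<zeta>) \<le> (\<eta> - \<zeta>)\<^sup>2 * (K * I)"
    if \<eta>: "\<bar>\<eta> - \<zeta>0\<bar> < r / 2" "\<bar>\<eta> - \<zeta>\<bar> \<le> r / 4" for \<eta>
  proof -
    define g where "g t = herglotz_kernel n \<eta> t - herglotz_kernel n \<zeta> t - (\<eta> - \<zeta>) * herglotz_kernel (Suc n) \<zeta> t" for t
    have "has_weak_integral (\<lambda>t. herglotz_kernel n \<eta> t *\<^sub>R \<Xi> t - herglotz_kernel n \<zeta> t *\<^sub>R \<Xi> t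
        - (\<eta> - \<zeta>) *\<^sub>R (herglotz_kernel (Suc n) \<zeta> t *\<^sub>R \<Xi> t)) (E \<eta> - E \<zeta> - (\<eta> - \<zeta>) *\<^sub>R herglotz_op (Suc n) \<zeta>)"
      by (intro has_weak_integral_diff has_weak_integral_scaleR E herglotz_op \<eta> \<zeta>) simp
    then have w: "has_weak_integral (\<lambda>t. g t *\<^sub>R \<Xi> t) (E \<eta> - E \<zeta> - (\<eta> - \<zeta>) *\<^sub>R herglotz_op (Suc n) \<zeta>)"
      by (simp add: g_def scaleR_diff_left)
    have "norm (E \<eta> - E \<zeta> - (\<eta> - \<zeta>) *\<^sub>R herglotz_op (Suc n) \<zeta>) \<le> \<bar>LINT t|lebesgue. (\<eta> - \<zeta>)\<^sup>2 * K * p t\<bar>"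
    proof (rule norm_has_weak_integral_le[OF w])
      show "integrable lebesgue (\<lambda>t. (\<eta> - \<zeta>)\<^sup>2 * K * p t)"
        unfolding p_def by (intro integrable_mult_right poisson_kernel_lebesgue r)
      show "AE t in lebesgue. cmod (cinner ((g t *\<^sub>R \<Xi> t) x) y) \<le> (\<eta> - \<zeta>)\<^sup>2 * K * p t * (norm x * norm y)" for x y
      proof (rule scaled_form_le)
        fix t assume t: "\<bar>t - \<zeta>0\<bar> \<ge> r"
        have s: "\<bar>t - \<zeta>\<bar> \<ge> r / 2" by (rule inverse_power_le(1)[OF \<zeta> t])
        have "\<bar>g t\<bar> = \<bar>fact n / ((t - \<zeta>) - (\<eta> - \<zeta>)) ^ (n + 1) - fact n / (t - \<zeta>) ^ (n + 1)
            - (\<eta> - \<zeta>) * (fact (n + 1) / (t - \<zeta>) ^ (n + 2))\<bar>"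
          by (simp add: g_def herglotz_kernel_def)
        also have "\<dots> \<le> C * (\<eta> - \<zeta>)\<^sup>2 / \<bar>t - \<zeta>\<bar> ^ (n + 3)"
          by (rule C(2)) (use s r \<eta> in auto)
        also have "\<dots> = (C * (\<eta> - \<zeta>)\<^sup>2) * (1 / \<bar>t - \<zeta>\<bar> ^ ((n + 1) + 2))" by (simp add: numeral_3_eq_3)
        also have "\<dots> \<le> (C * (\<eta> - \<zeta>)\<^sup>2) * ((2 / r) ^ (n + 1) * (8 / r) * p t)"
          unfolding p_def by (intro mult_left_mono inverse_power_le(2)[OF \<zeta> t]) (use C in simp)
        finally show "\<bar>g t\<bar> \<le> (\<eta> - \<zeta>)\<^sup>2 * K * p t" by (simp add: K_def mult_ac)
      qed (use K p0 in simp)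
    qed
    also have "\<dots> = (\<eta> - \<zeta>)\<^sup>2 * (K * I)" using K by (simp add: I_def abs_mult)
    finally show ?thesis .
  qed
  show ?thesis
    unfolding has_vector_derivative_def has_derivative_within_alt
  proof (intro conjI allI impI bounded_linear_scaleR_left)
    fix e :: real assume e: "e > 0"
    have KI: "K * I \<ge> 0" using K by (simp add: I_def)
    define d where "d = min (min (r / 4) (r / 2 - \<bar>\<zeta> - \<zeta>0\<bar>)) (e / (K * I + 1))"
    have d: "d > 0" using r \<zeta> e KI by (simp add: d_def)
    show "\<exists>d>0. \<forall>\<eta>\<in>UNIV. norm (\<eta> - \<zeta>) < d \<longrightarrow>
        norm (E \<eta> - E \<zeta> - (\<eta> - \<zeta>) *\<^sub>R herglotz_op (Suc n) \<zeta>) \<le> e * norm (\<eta> - \<zeta>)"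
    proof (intro exI[of _ d] conjI ballI impI d)
      fix \<eta> assume \<eta>: "norm (\<eta> - \<zeta>) < d"
      then have "\<bar>\<eta> - \<zeta>\<bar> < r / 2 - \<bar>\<zeta> - \<zeta>0\<bar>" "\<bar>\<eta> - \<zeta>\<bar> \<le> r / 4" "\<bar>\<eta> - \<zeta>\<bar> \<le> e / (K * I + 1)"
        by (auto simp: d_def)
      moreover have "\<bar>\<eta> - \<zeta>0\<bar> \<le> \<bar>\<eta> - \<zeta>\<bar> + \<bar>\<zeta> - \<zeta>0\<bar>" by arith
      ultimately have 1: "\<bar>\<eta> - \<zeta>0\<bar> < r / 2" "\<bar>\<eta> - \<zeta>\<bar> \<le> r / 4" "\<bar>\<eta> - \<zeta>\<bar> * (K * I + 1) \<le> e"
        using KI by (auto simp: field_simps)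
      have "norm (E \<eta> - E \<zeta> - (\<eta> - \<zeta>) *\<^sub>R herglotz_op (Suc n) \<zeta>) \<le> (\<eta> - \<zeta>)\<^sup>2 * (K * I)"
        by (rule key[OF 1(1,2)])
      also have "\<dots> = (\<bar>\<eta> - \<zeta>\<bar> * (K * I)) * \<bar>\<eta> - \<zeta>\<bar>" by (simp add: power2_eq_square mult_ac flip: abs_mult)
      also have "\<dots> \<le> e * \<bar>\<eta> - \<zeta>\<bar>"
        using 1(3) by (intro mult_right_mono) (auto simp: distrib_left)
      finally show "norm (E \<eta> - E \<zeta> - (\<eta> - \<zeta>) *\<^sub>R herglotz_op (Suc n) \<zeta>) \<le> e * norm (\<eta> - \<zeta>)" by simp
    qed
  qed
qed

lemma nth_vector_derivative_herglotz:
  assumes L: "\<And>\<zeta>. \<bar>\<zeta> - \<zeta>0\<bar> < r / 2 \<Longrightarrow> has_weak_integral (\<lambda>t. herglotz_kernel 0 \<zeta> t *\<^sub>R \<Xi> t) (L \<zeta> - D)"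
    and \<zeta>: "\<bar>\<zeta> - \<zeta>0\<bar> < r / 2"
  shows "nth_vector_derivative (Suc n) L \<zeta> = herglotz_op (Suc n) \<zeta>"
  using \<zeta>
proof (induction n arbitrary: \<zeta>)
  case 0
  have "((\<lambda>\<zeta>. L \<zeta> - D) has_vector_derivative herglotz_op (Suc 0) \<zeta>) (at \<zeta>)"
    by (rule weak_integral_has_derivative[OF L 0])
  then have "((\<lambda>\<zeta>. (L \<zeta> - D) + D) has_vector_derivative herglotz_op (Suc 0) \<zeta> + 0) (at \<zeta>)"
    by (intro has_vector_derivative_add has_vector_derivative_const)
  then have "(L has_vector_derivative herglotz_op (Suc 0) \<zeta>) (at \<zeta>)" by simp
  then show ?case by (simp add: nth_vector_derivative_def vector_derivative_at)
next
  case (Suc n)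
  have "(herglotz_op (Suc n) has_vector_derivative herglotz_op (Suc (Suc n)) \<zeta>) (at \<zeta>)"
    by (rule weak_integral_has_derivative[OF herglotz_op(2) Suc.prems]) simp_all
  moreover have "open (ball \<zeta>0 (r / 2))" "\<zeta> \<in> ball \<zeta>0 (r / 2)"
    using Suc.prems by (auto simp: dist_real_def abs_minus_commute)
  ultimately have "(nth_vector_derivative (Suc n) L has_vector_derivative herglotz_op (Suc (Suc n)) \<zeta>) (at \<zeta>)"
  proof (rule has_vector_derivative_transform_within_open)
    fix \<eta> assume "\<eta> \<in> ball \<zeta>0 (r / 2)"
    then show "herglotz_op (Suc n) \<eta> = nth_vector_derivative (Suc n) L \<eta>"
      using Suc.IH[of \<eta>] by (simp add: dist_real_def abs_minus_commute)
  qed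
  then show ?case by (simp add: nth_vector_derivative_def vector_derivative_at)
qed

end

section \<open>Traces of the spectral shift operators\<close>

lemma Im_cauchy_kernel:
  assumes "Im z \<noteq> 0"
  shows "Im (1 / (complex_of_real t - z) - complex_of_real q) = Im z / ((t - Re z)\<^sup>2 + (Im z)\<^sup>2)"
  using assms by (simp add: Im_divide power2_eq_square)

text \<open>A symmetric Herglotz representation of \<open>L\<close> off the real line; \<open>M\<close> stands for the extension of \<open>L\<close>
  to the interval \<open>I\<close>, where it is symmetric and has the same representation.\<close>

locale herglotz_representation = operator_density +
  fixes L M :: "complex \<Rightarrow> 'a::chilbert_space \<Rightarrow>\<^sub>L 'a" and C :: "'a \<Rightarrow>\<^sub>L 'a" and I :: "real set"
  assumes I: "open I"
    and L_ops: "\<And>z. Im z > 0 \<Longrightarrow> L z \<in> bounded_ops"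
    and C_sym: "C \<in> bounded_ops" "op_adj C = C"
    and rep: "\<And>z. Im z > 0 \<Longrightarrow> has_weak_integral
             (\<lambda>t. (1 / (complex_of_real t - z) - complex_of_real (t / (1 + t\<^sup>2))) *\<^sub>C \<Xi> t) (L z - C)"
    and rep_I: "\<And>\<zeta>. \<zeta> \<in> I \<Longrightarrow> has_weak_integral
             (\<lambda>t. (1 / (complex_of_real t - complex_of_real \<zeta>) - complex_of_real (t / (1 + t\<^sup>2))) *\<^sub>C \<Xi> t)
             (M (complex_of_real \<zeta>) - C)"
    and boundary: "\<And>\<zeta>. \<zeta> \<in> I \<Longrightarrow> ((\<lambda>\<epsilon>. L (Complex \<zeta> \<epsilon>)) \<longlongrightarrow> M (complex_of_real \<zeta>)) (at_right 0)"
    and M_sym: "\<And>\<zeta> x. \<zeta> \<in> I \<Longrightarrow> Im (cinner (M (complex_of_real \<zeta>) x) x) = 0"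
begin

lemma op_Im_bounded_ops: "Im z > 0 \<Longrightarrow> op_Im (L z) \<in> bounded_ops"
  unfolding op_Im_def by (intro bounded_ops_intros op_adj_in_bounded_ops L_ops)

lemma measurable_kernel [measurable]: "(\<lambda>t::real. b / ((t - a)\<^sup>2 + b\<^sup>2)) \<in> borel_measurable lebesgue"
  by (rule measurable_completion) measurable

text \<open>Taking imaginary parts removes the symmetric operator \<open>C\<close> and turns the Herglotz kernel into the
  Poisson kernel.\<close>
lemma op_Im_weak_integral:
  assumes z: "Im z > 0"
  shows "has_weak_integral (\<lambda>t. (Im z / ((t - Re z)\<^sup>2 + (Im z)\<^sup>2)) *\<^sub>R \<Xi> t) (op_Im (L z))"
  unfolding has_weak_integral_def
proof (intro allI)
  fix x y
  define k where "k t = 1 / (complex_of_real t - z) - complex_of_real (t / (1 + t\<^sup>2))" for t :: real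
  have b: "has_bochner_integral lebesgue (\<lambda>t. k t * cinner (\<Xi> t x) y) (cinner ((L z - C) x) y)" for x y
    using rep[OF z] unfolding has_weak_integral_def k_def by (simp add: cinner_simps)
  have "has_bochner_integral lebesgue (\<lambda>t. cnj (k t * cinner (\<Xi> t y) x)) (cnj (cinner ((L z - C) y) x))"
    by (rule has_bochner_integral_cnj[OF b])
  from has_bochner_integral_mult_right[OF has_bochner_integral_diff[OF b[of x y] this], of "1 / (2 * \<i>)"]
  have d: "has_bochner_integral lebesgue (\<lambda>t. 1 / (2 * \<i>) * (k t * cinner (\<Xi> t x) y - cnj (k t * cinner (\<Xi> t y) x)))
     (1 / (2 * \<i>) * (cinner ((L z - C) x) y - cnj (cinner ((L z - C) y) x)))" by simp
  have "cinner (C x) y = cnj (cinner (C y) x)"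
    using cinner_op_adj[OF C_sym(1), of x y] C_sym(2) cinner_commute[of x "C y"] by simp
  then have eq: "1 / (2 * \<i>) * (cinner ((L z - C) x) y - cnj (cinner ((L z - C) y) x)) = cinner (op_Im (L z) x) y"
    unfolding cinner_op_Im[OF L_ops[OF z]] by (simp add: blinfun.diff_left cinner_simps)
  have int: "(\<lambda>t. cinner (((Im z / ((t - Re z)\<^sup>2 + (Im z)\<^sup>2)) *\<^sub>R \<Xi> t) x) y) \<in> borel_measurable lebesgue"
    using weakly_measurable_scaleR[OF measurable_kernel] by (simp add: weakly_measurable_def)
  have "AE t in lebesgue. 1 / (2 * \<i>) * (k t * cinner (\<Xi> t x) y - cnj (k t * cinner (\<Xi> t y) x))
      = cinner (((Im z / ((t - Re z)\<^sup>2 + (Im z)\<^sup>2)) *\<^sub>R \<Xi> t) x) y"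
    using pos
  proof eventually_elim
    case (elim t)
    have "cnj (cinner (\<Xi> t y) x) = cinner (\<Xi> t x) y"
      using op_nonneg_symmetric'[OF ops elim, of x y] cinner_commute[of x "\<Xi> t y"] by simp
    then have "1 / (2 * \<i>) * (k t * cinner (\<Xi> t x) y - cnj (k t * cinner (\<Xi> t y) x))
        = (k t - cnj (k t)) / (2 * \<i>) * cinner (\<Xi> t x) y" by (simp add: left_diff_distrib)
    also have "(k t - cnj (k t)) / (2 * \<i>) = complex_of_real (Im (k t))"
      by (simp add: complex_eq_iff Re_divide Im_divide power2_eq_square)
    also have "Im (k t) = Im z / ((t - Re z)\<^sup>2 + (Im z)\<^sup>2)"
      unfolding k_def by (rule Im_cauchy_kernel) (use z in simp)
    finally show ?case by (simp add: blinfun.scaleR_left cinner_simps scaleR_conv_of_real)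
  qed
  then have "has_bochner_integral lebesgue (\<lambda>t. cinner (((Im z / ((t - Re z)\<^sup>2 + (Im z)\<^sup>2)) *\<^sub>R \<Xi> t) x) y)
      (1 / (2 * \<i>) * (cinner ((L z - C) x) y - cnj (cinner ((L z - C) y) x)))"
    using d int by (subst has_bochner_integral_cong_AE[symmetric]) (auto simp: has_bochner_integral_iff)
  then show "has_bochner_integral lebesgue (\<lambda>t. cinner (((Im z / ((t - Re z)\<^sup>2 + (Im z)\<^sup>2)) *\<^sub>R \<Xi> t) x) y)
      (cinner (op_Im (L z) x) y)" by (simp only: eq)
qed

lemma op_Im_nonneg: "Im z > 0 \<Longrightarrow> op_nonneg (op_Im (L z))"
  by (rule positive_weak_integral[OF op_Im_weak_integral]) auto

lemma op_Im_diagonal: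
  assumes "\<epsilon> > 0"
  shows "Re (cinner (op_Im (L (Complex t \<epsilon>)) x) x) = (LINT s|lebesgue. \<epsilon> / ((s - t)\<^sup>2 + \<epsilon>\<^sup>2) * Re (cinner (\<Xi> s x) x))"
  using diagonal_weak_integral[OF op_Im_weak_integral, of "Complex t \<epsilon>" x] assms
  by (simp add: has_bochner_integral_iff)

lemma op_Im_diagonal_limit:
  "AE t in lebesgue. ((\<lambda>\<epsilon>. cinner (op_Im (L (Complex t \<epsilon>)) x) x) \<longlongrightarrow> cinner ((pi *\<^sub>R \<Xi> t) x) x) (at_right 0)"
  using poisson_diagonal[of x] pos
proof eventually_elim
  case (elim t)
  have lim: "((\<lambda>\<epsilon>. complex_of_real (LINT s|lebesgue. \<epsilon> / ((s - t)\<^sup>2 + \<epsilon>\<^sup>2) * Re (cinner (\<Xi> s x) x)))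
      \<longlongrightarrow> complex_of_real (pi * Re (cinner (\<Xi> t x) x))) (at_right 0)"
    by (intro tendsto_of_real elim)
  have ev: "\<forall>\<^sub>F \<epsilon> in at_right 0. complex_of_real (LINT s|lebesgue. \<epsilon> / ((s - t)\<^sup>2 + \<epsilon>\<^sup>2) * Re (cinner (\<Xi> s x) x))
      = cinner (op_Im (L (Complex t \<epsilon>)) x) x"
    unfolding eventually_at_filter
  proof (rule always_eventually, intro allI impI)
    fix \<epsilon> :: real assume "\<epsilon> \<in> {0<..}"
    then have \<epsilon>: "\<epsilon> > 0" by simp
    show "complex_of_real (LINT s|lebesgue. \<epsilon> / ((s - t)\<^sup>2 + \<epsilon>\<^sup>2) * Re (cinner (\<Xi> s x) x))
      = cinner (op_Im (L (Complex t \<epsilon>)) x) x"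
      unfolding op_Im_diagonal[OF \<epsilon>, symmetric]
      by (rule op_nonneg_cinner[OF op_Im_nonneg, symmetric]) (simp add: \<epsilon>)
  qed
  have eq: "complex_of_real (pi * Re (cinner (\<Xi> t x) x)) = cinner ((pi *\<^sub>R \<Xi> t) x) x"
    using op_nonneg_cinner[OF elim(2), of x]
    by (simp add: blinfun.scaleR_left cinner_simps scaleR_conv_of_real)
  show ?case using Lim_transform_eventually[OF lim ev] unfolding eq .
qed

text \<open>On \<open>I\<close> the boundary value of \<open>L\<close> is symmetric, so that its imaginary part \<open>\<pi> \<Xi>\<close> vanishes.\<close>

lemma density_vanishes_on_I: "AE t in lebesgue. t \<in> I \<longrightarrow> \<Xi> t x = 0"
  using op_Im_diagonal_limit[of x] pos
proof eventually_elim
  case (elim t)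
  show ?case
  proof
    assume t: "t \<in> I"
    have "((\<lambda>\<epsilon>. Im (cinner (L (Complex t \<epsilon>) x) x)) \<longlongrightarrow> Im (cinner (M (complex_of_real t) x) x)) (at_right 0)"
      by (intro tendsto_Im cinner.tendsto blinfun.tendsto boundary t tendsto_const)
    moreover have "\<forall>\<^sub>F \<epsilon> in at_right 0. Im (cinner (L (Complex t \<epsilon>) x) x) = Re (cinner (op_Im (L (Complex t \<epsilon>)) x) x)"
      unfolding eventually_at_filter by (rule always_eventually) (simp add: Re_cinner_op_Im L_ops)
    ultimately have "((\<lambda>\<epsilon>. Re (cinner (op_Im (L (Complex t \<epsilon>)) x) x)) \<longlongrightarrow> 0) (at_right 0)"
      unfolding M_sym[OF t] by (rule Lim_transform_eventually)
    moreover have "((\<lambda>\<epsilon>. Re (cinner (op_Im (L (Complex t \<epsilon>)) x) x)) \<longlongrightarrow> Re (cinner ((pi *\<^sub>R \<Xi> t) x) x)) (at_right 0)"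
      by (intro tendsto_Re elim)
    ultimately have "Re (cinner ((pi *\<^sub>R \<Xi> t) x) x) = 0"
      using tendsto_unique trivial_limit_at_right_real by blast
    then show "\<Xi> t x = 0"
      by (intro positive_kernel[OF ops elim(2)]) (simp add: blinfun.scaleR_left cinner_simps)
  qed
qed

text \<open>Odd derivatives of \<open>L\<close> at a point of \<open>I\<close> are integrals of \<open>\<Xi>\<close> against a positive kernel. They are
  therefore positive, and by monotone convergence a finite trace of the derivative is a finite
  integral of the traces.\<close>

lemma weighted_trace_finite:
  assumes sep: "separable_space (euclidean :: 'a topology)" and B: "is_onb B" and \<zeta>: "\<zeta> \<in> I"
    and tc: "trace_class (nth_vector_derivative (2 * k + 1) (\<lambda>t. M (complex_of_real t)) \<zeta>)"
  shows "(\<integral>\<^sup>+t. ennreal (1 / (t - \<zeta>) ^ (2 * k + 2)) * etrace B (\<Xi> t) \<partial>lebesgue) < \<infinity>"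
proof -
  obtain r where r_pos: "r > 0" and rI: "ball \<zeta> r \<subseteq> I" using I \<zeta> by (meson openE)
  interpret vanishing_density \<Xi> \<zeta> r
  proof
    show "AE t in lebesgue. \<bar>t - \<zeta>\<bar> < r \<longrightarrow> \<Xi> t x = 0" for x
      using density_vanishes_on_I[of x]
      by eventually_elim (use rI in \<open>auto simp: dist_real_def abs_minus_commute subset_iff\<close>)
  qed (rule r_pos)
  have L: "has_weak_integral (\<lambda>t. herglotz_kernel 0 \<eta> t *\<^sub>R \<Xi> t) (M (complex_of_real \<eta>) - C)"
    if "\<bar>\<eta> - \<zeta>\<bar> < r / 2" for \<eta>
  proof -
    have "\<eta> \<in> ball \<zeta> r" using that r_pos by (simp add: dist_real_def abs_minus_commute)
    then have \<eta>: "\<eta> \<in> I" using rI by blast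
    have "(1 / (complex_of_real t - complex_of_real \<eta>) - complex_of_real (t / (1 + t\<^sup>2))) *\<^sub>C \<Xi> t
        = herglotz_kernel 0 \<eta> t *\<^sub>R \<Xi> t" for t
    proof -
      have "1 / (complex_of_real t - complex_of_real \<eta>) - complex_of_real (t / (1 + t\<^sup>2))
          = complex_of_real (herglotz_kernel 0 \<eta> t)" by (simp add: herglotz_kernel_def)
      then show ?thesis by (simp only: scaleC_of_real)
    qed
    then show ?thesis using rep_I[OF \<eta>] by simp
  qed
  have \<zeta>r: "\<bar>\<zeta> - \<zeta>\<bar> < r / 2" using r_pos by simp
  let ?T = "herglotz_op (Suc (2 * k)) \<zeta>"
  have T: "?T \<in> bounded_ops" "has_weak_integral (\<lambda>t. herglotz_kernel (Suc (2 * k)) \<zeta> t *\<^sub>R \<Xi> t) ?T"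
    using herglotz_op[OF \<zeta>r, of "Suc (2 * k)"] by simp_all
  have ker: "herglotz_kernel (Suc (2 * k)) \<zeta> t = fact (Suc (2 * k)) * (1 / (t - \<zeta>) ^ (2 * k + 2))" for t
    by (simp add: herglotz_kernel_def)
  have even: "(t - \<zeta>) ^ (2 * k + 2) \<ge> 0" for t
  proof -
    have "even (2 * k + 2)" by simp
    then show ?thesis by (rule zero_le_even_power)
  qed
  have kernn: "herglotz_kernel (Suc (2 * k)) \<zeta> t \<ge> 0" for t
    unfolding ker using even[of t] by (intro mult_nonneg_nonneg divide_nonneg_nonneg) auto
  have km: "herglotz_kernel (Suc (2 * k)) \<zeta> \<in> borel_measurable lebesgue"
    unfolding herglotz_kernel_def by (rule measurable_completion) measurable
  have "trace_class ?T"
    using tc nth_vector_derivative_herglotz[OF L \<zeta>r, of "2 * k"] by simp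
  then have "etrace B ?T < \<infinity>"
    by (rule trace_class_positiveD[OF T(1) positive_weak_integral[OF T(2) kernn] _ sep B])
  then have fin: "(\<integral>\<^sup>+t. ennreal (herglotz_kernel (Suc (2 * k)) \<zeta> t) * etrace B (\<Xi> t) \<partial>lebesgue) < \<infinity>"
    unfolding etrace_weak_integral[OF T(2) kernn km countable_onb[OF sep B]] .
  have "(\<integral>\<^sup>+t. ennreal (1 / (t - \<zeta>) ^ (2 * k + 2)) * etrace B (\<Xi> t) \<partial>lebesgue)
      \<le> (\<integral>\<^sup>+t. ennreal (herglotz_kernel (Suc (2 * k)) \<zeta> t) * etrace B (\<Xi> t) \<partial>lebesgue)"
  proof (intro nn_integral_mono mult_right_mono ennreal_leI)
    fix t
    have "1 * (1 / (t - \<zeta>) ^ (2 * k + 2)) \<le> fact (Suc (2 * k)) * (1 / (t - \<zeta>) ^ (2 * k + 2))"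
      using even[of t] by (intro mult_right_mono fact_ge_1 divide_nonneg_nonneg) auto
    then show "1 / (t - \<zeta>) ^ (2 * k + 2) \<le> herglotz_kernel (Suc (2 * k)) \<zeta> t" unfolding ker by simp
  qed simp
  then show ?thesis using fin by (rule le_less_trans)
qed

lemma AE_neq: "AE t in lebesgue. t \<noteq> (a::real)"
  by (rule AE_completion) (rule AE_lborel_singleton)

lemma trace_finite_AE:
  assumes sep: "separable_space (euclidean :: 'a topology)" and B: "is_onb B"
    and fin: "(\<integral>\<^sup>+t. ennreal (1 / (t - \<zeta>) ^ (2 * k + 2)) * etrace B (\<Xi> t) \<partial>lebesgue) < \<infinity>"
  shows "AE t in lebesgue. etrace B (\<Xi> t) < \<infinity>"
proof -
  have [measurable]: "(\<lambda>t. etrace B (\<Xi> t)) \<in> borel_measurable lebesgue"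
    by (rule measurable_etrace[OF countable_onb[OF sep B]])
  have [measurable]: "(\<lambda>t::real. 1 / (t - \<zeta>) ^ (2 * k + 2)) \<in> borel_measurable lebesgue"
    by (rule measurable_completion) measurable
  have "AE t in lebesgue. ennreal (1 / (t - \<zeta>) ^ (2 * k + 2)) * etrace B (\<Xi> t) \<noteq> \<infinity>"
  proof (rule nn_integral_PInf_AE)
    show "(\<lambda>t. ennreal (1 / (t - \<zeta>) ^ (2 * k + 2)) * etrace B (\<Xi> t)) \<in> borel_measurable lebesgue" by measurable
  qed (use fin in simp)
  then show ?thesis using AE_neq[of \<zeta>]
  proof eventually_elim
    case (elim t)
    have "even (2 * k + 2)" by simp
    then have "(t - \<zeta>) ^ (2 * k + 2) > 0" using elim(2) by (subst zero_less_power_eq) auto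
    then have "ennreal (1 / (t - \<zeta>) ^ (2 * k + 2)) > 0" by (simp add: ennreal_less_zero_iff)
    then show ?case using elim(1) by (auto simp: ennreal_mult_eq_top_iff less_top)
  qed
qed

lemma diagonal_limits_trace:
  fixes J :: "nat set"
  assumes sep: "separable_space (euclidean :: 'a topology)" and B: "is_onb (B :: 'a set)"
    and fin: "AE t in lebesgue. etrace B (\<Xi> t) < \<infinity>"
    and \<phi>: "inj_on \<phi> J" "is_onb (\<phi> ` J)"
  shows "AE t in lebesgue. \<exists>l. (\<forall>j\<in>J. ((\<lambda>\<epsilon>. complex_of_real (1 / pi) * cinner (op_Im (L (Complex t \<epsilon>)) (\<phi> j)) (\<phi> j)) \<longlongrightarrow> l j)
              (at_right 0)) \<and> (l has_sum op_trace (\<Xi> t)) J"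
proof -
  have "AE t in lebesgue. \<forall>j\<in>J. ((\<lambda>\<epsilon>. cinner (op_Im (L (Complex t \<epsilon>)) (\<phi> j)) (\<phi> j)) \<longlongrightarrow> cinner ((pi *\<^sub>R \<Xi> t) (\<phi> j)) (\<phi> j)) (at_right 0)"
    by (subst AE_ball_countable) (auto intro: op_Im_diagonal_limit)
  then show ?thesis using fin pos
  proof eventually_elim
    case (elim t)
    note onb = is_onb_some_onb[OF B]
    have ind: "etrace B' (\<Xi> t) = etrace B (\<Xi> t)" if "is_onb B'" for B'
      by (rule etrace_basis_independent[OF that countable_onb[OF sep that] B countable_onb[OF sep B] ops elim(3)])
    show ?case
    proof (intro exI conjI ballI)
      fix j assume j: "j \<in> J"
      have "((\<lambda>\<epsilon>. complex_of_real (1 / pi) * cinner (op_Im (L (Complex t \<epsilon>)) (\<phi> j)) (\<phi> j))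
          \<longlongrightarrow> complex_of_real (1 / pi) * cinner ((pi *\<^sub>R \<Xi> t) (\<phi> j)) (\<phi> j)) (at_right 0)"
        by (intro tendsto_mult_left bspec[OF elim(1) j])
      also have "complex_of_real (1 / pi) * cinner ((pi *\<^sub>R \<Xi> t) (\<phi> j)) (\<phi> j) = cinner (\<Xi> t (\<phi> j)) (\<phi> j)"
        by (simp add: blinfun.scaleR_left cinner_simps scaleR_conv_of_real)
      finally show "((\<lambda>\<epsilon>. complex_of_real (1 / pi) * cinner (op_Im (L (Complex t \<epsilon>)) (\<phi> j)) (\<phi> j))
          \<longlongrightarrow> cinner (\<Xi> t (\<phi> j)) (\<phi> j)) (at_right 0)" .
    next
      have "((\<lambda>e. cinner (\<Xi> t e) e) has_sum op_trace (\<Xi> t)) (\<phi> ` J)"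
        using positive_has_sum_etrace(2)[of "\<phi> ` J" "\<Xi> t"] op_trace_positive[of "\<Xi> t"] elim
        by (simp add: ind[OF \<phi>(2)] ind[OF onb])
      then show "((\<lambda>j. cinner (\<Xi> t (\<phi> j)) (\<phi> j)) has_sum op_trace (\<Xi> t)) J"
        using iffD1[OF has_sum_reindex[OF \<phi>(1)]] unfolding o_def by blast
    qed
  qed
qed

text \<open>Only the weight of the first derivative decays slowly enough to dominate \<open>1 / (1 + t\<^sup>2)\<close>.\<close>
lemma second_order_weight:
  assumes sep: "separable_space (euclidean :: 'a topology)" and B: "is_onb (B :: 'a set)"
    and fin: "(\<integral>\<^sup>+t. ennreal (1 / (t - \<zeta>) ^ 2) * etrace B (\<Xi> t) \<partial>lebesgue) < \<infinity>"
  shows "(\<integral>\<^sup>+t. ennreal (1 / (1 + t\<^sup>2)) * etrace B (\<Xi> t) \<partial>lebesgue) < \<infinity>"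
proof -
  have [measurable]: "(\<lambda>t. etrace B (\<Xi> t)) \<in> borel_measurable lebesgue"
    by (rule measurable_etrace[OF countable_onb[OF sep B]])
  have [measurable]: "(\<lambda>t::real. 1 / (t - \<zeta>)\<^sup>2) \<in> borel_measurable lebesgue"
    by (rule measurable_completion) measurable
  define c where "c = 2 + 2 * \<zeta>\<^sup>2"
  have c: "c \<ge> 0" by (simp add: c_def)
  have "(\<integral>\<^sup>+t. ennreal (1 / (1 + t\<^sup>2)) * etrace B (\<Xi> t) \<partial>lebesgue)
      \<le> (\<integral>\<^sup>+t. ennreal c * (ennreal (1 / (t - \<zeta>)\<^sup>2) * etrace B (\<Xi> t)) \<partial>lebesgue)"
  proof (rule nn_integral_mono_AE)
    show "AE t in lebesgue. ennreal (1 / (1 + t\<^sup>2)) * etrace B (\<Xi> t) \<le> ennreal c * (ennreal (1 / (t - \<zeta>)\<^sup>2) * etrace B (\<Xi> t))"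
      using AE_neq[of \<zeta>]
    proof eventually_elim
      case (elim t)
      have "0 \<le> (t + \<zeta>)\<^sup>2 + 2 * (1 + \<zeta>\<^sup>2 * t\<^sup>2)" by simp
      then have "(t - \<zeta>)\<^sup>2 \<le> c * (1 + t\<^sup>2)" by (simp add: c_def power2_eq_square algebra_simps)
      moreover have "0 < (t - \<zeta>)\<^sup>2" "0 < 1 + t\<^sup>2" using elim by (simp_all add: add_pos_nonneg)
      ultimately have "1 / (1 + t\<^sup>2) \<le> c * (1 / (t - \<zeta>)\<^sup>2)" by (simp add: field_simps)
      then have "ennreal (1 / (1 + t\<^sup>2)) \<le> ennreal c * ennreal (1 / (t - \<zeta>)\<^sup>2)"
        using c by (subst ennreal_mult[symmetric]) (auto intro: ennreal_leI)
      then show ?case unfolding mult.assoc[symmetric] by (rule mult_right_mono) simp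
    qed
  qed
  also have "\<dots> = ennreal c * (\<integral>\<^sup>+t. ennreal (1 / (t - \<zeta>)\<^sup>2) * etrace B (\<Xi> t) \<partial>lebesgue)"
    by (rule nn_integral_cmult) measurable
  also have "\<dots> < \<infinity>" using fin by (simp add: ennreal_mult_less_top)
  finally show ?thesis .
qed

text \<open>Integrability of the trace of the density against \<open>dt / (1 + t\<^sup>2)\<close> is what its Poisson integrals, that
  is the traces of \<open>Im L\<close>, require.\<close>

context
  fixes B :: "'a set"
  assumes sep: "separable_space (euclidean :: 'a topology)" and B: "is_onb B"
    and fin: "(\<integral>\<^sup>+t. ennreal (1 / (1 + t\<^sup>2)) * etrace B (\<Xi> t) \<partial>lebesgue) < \<infinity>"
begin

lemma etrace_finite: "AE t in lebesgue. etrace B (\<Xi> t) < \<infinity>"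
proof -
  have [measurable]: "(\<lambda>t. etrace B (\<Xi> t)) \<in> borel_measurable lebesgue"
    by (rule measurable_etrace[OF countable_onb[OF sep B]])
  have [measurable]: "(\<lambda>t::real. 1 / (1 + t\<^sup>2)) \<in> borel_measurable lebesgue"
    by (rule measurable_completion) measurable
  have "AE t in lebesgue. ennreal (1 / (1 + t\<^sup>2)) * etrace B (\<Xi> t) \<noteq> \<infinity>"
  proof (rule nn_integral_PInf_AE)
    show "(\<lambda>t. ennreal (1 / (1 + t\<^sup>2)) * etrace B (\<Xi> t)) \<in> borel_measurable lebesgue" by measurable
  qed (use fin in simp)
  then show ?thesis
  proof eventually_elim
    case (elim t)
    have "ennreal (1 / (1 + t\<^sup>2)) > 0" by (simp add: ennreal_less_zero_iff add_pos_nonneg)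
    then show ?case using elim by (auto simp: ennreal_mult_eq_top_iff less_top)
  qed
qed

definition density_trace :: "real \<Rightarrow> real" where
  "density_trace t = enn2real (etrace B (\<Xi> t))"

lemma measurable_density_trace: "density_trace \<in> borel_measurable lebesgue"
  unfolding density_trace_def using measurable_etrace[OF countable_onb[OF sep B]] by measurable

lemma weighted_density_trace:
  assumes g: "\<And>t. g t \<ge> 0" and [measurable]: "g \<in> borel_measurable lebesgue"
    and le: "\<And>t. g t \<le> c * (1 / (1 + t\<^sup>2))"
  shows "integrable lebesgue (\<lambda>t. g t * density_trace t)"
    "(\<integral>\<^sup>+t. ennreal (g t) * etrace B (\<Xi> t) \<partial>lebesgue) = ennreal (LINT t|lebesgue. g t * density_trace t)"
proof -
  have [measurable]: "(\<lambda>t. etrace B (\<Xi> t)) \<in> borel_measurable lebesgue"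
    by (rule measurable_etrace[OF countable_onb[OF sep B]])
  have [measurable]: "(\<lambda>t::real. 1 / (1 + t\<^sup>2)) \<in> borel_measurable lebesgue"
    by (rule measurable_completion) measurable
  have [measurable]: "density_trace \<in> borel_measurable lebesgue" by (rule measurable_density_trace)
  have c: "c \<ge> 0" using order_trans[OF g le[of 0]] by simp
  have eq: "(\<integral>\<^sup>+t. ennreal (g t) * etrace B (\<Xi> t) \<partial>lebesgue) = (\<integral>\<^sup>+t. ennreal (g t * density_trace t) \<partial>lebesgue)"
  proof (rule nn_integral_cong_AE)
    show "AE t in lebesgue. ennreal (g t) * etrace B (\<Xi> t) = ennreal (g t * density_trace t)"
      using etrace_finite by eventually_elim (simp add: density_trace_def ennreal_mult g)
  qed
  have "(\<integral>\<^sup>+t. ennreal (g t) * etrace B (\<Xi> t) \<partial>lebesgue)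
      \<le> (\<integral>\<^sup>+t. ennreal c * (ennreal (1 / (1 + t\<^sup>2)) * etrace B (\<Xi> t)) \<partial>lebesgue)"
  proof (rule nn_integral_mono)
    fix t
    have "ennreal (g t) \<le> ennreal c * ennreal (1 / (1 + t\<^sup>2))"
      using c le[of t] by (subst ennreal_mult[symmetric]) (auto intro: ennreal_leI)
    then show "ennreal (g t) * etrace B (\<Xi> t) \<le> ennreal c * (ennreal (1 / (1 + t\<^sup>2)) * etrace B (\<Xi> t))"
      unfolding mult.assoc[symmetric] by (rule mult_right_mono) simp
  qed
  also have "\<dots> = ennreal c * (\<integral>\<^sup>+t. ennreal (1 / (1 + t\<^sup>2)) * etrace B (\<Xi> t) \<partial>lebesgue)"
    by (rule nn_integral_cmult) measurable
  also have "\<dots> < \<infinity>" using fin by (simp add: ennreal_mult_less_top)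
  finally have f: "(\<integral>\<^sup>+t. ennreal (g t * density_trace t) \<partial>lebesgue) < \<infinity>" by (simp add: eq)
  have nn: "0 \<le> g t * density_trace t" for t by (simp add: density_trace_def g)
  show i: "integrable lebesgue (\<lambda>t. g t * density_trace t)"
    by (rule integrableI_nonneg) (use f nn in auto)
  show "(\<integral>\<^sup>+t. ennreal (g t) * etrace B (\<Xi> t) \<partial>lebesgue) = ennreal (LINT t|lebesgue. g t * density_trace t)"
    unfolding eq by (rule nn_integral_eq_integral[OF i]) (use nn in auto)
qed

lemma etrace_op_Im:
  assumes z: "Im z > 0"
  shows "etrace B (op_Im (L z)) = ennreal (LINT t|lebesgue. Im z / ((t - Re z)\<^sup>2 + (Im z)\<^sup>2) * density_trace t)"
proof -
  have "etrace B (op_Im (L z)) = (\<integral>\<^sup>+t. ennreal (Im z / ((t - Re z)\<^sup>2 + (Im z)\<^sup>2)) * etrace B (\<Xi> t) \<partial>lebesgue)"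
    by (rule etrace_weak_integral[OF op_Im_weak_integral[OF z] _ measurable_kernel countable_onb[OF sep B]])
      (use z in simp)
  also have "\<dots> = ennreal (LINT t|lebesgue. Im z / ((t - Re z)\<^sup>2 + (Im z)\<^sup>2) * density_trace t)"
    by (rule weighted_density_trace(2)[OF _ measurable_kernel poisson_kernel_le[OF z]]) (use z in simp)
  finally show ?thesis .
qed

lemma trace_class_op_Im: "Im z > 0 \<Longrightarrow> trace_class (op_Im (L z))"
  by (rule trace_class_positiveI[OF op_Im_bounded_ops op_Im_nonneg B]) (simp_all add: etrace_op_Im)

lemma density_trace_limit:
  "AE t in lebesgue. ((\<lambda>\<epsilon>. LINT s|lebesgue. \<epsilon> / ((s - t)\<^sup>2 + \<epsilon>\<^sup>2) * density_trace s) \<longlongrightarrow> pi * density_trace t) (at_right 0)"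
proof (rule poisson_limit_AE[OF measurable_density_trace])
  have k: "(\<lambda>t::real. 1 / (1 + t\<^sup>2)) \<in> borel_measurable lebesgue"
    by (rule measurable_completion) measurable
  have "integrable lebesgue (\<lambda>s. 1 / (1 + s\<^sup>2) * density_trace s)"
    by (rule weighted_density_trace(1)[OF _ k, of 1]) auto
  then show "integrable lebesgue (\<lambda>s. density_trace s / (1 + s\<^sup>2))" by simp
qed (simp add: density_trace_def)

lemma entrywise_limit:
  assumes F: "countable F"
  shows "AE t in lebesgue. \<forall>e\<in>F. \<forall>f\<in>F.
    ((\<lambda>\<epsilon>. cinner (op_Im (L (Complex t \<epsilon>)) e) f) \<longlongrightarrow> cinner ((pi *\<^sub>R \<Xi> t) e) f) (at_right 0)"
proof -
  let ?lim = "\<lambda>t w. ((\<lambda>\<epsilon>. cinner (op_Im (L (Complex t \<epsilon>)) w) w) \<longlongrightarrow> cinner ((pi *\<^sub>R \<Xi> t) w) w) (at_right 0)"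
  have "AE t in lebesgue. \<forall>e\<in>F. \<forall>f\<in>F. ?lim t (e + f) \<and> ?lim t (e - f) \<and> ?lim t (e + \<i> *\<^sub>C f) \<and> ?lim t (e - \<i> *\<^sub>C f)"
    by (simp only: AE_ball_countable[OF F] AE_conj_iff) (intro ballI conjI op_Im_diagonal_limit)
  then show ?thesis
  proof eventually_elim
    case (elim t)
    show ?case
    proof (intro ballI)
      fix e f assume ef: "e \<in> F" "f \<in> F"
      let ?q = "\<lambda>A w. cinner ((A :: 'a \<Rightarrow>\<^sub>L 'a) w) w"
      let ?p = "\<lambda>A. (?q A (e + f) - ?q A (e - f) + \<i> * ?q A (e + \<i> *\<^sub>C f) - \<i> * ?q A (e - \<i> *\<^sub>C f)) / 4"
      have pol: "cinner (A e) f = ?p A" if "A \<in> bounded_ops" for A :: "'a \<Rightarrow>\<^sub>L 'a"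
        using polarization[OF that, of e f] by (simp add: mult.commute[of _ 4])
      have lim: "((\<lambda>\<epsilon>. ?p (op_Im (L (Complex t \<epsilon>)))) \<longlongrightarrow> ?p (pi *\<^sub>R \<Xi> t)) (at_right 0)"
        using elim ef by (intro tendsto_intros) auto
      have ev: "\<forall>\<^sub>F \<epsilon> in at_right 0. ?p (op_Im (L (Complex t \<epsilon>))) = cinner (op_Im (L (Complex t \<epsilon>)) e) f"
        unfolding eventually_at_filter
        by (rule always_eventually) (use pol op_Im_bounded_ops in simp)
      have eq: "?p (pi *\<^sub>R \<Xi> t) = cinner ((pi *\<^sub>R \<Xi> t) e) f"
        by (rule pol[symmetric]) (intro bounded_ops_intros ops)
      show "((\<lambda>\<epsilon>. cinner (op_Im (L (Complex t \<epsilon>)) e) f) \<longlongrightarrow> cinner ((pi *\<^sub>R \<Xi> t) e) f) (at_right 0)"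
        using Lim_transform_eventually[OF lim ev] unfolding eq .
    qed
  qed
qed

end

text \<open>The entries of \<open>Im L(t + i \<epsilon>)\<close> and its trace are Poisson integrals of the entries and of the trace of
  \<open>\<Xi>\<close>, so at almost every \<open>t\<close> both converge and the non-commutative Scheffe lemma applies.\<close>
lemma trace_norm_boundary_values:
  assumes sep: "separable_space (euclidean :: 'a topology)" and B: "is_onb (some_onb :: 'a set)"
    and fin: "(\<integral>\<^sup>+t. ennreal (1 / (1 + t\<^sup>2)) * etrace some_onb (\<Xi> t) \<partial>lebesgue) < \<infinity>"
  shows "AE t in lebesgue. \<exists>S. trace_class S \<and>
     ((\<lambda>\<epsilon>. trace_norm (op_Im (L (Complex t \<epsilon>)) - S)) \<longlongrightarrow> 0) (at_right 0) \<and>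
     op_trace (\<Xi> t) = complex_of_real (1 / pi) * op_trace S"
  using etrace_finite[OF sep B fin] density_trace_limit[OF sep B fin]
    entrywise_limit[OF sep B fin countable_onb[OF sep B]] pos
proof eventually_elim
  case (elim t)
  let ?B = "some_onb :: 'a set" and ?\<tau> = "density_trace some_onb"
  define S where "S = pi *\<^sub>R \<Xi> t"
  have Sop: "S \<in> bounded_ops" unfolding S_def by (intro bounded_ops_intros ops)
  have Spos: "op_nonneg S" unfolding S_def by (intro op_nonneg_scaleR elim) simp
  have hs: "((\<lambda>e. cinner (S e) e) has_sum complex_of_real (pi * ?\<tau> t)) ?B"
    using has_sum_cmult_right[OF positive_has_sum_etrace(2)[OF elim(1,4)], of "complex_of_real pi"]
    by (simp add: S_def blinfun.scaleR_left cinner_simps scaleR_conv_of_real density_trace_def[OF sep B fin])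
  have hsR: "((\<lambda>e. Re (cinner (S e) e)) has_sum (pi * ?\<tau> t)) ?B"
    using has_sum_bounded_linear[OF bounded_linear_Re hs] by (simp add: o_def)
  have "trace_class S"
    unfolding trace_class_def op_abs_positive[OF Sop Spos] using Sop B hs by (auto simp: summable_on_def)
  moreover have "((\<lambda>\<epsilon>. trace_norm (op_Im (L (Complex t \<epsilon>)) - S)) \<longlongrightarrow> 0) (at_right 0)"
  proof (rule trace_norm_convergence[OF B countable_onb[OF sep B] _ Sop Spos hsR])
    show "((\<lambda>\<epsilon>. LINT s|lebesgue. \<epsilon> / ((s - t)\<^sup>2 + \<epsilon>\<^sup>2) * ?\<tau> s) \<longlongrightarrow> pi * ?\<tau> t) (at_right 0)" by (rule elim)
    show "((\<lambda>\<epsilon>. cinner (op_Im (L (Complex t \<epsilon>)) e) f) \<longlongrightarrow> cinner (S e) f) (at_right 0)"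
      if "e \<in> ?B" "f \<in> ?B" for e f using elim(3) that unfolding S_def by blast
    show "\<forall>\<^sub>F \<epsilon> in at_right 0. op_Im (L (Complex t \<epsilon>)) \<in> bounded_ops \<and> op_nonneg (op_Im (L (Complex t \<epsilon>))) \<and>
        ((\<lambda>e. Re (cinner (op_Im (L (Complex t \<epsilon>)) e) e)) has_sum (LINT s|lebesgue. \<epsilon> / ((s - t)\<^sup>2 + \<epsilon>\<^sup>2) * ?\<tau> s)) ?B"
      unfolding eventually_at_filter
    proof (rule always_eventually, intro allI impI conjI)
      fix \<epsilon> :: real assume "\<epsilon> \<noteq> 0" "\<epsilon> \<in> {0<..}"
      then have \<epsilon>: "\<epsilon> > 0" "Im (Complex t \<epsilon>) > 0" by auto
      show "op_Im (L (Complex t \<epsilon>)) \<in> bounded_ops" by (rule op_Im_bounded_ops[OF \<epsilon>(2)])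
      show nn: "op_nonneg (op_Im (L (Complex t \<epsilon>)))" by (rule op_Im_nonneg[OF \<epsilon>(2)])
      have e: "etrace ?B (op_Im (L (Complex t \<epsilon>))) = ennreal (LINT s|lebesgue. \<epsilon> / ((s - t)\<^sup>2 + \<epsilon>\<^sup>2) * ?\<tau> s)"
        using etrace_op_Im[OF sep B fin \<epsilon>(2)] by simp
      have "(LINT s|lebesgue. \<epsilon> / ((s - t)\<^sup>2 + \<epsilon>\<^sup>2) * ?\<tau> s) \<ge> 0"
        using \<epsilon> by (intro integral_nonneg_AE) (auto simp: density_trace_def[OF sep B fin])
      then show "((\<lambda>e. Re (cinner (op_Im (L (Complex t \<epsilon>)) e) e)) has_sum (LINT s|lebesgue. \<epsilon> / ((s - t)\<^sup>2 + \<epsilon>\<^sup>2) * ?\<tau> s)) ?B"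
        using positive_has_sum_etrace(1)[OF _ nn, of ?B] by (simp add: e)
    qed
  qed
  moreover have "op_trace (\<Xi> t) = complex_of_real (1 / pi) * op_trace S"
  proof -
    have "op_trace S = complex_of_real (pi * ?\<tau> t)" unfolding op_trace_def by (rule infsumI[OF hs])
    moreover have "op_trace (\<Xi> t) = complex_of_real (?\<tau> t)"
      by (simp add: op_trace_positive[OF elim(1,4)] density_trace_def[OF sep B fin])
    ultimately show ?thesis by simp
  qed
  ultimately show ?case by blast
qed

end

lemma op_Im_op_adj:
  assumes "A \<in> bounded_ops" shows "op_Im (op_adj A) = - op_Im A"
  by (rule blinfun_eqI)
    (simp add: op_Im_def op_adj_op_adj[OF assms] blinfun.diff_left blinfun.minus_left scaleC.diff_right)

lemma op_adj_op_Re: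
  assumes A: "A \<in> bounded_ops" shows "op_adj (op_Re A) = op_Re A"
proof -
  have "op_adj (op_Re A) = cnj (1 / 2) *\<^sub>C (op_adj A + op_adj (op_adj A))"
    unfolding op_Re_def
    by (simp only: op_adj_scaleC[OF bounded_ops_add[OF A op_adj_in_bounded_ops[OF A]]]
        op_adj_add[OF A op_adj_in_bounded_ops[OF A]])
  then show ?thesis by (simp add: op_Re_def op_adj_op_adj[OF A] add.commute)
qed

theorem proposition3p4:
  fixes N :: "complex \<Rightarrow> 'a::chilbert_space \<Rightarrow>\<^sub>L 'a"
    and I :: "real set"
    and C :: "'a \<Rightarrow>\<^sub>L 'a"
    and \<Xi> :: "real \<Rightarrow> 'a \<Rightarrow>\<^sub>L 'a"
  assumes "separable_space (euclidean :: 'a topology)"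
    and "nevanlinna N"
    and "\<exists>z. Im z \<noteq> 0 \<and> op_invertible (N z)"
    and "open I" and "is_interval I"
    and "admits_reflection_continuation N I"
    and "\<exists>\<epsilon>>0. \<forall>\<zeta>\<in>I. op_spectrum (refl_ext N I (complex_of_real \<zeta>)) \<subseteq> complex_of_real ` {\<epsilon><..}"
    and "C = op_Re (nev_log N \<i>)"
    and "\<forall>t. \<Xi> t \<in> bounded_ops" and "weakly_measurable \<Xi>"
    and "AE t in lebesgue. \<Xi> t = op_adj (\<Xi> t) \<and> op_le 0 (\<Xi> t) \<and> op_le (\<Xi> t) id_blinfun"
    and "\<forall>z. Im z \<noteq> 0 \<or> z \<in> complex_of_real ` I \<longrightarrow>
           has_weak_integral
             (\<lambda>t. (1 / (complex_of_real t - z) - complex_of_real (t / (1 + t\<^sup>2))) *\<^sub>C \<Xi> t)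
             (refl_ext (nev_log N) I z - C)"
    and "\<exists>k. \<exists>\<zeta>\<in>I. trace_class
           (nth_vector_derivative (2 * k + 1) (\<lambda>t. refl_ext (nev_log N) I (complex_of_real t)) \<zeta>)"
  shows
    "(AE t in lebesgue. op_le 0 (\<Xi> t) \<and> trace_class (\<Xi> t)) \<and>
     (\<forall>(J :: nat set) \<phi>. inj_on \<phi> J \<and> is_onb (\<phi> ` J) \<longrightarrow>
        (AE t in lebesgue. \<exists>l.
           (\<forall>j\<in>J. ((\<lambda>\<epsilon>. complex_of_real (1 / pi) * cinner (op_Im (nev_log N (Complex t \<epsilon>)) (\<phi> j)) (\<phi> j)) \<longlongrightarrow> l j)
              (at_right 0)) \<and>
           (l has_sum op_trace (\<Xi> t)) J)) \<and>
     ((\<exists>\<zeta>\<in>I. trace_class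
         (nth_vector_derivative 1 (\<lambda>t. refl_ext (nev_log N) I (complex_of_real t)) \<zeta>)) \<longrightarrow>
        (\<forall>z. Im z \<noteq> 0 \<longrightarrow> trace_class (op_Im (nev_log N z))) \<and>
        (AE t in lebesgue. \<exists>S. trace_class S \<and>
           ((\<lambda>\<epsilon>. trace_norm (op_Im (nev_log N (Complex t \<epsilon>)) - S)) \<longlongrightarrow> 0) (at_right 0) \<and>
           op_trace (\<Xi> t) = complex_of_real (1 / pi) * op_trace S))"
proof -
  note sep = assms(1) and N = assms(2) and inv = assms(3)
  define M where "M = refl_ext (nev_log N) I"
  obtain M0 where M0: "reflection_continuation (nev_log N) I M0"
    using assms(7) nev_log_reflection_continuation[OF N inv assms(6)] by metis
  have M_eq: "M z = M0 z" if "Im z \<noteq> 0 \<or> z \<in> complex_of_real ` I" for z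
    unfolding M_def by (rule refl_ext_eq[OF M0 that])
  have M0_eq: "M0 z = nev_log N z" if "Im z \<noteq> 0" for z
    using M0 that by (simp add: reflection_continuation_def)
  have log_ops: "nev_log N z \<in> bounded_ops" if "Im z \<noteq> 0" for z
    by (rule nev_log_bounded_ops[OF N inv that])
  interpret herglotz_representation \<Xi> "nev_log N" M C I
  proof
    show "\<Xi> t \<in> bounded_ops" for t using assms(9) by blast
    show "AE t in lebesgue. op_nonneg (\<Xi> t)"
      using assms(11) by eventually_elim (simp add: op_le_def)
    show "AE t in lebesgue. op_nonneg (id_blinfun - \<Xi> t)"
      using assms(11) by eventually_elim (simp add: op_le_def)
    show "C \<in> bounded_ops"
      unfolding assms(8) op_Re_def by (intro bounded_ops_intros op_adj_in_bounded_ops log_ops) simp_all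
    show "op_adj C = C" unfolding assms(8) by (rule op_adj_op_Re[OF log_ops]) simp
    show "has_weak_integral (\<lambda>t. (1 / (complex_of_real t - z) - complex_of_real (t / (1 + t\<^sup>2))) *\<^sub>C \<Xi> t) (nev_log N z - C)"
      if "Im z > 0" for z
    proof -
      have nz: "Im z \<noteq> 0" using that by simp
      have "refl_ext (nev_log N) I z = nev_log N z" using M_eq[of z] M0_eq[OF nz] nz by (simp add: M_def)
      then show ?thesis using assms(12)[rule_format, OF disjI1[OF nz]] by metis
    qed
    show "has_weak_integral (\<lambda>t. (1 / (complex_of_real t - complex_of_real \<zeta>) - complex_of_real (t / (1 + t\<^sup>2))) *\<^sub>C \<Xi> t)
        (M (complex_of_real \<zeta>) - C)" if "\<zeta> \<in> I" for \<zeta>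
      using assms(12) that unfolding M_def by blast
    show "((\<lambda>\<epsilon>. nev_log N (Complex \<zeta> \<epsilon>)) \<longlongrightarrow> M (complex_of_real \<zeta>)) (at_right 0)" if \<zeta>: "\<zeta> \<in> I" for \<zeta>
    proof -
      have "((\<lambda>\<epsilon>. M0 (Complex \<zeta> \<epsilon>)) \<longlongrightarrow> M0 (complex_of_real \<zeta>)) (at_right 0)"
        using reflection_continuation_tendsto[OF M0 \<zeta>] by (rule tendsto_mono[rotated]) (simp add: at_within_le_at)
      moreover have "\<forall>\<^sub>F \<epsilon> in at_right 0. M0 (Complex \<zeta> \<epsilon>) = nev_log N (Complex \<zeta> \<epsilon>)"
        unfolding eventually_at_filter by (rule always_eventually) (simp add: M0_eq)
      ultimately have "((\<lambda>\<epsilon>. nev_log N (Complex \<zeta> \<epsilon>)) \<longlongrightarrow> M0 (complex_of_real \<zeta>)) (at_right 0)"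
        by (rule Lim_transform_eventually)
      then show ?thesis using M_eq[of "complex_of_real \<zeta>"] \<zeta> by simp
    qed
    show "Im (cinner (M (complex_of_real \<zeta>) x) x) = 0" if \<zeta>: "\<zeta> \<in> I" for \<zeta> x
    proof -
      obtain U where "complex_of_real ` I \<subseteq> U" "\<forall>z\<in>{z. Im z > 0} \<union> U. M0 z \<in> bounded_ops"
        using M0 by (auto simp: reflection_continuation_def)
      then have op: "M0 (complex_of_real \<zeta>) \<in> bounded_ops" using \<zeta> by blast
      have "op_adj (M0 (complex_of_real \<zeta>)) = M0 (complex_of_real \<zeta>)"
        by (rule reflection_continuation_symmetric[OF M0 \<zeta> nev_log_reflection])
      then have "cinner (M0 (complex_of_real \<zeta>) x) x = cnj (cinner (M0 (complex_of_real \<zeta>) x) x)"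
        using cinner_op_adj[OF op, of x x] cinner_commute[of x "M0 (complex_of_real \<zeta>) x"] by simp
      then show ?thesis using M_eq[of "complex_of_real \<zeta>"] \<zeta> by (simp add: complex_eq_iff)
    qed
  qed (use assms(4,10) log_ops in auto)
  obtain k \<zeta> where \<zeta>: "\<zeta> \<in> I"
    and tc: "trace_class (nth_vector_derivative (2 * k + 1) (\<lambda>t. M (complex_of_real t)) \<zeta>)"
    using assms(13) unfolding M_def by blast
  have onb: "is_onb (some_onb :: 'a set)"
    using tc is_onb_some_onb unfolding trace_class_def by blast
  have fin: "AE t in lebesgue. etrace some_onb (\<Xi> t) < \<infinity>"
    by (rule trace_finite_AE[OF sep onb weighted_trace_finite[OF sep onb \<zeta> tc]])
  have "AE t in lebesgue. op_le 0 (\<Xi> t) \<and> trace_class (\<Xi> t)"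
    using pos fin by eventually_elim (simp add: op_le_def trace_class_positiveI[OF ops _ onb])
  moreover have "AE t in lebesgue. \<exists>l.
           (\<forall>j\<in>J. ((\<lambda>\<epsilon>. complex_of_real (1 / pi) * cinner (op_Im (nev_log N (Complex t \<epsilon>)) (\<phi> j)) (\<phi> j)) \<longlongrightarrow> l j)
              (at_right 0)) \<and> (l has_sum op_trace (\<Xi> t)) J"
    if "inj_on \<phi> J" "is_onb (\<phi> ` J)" for J :: "nat set" and \<phi>
    by (rule diagonal_limits_trace[OF sep onb fin that])
  moreover have "(\<forall>z. Im z \<noteq> 0 \<longrightarrow> trace_class (op_Im (nev_log N z))) \<and>
        (AE t in lebesgue. \<exists>S. trace_class S \<and>
           ((\<lambda>\<epsilon>. trace_norm (op_Im (nev_log N (Complex t \<epsilon>)) - S)) \<longlongrightarrow> 0) (at_right 0) \<and>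
           op_trace (\<Xi> t) = complex_of_real (1 / pi) * op_trace S)"
    if hyp: "\<exists>\<zeta>\<in>I. trace_class (nth_vector_derivative 1 (\<lambda>t. refl_ext (nev_log N) I (complex_of_real t)) \<zeta>)"
  proof -
    obtain \<eta> where \<eta>: "\<eta> \<in> I" "trace_class (nth_vector_derivative (2 * 0 + 1) (\<lambda>t. M (complex_of_real t)) \<eta>)"
      using hyp unfolding M_def by auto
    have fin2: "(\<integral>\<^sup>+t. ennreal (1 / (1 + t\<^sup>2)) * etrace some_onb (\<Xi> t) \<partial>lebesgue) < \<infinity>"
      by (rule second_order_weight[OF sep onb]) (use weighted_trace_finite[OF sep onb \<eta>] in \<open>simp add: numeral_2_eq_2\<close>)
    have up: "trace_class (op_Im (nev_log N z))" if "Im z > 0" for z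
      by (rule trace_class_op_Im[OF sep onb fin2 that])
    have "trace_class (op_Im (nev_log N z))" if z: "Im z \<noteq> 0" for z
    proof (cases "Im z > 0")
      case False
      then have neg: "Im z < 0" and pz: "Im (cnj z) > 0" using z by auto
      have "op_Im (nev_log N z) = - op_Im (nev_log N (cnj z))"
        using nev_log_reflection[OF neg, of N] op_Im_op_adj[OF log_ops[of "cnj z"]] pz by simp
      then show ?thesis
        using trace_class_uminusI[OF op_Im_bounded_ops[OF pz] op_Im_nonneg[OF pz] up[OF pz]] by simp
    qed (rule up)
    then show ?thesis using trace_norm_boundary_values[OF sep onb fin2] by blast
  qed
  ultimately show ?thesis by blast
qed

end
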